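(* Let $A[1..N]$ be an array of anchors satisfying the Equal Match Length property ($I.b-I.a=I.d-I.c$ for every anchor $I$). Then the values $\max_{S}\mathtt{coverage}(S)$, where $S$ ranges over all weak chains ending at $A[i]$, can be computed for all $i$, $1\le i\le N$, in $O(N\log N)$ time.
   Context: An anchor is an interval pair $I=([I.a..I.b],[I.c..I.d])$ with positive integer endpoints, $I.a\le I.b$, $I.c\le I.d$. Weak precedence: $I'\prec^w I$ iff $I'.a<I.a$ and $I'.c<I.c$. A weak chain ending at $A[i]$ is a sequence $S[1..n]$ ($n\ge1$) of anchors from $A$ with $S[j-1]\prec^w S[j]$ for all $1<j\le n$ and $S[n]=A[i]$. Its symmetric (weakly) ordered coverage is \[ \mathtt{coverage}(S)=\sum_{j=1}^{n-1}\min\Big(\min(S[j+1].a,S[j].b+1)-S[j].a,\ \min(S[j+1].c,S[j].d+1)-S[j].c\Big)+\min\big(S[n].b-S[n].a+1,\ S[n].d-S[n].c+1\big). \] *)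

theory Defs
  imports Complex_Main "HOL-Library.Landau_Symbols"
begin

section \<open>Anchors, weak chains and symmetric coverage\<close>

datatype anchor = Anchor (I_a: int) (I_b: int) (I_c: int) (I_d: int)

definition valid_anchor :: "anchor \<Rightarrow> bool" where
  "valid_anchor I \<longleftrightarrow>
     0 < I_a I \<and> 0 < I_b I \<and> 0 < I_c I \<and> 0 < I_d I \<and> I_a I \<le> I_b I \<and> I_c I \<le> I_d I"

definition equal_match_length :: "anchor list \<Rightarrow> bool" where
  "equal_match_length A \<longleftrightarrow> (\<forall>I\<in>set A. I_b I - I_a I = I_d I - I_c I)"

definition weak_prec :: "anchor \<Rightarrow> anchor \<Rightarrow> bool"  (infix "\<prec>w" 50) where
  "I' \<prec>w I \<longleftrightarrow> I_a I' < I_a I \<and> I_c I' < I_c I"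

text \<open>Lists are indexed from 0, so \<open>A ! i\<close> is the \<open>(i+1)\<close>-st anchor of the array.\<close>

definition weak_chain_ending_at :: "anchor list \<Rightarrow> nat \<Rightarrow> anchor list \<Rightarrow> bool" where
  "weak_chain_ending_at A i S \<longleftrightarrow>
     S \<noteq> [] \<and> set S \<subseteq> set A \<and>
     (\<forall>j. Suc j < length S \<longrightarrow> S ! j \<prec>w S ! Suc j) \<and>
     last S = A ! i"

definition coverage :: "anchor list \<Rightarrow> int" where
  "coverage S =
     (\<Sum>j<length S - 1.
        min (min (I_a (S ! Suc j)) (I_b (S ! j) + 1) - I_a (S ! j))
            (min (I_c (S ! Suc j)) (I_d (S ! j) + 1) - I_c (S ! j)))
     + min (I_b (last S) - I_a (last S) + 1) (I_d (last S) - I_c (last S) + 1)"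

definition max_coverage :: "anchor list \<Rightarrow> nat \<Rightarrow> int" where
  "max_coverage A i = Max {coverage S | S. weak_chain_ending_at A i S}"

text \<open>The maximum is taken over a finite nonempty set.\<close>

lemma weak_chain_distinct:
  assumes "\<forall>j. Suc j < length S \<longrightarrow> S ! j \<prec>w S ! Suc j"
  shows "distinct S"
proof -
  have "transp (\<lambda>I J. I_a I < I_a J)"
    by (rule transpI) simp
  then have "sorted_wrt (\<lambda>I J. I_a I < I_a J) S"
    using assms by (subst sorted_wrt_iff_nth_Suc_transp) (auto simp: weak_prec_def)
  then show ?thesis
    by (induction S) auto
qed

lemma finite_coverages: "finite {coverage S | S. weak_chain_ending_at A i S}"
proof -
  have "{S. weak_chain_ending_at A i S} \<subseteq> {S. set S \<subseteq> set A \<and> distinct S}"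
    using weak_chain_distinct by (auto simp: weak_chain_ending_at_def)
  then have "finite {S. weak_chain_ending_at A i S}"
    using finite_subset_distinct[of "set A"] finite_subset by auto
  then show ?thesis by simp
qed

lemma coverages_nonempty:
  "i < length A \<Longrightarrow> {coverage S | S. weak_chain_ending_at A i S} \<noteq> {}"
  by (auto simp: weak_chain_ending_at_def intro!: exI[of _ "[A ! i]"])


section \<open>A word RAM\<close>

text \<open>
  Running time is measured on a word RAM whose programs are presented in structured form: finitely
  many integer registers and random-access arrays (a program mentions only finitely many names, so
  its arrays can be interleaved in a single memory). The arithmetic is addition, subtraction and
  shifting right by one bit. Every operation, memory access and test has unit cost.
\<close>

datatype aexp =
    Const int
  | Reg string
  | Load string aexp
  | Plus aexp aexp
  | Minus aexp aexp
  | Half aexp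

datatype bexp =
    Less aexp aexp
  | Eq aexp aexp
  | BNot bexp
  | BAnd bexp bexp

datatype com =
    Skip
  | Assign string aexp
  | Store string aexp aexp
  | Seq com com
  | Cond bexp com com
  | While bexp com

record state =
  regs :: "string \<Rightarrow> int"
  arrs :: "string \<Rightarrow> int \<Rightarrow> int"

fun aval :: "aexp \<Rightarrow> state \<Rightarrow> int" where
  "aval (Const n) s = n"
| "aval (Reg x) s = regs s x"
| "aval (Load X e) s = arrs s X (aval e s)"
| "aval (Plus e f) s = aval e s + aval f s"
| "aval (Minus e f) s = aval e s - aval f s"
| "aval (Half e) s = aval e s div 2"

fun bval :: "bexp \<Rightarrow> state \<Rightarrow> bool" where
  "bval (Less e f) s \<longleftrightarrow> aval e s < aval f s"
| "bval (Eq e f) s \<longleftrightarrow> aval e s = aval f s"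
| "bval (BNot b) s \<longleftrightarrow> \<not> bval b s"
| "bval (BAnd b c) s \<longleftrightarrow> bval b s \<and> bval c s"

fun acost :: "aexp \<Rightarrow> nat" where
  "acost (Const n) = 1"
| "acost (Reg x) = 1"
| "acost (Load X e) = 1 + acost e"
| "acost (Plus e f) = 1 + acost e + acost f"
| "acost (Minus e f) = 1 + acost e + acost f"
| "acost (Half e) = 1 + acost e"

fun bcost :: "bexp \<Rightarrow> nat" where
  "bcost (Less e f) = 1 + acost e + acost f"
| "bcost (Eq e f) = 1 + acost e + acost f"
| "bcost (BNot b) = 1 + bcost b"
| "bcost (BAnd b c) = 1 + bcost b + bcost c"

text \<open>
  \<open>exec W c s t s'\<close>: started in \<open>s\<close>, the program \<open>c\<close> halts in \<open>s'\<close> after \<open>t\<close> unit-cost steps, and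
  every value written is at most \<open>W\<close> in absolute value (there is no derivation if a word
  overflows). Only stored values are constrained: the expressions of a fixed program have bounded
  size, so their intermediate values, addresses included, exceed the stored ones and the constants
  of the program by at most a constant factor.
\<close>

inductive exec :: "int \<Rightarrow> com \<Rightarrow> state \<Rightarrow> nat \<Rightarrow> state \<Rightarrow> bool" for W :: int where
  Skip: "exec W Skip s 1 s"
| Assign: "\<bar>aval e s\<bar> \<le> W \<Longrightarrow>
    exec W (Assign x e) s (1 + acost e) (s\<lparr>regs := (regs s)(x := aval e s)\<rparr>)"
| Store: "\<bar>aval f s\<bar> \<le> W \<Longrightarrow>
    exec W (Store X e f) s (1 + acost e + acost f)
      (s\<lparr>arrs := (arrs s)(X := (arrs s X)(aval e s := aval f s))\<rparr>)"
| Seq: "exec W c1 s t1 s' \<Longrightarrow> exec W c2 s' t2 s'' \<Longrightarrow> exec W (Seq c1 c2) s (t1 + t2) s''"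
| CondTrue: "bval b s \<Longrightarrow> exec W c1 s t s' \<Longrightarrow> exec W (Cond b c1 c2) s (1 + bcost b + t) s'"
| CondFalse: "\<not> bval b s \<Longrightarrow> exec W c2 s t s' \<Longrightarrow> exec W (Cond b c1 c2) s (1 + bcost b + t) s'"
| WhileFalse: "\<not> bval b s \<Longrightarrow> exec W (While b c) s (1 + bcost b) s"
| WhileTrue: "bval b s \<Longrightarrow> exec W c s t s' \<Longrightarrow> exec W (While b c) s' t' s'' \<Longrightarrow>
    exec W (While b c) s (1 + bcost b + t + t') s''"

inductive_cases SkipE: "exec W Skip s t s'"
inductive_cases AssignE: "exec W (Assign x e) s t s'"
inductive_cases StoreE: "exec W (Store X e f) s t s'"
inductive_cases SeqE: "exec W (Seq c1 c2) s t s'"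
inductive_cases CondE: "exec W (Cond b c1 c2) s t s'"
inductive_cases WhileE: "exec W (While b c) s t s'"

lemma exec_deterministic:
  "exec W c s t s' \<Longrightarrow> exec W c s u s'' \<Longrightarrow> u = t \<and> s'' = s'"
proof (induction arbitrary: u s'' rule: exec.induct)
  case (Skip s)
  then show ?case by (auto elim: SkipE)
next
  case (Assign e s x)
  from Assign.prems show ?case by (rule AssignE) simp
next
  case (Store f s X e)
  from Store.prems show ?case by (rule StoreE) simp
next
  case (Seq c1 s t1 s1 c2 t2 s2)
  from Seq.prems show ?case
  proof (rule SeqE)
    fix v1 r v2
    assume u: "u = v1 + v2" and 1: "exec W c1 s v1 r" and 2: "exec W c2 r v2 s''"
    from Seq.IH(1)[OF 1] have "v1 = t1" "r = s1" by auto
    with Seq.IH(2) 2 u show ?thesis by blast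
  qed
next
  case (CondTrue b s c1 t s1 c2)
  from CondTrue.prems show ?case
    by (rule CondE) (simp_all add: CondTrue.hyps(1) CondTrue.IH)
next
  case (CondFalse b s c2 t s1 c1)
  from CondFalse.prems show ?case
    by (rule CondE) (simp_all add: CondFalse.hyps(1) CondFalse.IH)
next
  case (WhileFalse b s c)
  from WhileFalse.prems show ?case
    by (rule WhileE) (simp_all add: WhileFalse.hyps)
next
  case (WhileTrue b s c t s1 t' s2)
  from WhileTrue.prems show ?case
  proof (rule WhileE)
    assume "\<not> bval b s"
    with WhileTrue.hyps(1) show ?thesis by simp
  next
    fix v r v'
    assume u: "u = Suc (bcost b + v + v')"
      and 1: "exec W c s v r" and 2: "exec W (While b c) r v' s''"
    from WhileTrue.IH(1)[OF 1] have "v = t" "r = s1" by auto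
    moreover from 2 have "v' = t' \<and> s'' = s2"
      unfolding \<open>r = s1\<close> by (rule WhileTrue.IH(2))
    ultimately show ?thesis using u by simp
  qed
qed

text \<open>
  Input: the register \<open>N\<close> holds the number of anchors, and the arrays \<open>a\<close>, \<open>b\<close>, \<open>c\<close>, \<open>d\<close> hold
  their endpoints at the indices \<open>0, ..., N - 1\<close>; everything else is 0.
\<close>

definition input_array :: "(anchor \<Rightarrow> int) \<Rightarrow> anchor list \<Rightarrow> int \<Rightarrow> int" where
  "input_array f A k = (if 0 \<le> k \<and> k < int (length A) then f (A ! nat k) else 0)"

definition input_state :: "anchor list \<Rightarrow> state" where
  "input_state A =
     \<lparr>regs = (\<lambda>x. 0)(''N'' := int (length A)),
      arrs = (\<lambda>X k. 0)(''a'' := input_array I_a A, ''b'' := input_array I_b A,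
                       ''c'' := input_array I_c A, ''d'' := input_array I_d A)\<rparr>"

text \<open>
  A word size of \<open>O(log (N + M))\<close> bits, where \<open>M\<close> is the largest endpoint, allows absolute values up
  to a fixed power of \<open>N + M + 2\<close>. Right endpoints suffice for \<open>M\<close> if the anchors are valid.
\<close>

definition max_endpoint :: "anchor list \<Rightarrow> int" where
  "max_endpoint A = Max (insert 0 (I_b ` set A \<union> I_d ` set A))"

definition word_bound :: "nat \<Rightarrow> anchor list \<Rightarrow> int" where
  "word_bound k A = (int (length A) + max_endpoint A + 2) ^ k"

end

theory Submission
  imports Defs "HOL-Real_Asymp.Real_Asymp"
begin

text \<open>
  Let \<open>D i\<close> be the maximal coverage of a chain ending at anchor \<open>i\<close> without the contribution of the
  last anchor. With \<open>V x y\<close>, the best value that a chain contributes below the point \<open>(x, y)\<close>, the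
  usual recurrence reads \<open>D i = V (a i) (c i)\<close>. By the equal match length property, anchors are
  diagonal segments, \<open>V\<close> is monotone, and \<open>V (x + t) (y + t) \<le> V x y + t\<close>. Hence an anchor \<open>j\<close> that
  overlaps the start of \<open>i\<close> in the row or column direction attains \<open>V\<close> where its diagonal meets the row
  or column of \<open>(a i, c i)\<close>, and monotonicity shows that among all such \<open>j\<close> on one side only the one on
  the nearest diagonal matters. Which one that is does not depend on \<open>D\<close>: two offline sweeps over the
  diagonals find it by stabbing queries. A third sweep over the first coordinate combines
  these two candidates with the best anchor that ends before \<open>i\<close> in both coordinates. Each
  sweep sorts \<open>2 N\<close> events and spends \<open>O(log N)\<close> on each of them.
\<close>

section \<open>The recurrence for the maximal coverage\<close>

text \<open>The obstacle is expiry. In a sweep over the first coordinate, an overlapping anchor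
  \<open>j\<close> is a candidate only while \<open>a i <= b j\<close>, so maximizing
  \<open>D j - a j\<close> directly would require deletions, while the trees used here can only
  raise values. Since the dominating overlapping anchor is determined by geometry alone, it can be
  found in the order of diagonals instead: there an anchor, once inserted, is admissible for every
  later query, and the remaining condition says that a one-dimensional interval contains the start
  of \<open>i\<close>. Only anchors that end before \<open>i\<close> are left to the sweep that
  computes \<open>D\<close>, and these never expire. Equal match length makes this work: it puts
  both ends of an anchor on one diagonal, so that the diagonal decides which of the two coordinates
  limits an overlap.\<close>

text \<open>Pointers are shifted by one, and 0 stands for the empty set.\<close>

definition nearest :: "int set \<Rightarrow> (int \<Rightarrow> int) \<Rightarrow> int \<Rightarrow> bool" where
  "nearest X f p \<longleftrightarrow> (if X = {} then p = 0 else p - 1 \<in> X \<and> (\<forall>j\<in>X. f j \<le> f (p - 1)))"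

locale anchors =
  fixes A :: "anchor list"
  assumes valid: "I \<in> set A \<Longrightarrow> valid_anchor I"
    and eml: "equal_match_length A"
begin

text \<open>Indices are integers and the coordinate functions are the input arrays of the machine
  themselves, so that facts about them apply to memory contents as they stand.\<close>

definition n :: int where "n = int (length A)"
definition a :: "int \<Rightarrow> int" where "a = input_array I_a A"
definition b :: "int \<Rightarrow> int" where "b = input_array I_b A"
definition c :: "int \<Rightarrow> int" where "c = input_array I_c A"
definition d :: "int \<Rightarrow> int" where "d = input_array I_d A"

abbreviation len :: "int \<Rightarrow> int" where "len i \<equiv> b i - a i + 1"

definition D :: "int \<Rightarrow> int" where "D i = max_coverage A (nat i) - len i"

text \<open>This is the summand of \<open>coverage\<close> that \<open>j\<close> keeps when the next
  anchor starts at \<open>(x, y)\<close>, with one \<open>len j\<close> serving both coordinates. It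
  is defined at arbitrary points because the domination argument evaluates it off the starts of
  anchors.\<close>

definition gain :: "int \<Rightarrow> int \<Rightarrow> int \<Rightarrow> int" where
  "gain j x y = min (len j) (min (x - a j) (y - c j))"

definition cands :: "int \<Rightarrow> int \<Rightarrow> int set" where
  "cands x y = {j \<in> {0..<n}. a j < x \<and> c j < y}"

text \<open>The inserted 0 is the empty chain, so that \<open>V\<close> is total and an anchor
  without predecessors needs no separate case.\<close>

definition V :: "int \<Rightarrow> int \<Rightarrow> int" where
  "V x y = Max (insert 0 ((\<lambda>j. D j + gain j x y) ` cands x y))"

section \<open>Chains and their coverage\<close>

lemma in_set: "j \<in> {0..<n} \<Longrightarrow> A ! nat j \<in> set A"
  by (auto simp: n_def)

lemma endpoint_simps:
  assumes "j \<in> {0..<n}"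
  shows "I_a (A ! nat j) = a j" "I_b (A ! nat j) = b j"
    "I_c (A ! nat j) = c j" "I_d (A ! nat j) = d j"
  using assms by (auto simp: n_def a_def b_def c_def d_def input_array_def)

lemma anchor_bounds:
  assumes "j \<in> {0..<n}"
  shows "0 < a j" "a j \<le> b j" "0 < c j" "c j \<le> d j" "d j = b j - a j + c j"
  using valid[OF in_set[OF assms]] eml in_set[OF assms] endpoint_simps[OF assms]
  by (auto simp: valid_anchor_def equal_match_length_def)

lemma finite_cands: "finite (cands x y)"
  by (rule finite_subset[of _ "{0..<n}"]) (auto simp: cands_def)

lemma V_nonneg: "0 \<le> V x y"
  by (simp add: V_def finite_cands)

lemma V_ge: "j \<in> cands x y \<Longrightarrow> D j + gain j x y \<le> V x y"
  by (auto simp: V_def finite_cands intro!: Max_ge)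

lemma V_le:
  "0 \<le> u \<Longrightarrow> (\<And>j. j \<in> cands x y \<Longrightarrow> D j + gain j x y \<le> u) \<Longrightarrow> V x y \<le> u"
  by (auto simp: V_def finite_cands)

text \<open>All summands but the last concern neighbours within \<open>S\<close>; appending an
  anchor exchanges the full length of \<open>last S\<close> for its truncated contribution and adds
  the full length of the new anchor.\<close>

lemma coverage_append:
  assumes "S \<noteq> []"
  shows "coverage (S @ [x]) = coverage S
    - min (I_b (last S) - I_a (last S) + 1) (I_d (last S) - I_c (last S) + 1)
    + min (min (I_a x) (I_b (last S) + 1) - I_a (last S))
          (min (I_c x) (I_d (last S) + 1) - I_c (last S))
    + min (I_b x - I_a x + 1) (I_d x - I_c x + 1)"
proof -
  define f where "f S j = min (min (I_a (S ! Suc j)) (I_b (S ! j) + 1) - I_a (S ! j))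
            (min (I_c (S ! Suc j)) (I_d (S ! j) + 1) - I_c (S ! j))" for S :: "anchor list" and j
  obtain l where l: "length S = Suc l" using assms by (cases S) auto
  have "(\<Sum>j<Suc l. f (S @ [x]) j) = (\<Sum>j<l. f (S @ [x]) j) + f (S @ [x]) l"
    by simp
  also have "(\<Sum>j<l. f (S @ [x]) j) = (\<Sum>j<l. f S j)"
    by (rule sum.cong) (auto simp: f_def nth_append l)
  finally show ?thesis
    using assms unfolding coverage_def f_def by (simp add: l nth_append last_conv_nth)
qed

lemma coverage_single: "coverage [x] = min (I_b x - I_a x + 1) (I_d x - I_c x + 1)"
  by (simp add: coverage_def)

lemma len_anchor:
  assumes "j \<in> {0..<n}"
  shows "min (I_b (A ! nat j) - I_a (A ! nat j) + 1) (I_d (A ! nat j) - I_c (A ! nat j) + 1) = len j"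
  using anchor_bounds[OF assms] endpoint_simps[OF assms] by simp

lemma coverage_extend:
  assumes S: "weak_chain_ending_at A (nat j) S" and j: "j \<in> {0..<n}" and i: "i \<in> {0..<n}"
  shows "coverage (S @ [A ! nat i]) = coverage S - len j + gain j (a i) (c i) + len i"
proof -
  have "S \<noteq> []" "last S = A ! nat j" using S by (auto simp: weak_chain_ending_at_def)
  then show ?thesis
    using coverage_append[of S "A ! nat i"] len_anchor[OF j] len_anchor[OF i]
      endpoint_simps[OF j] endpoint_simps[OF i] anchor_bounds[OF j]
    by (auto simp: gain_def min_def)
qed

text \<open>Chains consist of anchors, candidates are indices. Equal anchors may occur several times
  in \<open>A\<close>, so the index found for \<open>last S\<close> need not be unique, and only
  existence is claimed.\<close>

lemma chain_extend_iff:
  assumes "S \<noteq> []" "i \<in> {0..<n}"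
  shows "weak_chain_ending_at A (nat i) (S @ [A ! nat i]) \<longleftrightarrow>
    (\<exists>j \<in> cands (a i) (c i). weak_chain_ending_at A (nat j) S)" (is "?L = ?R")
proof
  assume L: ?L
  then have "last S \<in> set A" using assms by (auto simp: weak_chain_ending_at_def)
  then obtain k where k: "k < length A" "last S = A ! k" by (metis in_set_conv_nth)
  have "Suc (length S - 1) = length S" using assms by (cases S) auto
  then have "(S @ [A ! nat i]) ! (length S - 1) \<prec>w (S @ [A ! nat i]) ! length S"
    using L by (auto simp: weak_chain_ending_at_def dest!: spec[of _ "length S - 1"])
  then have "A ! k \<prec>w A ! nat i"
    using k assms by (simp add: nth_append last_conv_nth)
  then have "int k \<in> cands (a i) (c i)"
    using k assms endpoint_simps[of "int k"] endpoint_simps[of i]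
    by (auto simp: cands_def weak_prec_def n_def)
  moreover have "weak_chain_ending_at A k S"
  proof -
    have "S ! j \<prec>w S ! Suc j" if "Suc j < length S" for j
      using L that by (auto simp: weak_chain_ending_at_def nth_append dest!: spec[of _ j])
    then show ?thesis using L k assms by (auto simp: weak_chain_ending_at_def)
  qed
  ultimately show ?R by (intro bexI[of _ "int k"]) auto
next
  assume ?R
  then obtain j where j: "j \<in> cands (a i) (c i)" and S: "weak_chain_ending_at A (nat j) S" by auto
  have "A ! nat j \<prec>w A ! nat i"
    using j assms endpoint_simps[of j] endpoint_simps[of i] by (auto simp: cands_def weak_prec_def)
  moreover have "Suc k = length S \<Longrightarrow> S ! k = last S" for k
    using assms by (metis diff_Suc_1 last_conv_nth)
  ultimately have "(S @ [A ! nat i]) ! k \<prec>w (S @ [A ! nat i]) ! Suc k"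
    if "Suc k < length (S @ [A ! nat i])" for k
    using S that by (cases "Suc k = length S") (auto simp: weak_chain_ending_at_def nth_append)
  then show ?L using S in_set[OF assms(2)] by (auto simp: weak_chain_ending_at_def)
qed

lemma chain_single: "i \<in> {0..<n} \<Longrightarrow> weak_chain_ending_at A (nat i) [A ! nat i]"
  using in_set by (auto simp: weak_chain_ending_at_def)

lemma max_coverage_ge:
  "weak_chain_ending_at A i S \<Longrightarrow> coverage S \<le> max_coverage A i"
  unfolding max_coverage_def using finite_coverages by (intro Max_ge) auto

lemma max_coverage_attained:
  assumes "i < length A"
  obtains S where "weak_chain_ending_at A i S" "max_coverage A i = coverage S"
  using Max_in[OF finite_coverages coverages_nonempty[OF assms]]
  unfolding max_coverage_def by auto

text \<open>Cutting the last anchor off an optimal chain leaves nothing or a chain ending at a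
  candidate, and any optimal chain ending at a candidate can be prolonged. The length of the final
  anchor is the same for all chains and cancels.\<close>

lemma D_eq:
  assumes i: "i \<in> {0..<n}"
  shows "D i = V (a i) (c i)"
proof (rule antisym)
  obtain S where S: "weak_chain_ending_at A (nat i) S" "max_coverage A (nat i) = coverage S"
    by (rule max_coverage_attained[of "nat i"]) (use i in \<open>auto simp: n_def\<close>)
  have "S \<noteq> []" "last S = A ! nat i" using S by (auto simp: weak_chain_ending_at_def)
  then obtain S' where S': "S = S' @ [A ! nat i]" by (metis append_butlast_last_id)
  show "D i \<le> V (a i) (c i)"
  proof (cases "S' = []")
    case True
    then show ?thesis
      using S S' V_nonneg coverage_single len_anchor[OF i] by (simp add: D_def)
  next
    case False
    then obtain j where j: "j \<in> cands (a i) (c i)" "weak_chain_ending_at A (nat j) S'"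
      using chain_extend_iff[OF False i] S S' by auto
    have "coverage S = coverage S' - len j + gain j (a i) (c i) + len i"
      using j i coverage_extend[of j S' i] unfolding S' by (auto simp: cands_def)
    then show ?thesis
      using S(2) max_coverage_ge[OF j(2)] V_ge[OF j(1)] by (simp add: D_def)
  qed
next
  show "V (a i) (c i) \<le> D i"
  proof (rule V_le)
    show "0 \<le> D i"
      using max_coverage_ge[OF chain_single[OF i]] len_anchor[OF i] coverage_single
      by (simp add: D_def)
  next
    fix j assume j: "j \<in> cands (a i) (c i)"
    then have j': "j \<in> {0..<n}" by (simp add: cands_def)
    obtain S where S: "weak_chain_ending_at A (nat j) S" "max_coverage A (nat j) = coverage S"
      by (rule max_coverage_attained[of "nat j"]) (use j' in \<open>auto simp: n_def\<close>)
    then have "S \<noteq> []" by (auto simp: weak_chain_ending_at_def)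
    then have "weak_chain_ending_at A (nat i) (S @ [A ! nat i])"
      using chain_extend_iff i j S by blast
    from max_coverage_ge[OF this] show "D j + gain j (a i) (c i) \<le> D i"
      using coverage_extend[OF S(1) j' i] S(2) by (simp add: D_def)
  qed
qed

section \<open>Monotonicity and growth of \<open>V\<close>\<close>

lemma V_mono: "x \<le> x' \<Longrightarrow> y \<le> y' \<Longrightarrow> V x y \<le> V x' y'"
proof (rule V_le)
  fix j assume *: "x \<le> x'" "y \<le> y'" "j \<in> cands x y"
  then have "D j + gain j x y \<le> D j + gain j x' y'" "j \<in> cands x' y'"
    by (auto simp: gain_def cands_def)
  then show "D j + gain j x y \<le> V x' y'" using V_ge by force
qed (rule V_nonneg)

text \<open>
  A chain through a candidate outside the quadrant below \<open>(x, y)\<close> gains at most \<open>t\<close> after leaving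
  that quadrant, because its contributions occupy disjoint ranges of one of the two coordinates.
\<close>

lemma V_diag: "0 \<le> t \<Longrightarrow> V (x + t) (y + t) \<le> V x y + t"
\<comment> \<open>The measure is the first coordinate of the outer point. The recursion goes to the
  start of a candidate \<open>j\<close>, where \<open>a j < x + t\<close>, and
  \<open>0 < a j\<close> makes the drop strict in \<open>nat\<close>.\<close>
proof (induction "nat (x + t)" arbitrary: x y t rule: less_induct)
  case less
  show ?case
  proof (rule V_le)
    fix j assume j: "j \<in> cands (x + t) (y + t)"
    then have j': "j \<in> {0..<n}" "a j < x + t" "c j < y + t" by (auto simp: cands_def)
    show "D j + gain j (x + t) (y + t) \<le> V x y + t"
    proof (cases "a j < x \<and> c j < y")
      case True
      then have "D j + gain j x y \<le> V x y" using j' by (intro V_ge) (auto simp: cands_def)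
      then show ?thesis using less.prems by (simp add: gain_def)
    next
      case False
      \<comment> \<open>\<open>u\<close> measures how far the start of \<open>j\<close> lies outside
        the quadrant. Moved back by \<open>u\<close> along its diagonal it lies at or below
        \<open>(x, y)\<close>, and \<open>j\<close> itself can contribute at most
        \<open>t - u\<close>.\<close>
      define u where "u = max (a j - x) (c j - y)"
      have u: "0 \<le> u" "gain j (x + t) (y + t) \<le> t - u" using False by (auto simp: u_def gain_def)
      have "D j = V (a j - u + u) (c j - u + u)" using D_eq j' by simp
      also have "\<dots> \<le> V (a j - u) (c j - u) + u"
        using j' anchor_bounds(1)[OF j'(1)] u less.hyps[of "a j - u" u "c j - u"] by simp
      also have "V (a j - u) (c j - u) \<le> V x y" by (rule V_mono) (auto simp: u_def)
      finally show ?thesis using u by simp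
    qed
  qed (use less.prems V_nonneg[of x y] in simp)
qed

text \<open>Going back along the diagonal to first coordinate 1 reaches a point with no candidates,
  since all starts are positive. The bound is what keeps \<open>D\<close> within a machine
  word.\<close>

lemma D_le: "i \<in> {0..<n} \<Longrightarrow> 0 \<le> D i \<and> D i < a i"
proof -
  assume i: "i \<in> {0..<n}"
  have "cands 1 (c i - a i + 1) = {}"
    using anchor_bounds(1) by (force simp: cands_def)
  then have "V 1 (c i - a i + 1) = 0" by (simp add: V_def)
  moreover have "V (a i) (c i) \<le> V 1 (c i - a i + 1) + (a i - 1)"
    using V_diag[of "a i - 1" 1 "c i - a i + 1"] anchor_bounds(1)[OF i] by simp
  ultimately show ?thesis using D_eq[OF i] V_nonneg[of "a i" "c i"] by simp
qed

section \<open>Predecessors that end before an anchor or overlap its start\<close>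

definition before :: "int \<Rightarrow> int set" where
  "before i = {j \<in> {0..<n}. b j < a i \<and> d j < c i}"

text \<open>The inequality \<open>c j < c i\<close> follows from the diagonal condition, as
  \<open>c i - c j >= a i - a j > 0\<close>. On this side the first coordinate limits the overlap,
  so the gain is \<open>a i - a j\<close>; \<open>beside\<close> is the mirror image, and anchors on
  the diagonal of \<open>i\<close> may lie in both sets.\<close>

definition above :: "int \<Rightarrow> int set" where
  "above i = {j \<in> {0..<n}. a j < a i \<and> a i \<le> b j \<and> c j - a j \<le> c i - a i}"

definition beside :: "int \<Rightarrow> int set" where
  "beside i = {j \<in> {0..<n}. c j < c i \<and> c i \<le> d j \<and> a j - c j \<le> a i - c i}"

lemma D_before: "i \<in> {0..<n} \<Longrightarrow> j \<in> before i \<Longrightarrow> D j + len j \<le> D i"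
  using V_ge[of j "a i" "c i"] D_eq[of i] anchor_bounds[of j]
  by (auto simp: before_def cands_def gain_def)

lemma D_above: "i \<in> {0..<n} \<Longrightarrow> j \<in> above i \<Longrightarrow> D j + (a i - a j) \<le> D i"
  using V_ge[of j "a i" "c i"] D_eq[of i] anchor_bounds[of j]
  by (auto simp: above_def cands_def gain_def)

lemma D_beside: "i \<in> {0..<n} \<Longrightarrow> j \<in> beside i \<Longrightarrow> D j + (c i - c j) \<le> D i"
  using V_ge[of j "a i" "c i"] D_eq[of i] anchor_bounds[of j]
  by (auto simp: beside_def cands_def gain_def)

text \<open>
  The nearest diagonal dominates: on the row or column of the start of anchor \<open>i\<close>, the offer of an
  overlapping anchor is the value of \<open>V\<close> on its diagonal, and \<open>V\<close> is monotone.
\<close>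

lemma nearest_above:
  assumes "i \<in> {0..<n}" "j \<in> above i" "p \<in> above i" "c j - a j \<le> c p - a p"
  shows "D j + (a i - a j) \<le> D p + (a i - a p)"
proof -
  have jp: "j \<in> {0..<n}" "p \<in> {0..<n}" using assms by (auto simp: above_def)
  have "D j + (a i - a j) \<le> V (a i) (a i + (c j - a j))"
    using V_ge[of j "a i" "a i + (c j - a j)"] assms anchor_bounds[of j]
    by (auto simp: above_def cands_def gain_def)
  also have "\<dots> \<le> V (a i) (a i + (c p - a p))" using assms by (intro V_mono) auto
  also have "\<dots> \<le> V (a p) (c p) + (a i - a p)"
    using V_diag[of "a i - a p" "a p" "c p"] assms by (simp add: above_def algebra_simps)
  finally show ?thesis using D_eq[OF jp(2)] by simp
qed

lemma nearest_beside:
  assumes "i \<in> {0..<n}" "j \<in> beside i" "p \<in> beside i" "a j - c j \<le> a p - c p"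
  shows "D j + (c i - c j) \<le> D p + (c i - c p)"
proof -
  have jp: "j \<in> {0..<n}" "p \<in> {0..<n}" using assms by (auto simp: beside_def)
  have "D j + (c i - c j) \<le> V (c i + (a j - c j)) (c i)"
    using V_ge[of j "c i + (a j - c j)" "c i"] assms anchor_bounds[of j]
    by (auto simp: beside_def cands_def gain_def)
  also have "\<dots> \<le> V (c i + (a p - c p)) (c i)" using assms by (intro V_mono) auto
  also have "\<dots> \<le> V (a p) (c p) + (c i - c p)"
    using V_diag[of "c i - c p" "a p" "c p"] assms by (simp add: beside_def algebra_simps)
  finally show ?thesis using D_eq[OF jp(2)] by simp
qed

text \<open>Every offer is realized by some candidate, so the right side never exceeds
  \<open>D i\<close>, whichever pointers are chosen among ties. For the other inequality it is
  enough that the three sets cover all candidates and that a pointer beats the members of its own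
  set.\<close>

lemma D_recurrence:
  assumes i: "i \<in> {0..<n}"
    and p: "nearest (above i) (\<lambda>j. c j - a j) p"
    and q: "nearest (beside i) (\<lambda>j. a j - c j) q"
  shows "D i = max (Max (insert 0 ((\<lambda>j. D j + len j) ` before i)))
    (max (if p = 0 then 0 else D (p - 1) + (a i - a (p - 1)))
         (if q = 0 then 0 else D (q - 1) + (c i - c (q - 1))))" (is "_ = ?M")
proof (rule antisym)
  have fin: "finite (before i)"
    by (rule finite_subset[of _ "{0..<n}"]) (auto simp: before_def)
  have "D i = V (a i) (c i)" by (rule D_eq[OF i])
  also have "\<dots> \<le> ?M"
  proof (rule V_le)
    have "0 \<le> Max (insert 0 ((\<lambda>j. D j + len j) ` before i))" using fin by simp
    then show "0 \<le> ?M" by linarith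
  next
    fix j assume "j \<in> cands (a i) (c i)"
    then have j: "j \<in> {0..<n}" "a j < a i" "c j < c i" by (auto simp: cands_def)
    note jb = anchor_bounds[OF j(1)]
    \<comment> \<open>If \<open>a i <= b j\<close> and the diagonal of \<open>j\<close> is larger
      than that of \<open>i\<close>, then
      \<open>d j = c j + (b j - a j) >= c j + (a i - a j) > c i\<close>, so \<open>j\<close> is in
      \<open>beside\<close>; the case \<open>c i <= d j\<close> is symmetric.\<close>
    consider "j \<in> before i" | "j \<in> above i" | "j \<in> beside i"
      using j jb by (fastforce simp: before_def above_def beside_def)
    then show "D j + gain j (a i) (c i) \<le> ?M"
    proof cases
      case 1
      then have "D j + len j \<le> Max (insert 0 ((\<lambda>j. D j + len j) ` before i))"
        using fin by (intro Max_ge) auto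
      then show ?thesis by (simp add: gain_def)
    next
      case 2
      then have "p - 1 \<in> above i" "c j - a j \<le> c (p - 1) - a (p - 1)"
        using p by (auto simp: nearest_def split: if_splits)
      \<comment> \<open>Indices are nonnegative, so a pointer to an actual anchor is at least 1 and
        cannot be mistaken for the empty marker.\<close>
      moreover from this have "p \<noteq> 0" by (auto simp: above_def)
      ultimately show ?thesis
        using nearest_above[OF i 2, of "p - 1"] by (simp add: gain_def)
    next
      case 3
      then have "q - 1 \<in> beside i" "a j - c j \<le> a (q - 1) - c (q - 1)"
        using q by (auto simp: nearest_def split: if_splits)
      moreover from this have "q \<noteq> 0" by (auto simp: beside_def)
      ultimately show ?thesis
        using nearest_beside[OF i 3, of "q - 1"] by (simp add: gain_def)
    qed
  qed
  finally show "D i \<le> ?M" .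
  have "0 \<le> D i" using D_le[OF i] by simp
  moreover have "Max (insert 0 ((\<lambda>j. D j + len j) ` before i)) \<le> D i"
    using fin D_before[OF i] \<open>0 \<le> D i\<close> by auto
  moreover have "p \<noteq> 0 \<Longrightarrow> D (p - 1) + (a i - a (p - 1)) \<le> D i"
    using p D_above[OF i, of "p - 1"] by (auto simp: nearest_def split: if_splits)
  moreover have "q \<noteq> 0 \<Longrightarrow> D (q - 1) + (c i - c (q - 1)) \<le> D i"
    using q D_beside[OF i, of "q - 1"] by (auto simp: nearest_def split: if_splits)
  ultimately show "?M \<le> D i" by auto
qed

end

section \<open>Weakest preconditions with running time\<close>

text \<open>An existing run means termination without overflow, and determinism makes it the only
  run. Since the postcondition sees the elapsed time, time bounds are proved along with the
  values.\<close>

definition wp :: "int \<Rightarrow> com \<Rightarrow> state \<Rightarrow> (nat \<Rightarrow> state \<Rightarrow> bool) \<Rightarrow> bool" where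
  "wp W p s Q \<longleftrightarrow> (\<exists>t s'. exec W p s t s' \<and> Q t s')"

lemma wp_Skip [simp]: "wp W Skip s Q \<longleftrightarrow> Q 1 s"
  unfolding wp_def by (rule iffI, (auto elim!: SkipE)[1], blast intro: exec.Skip)

lemma wp_Assign [simp]:
  "wp W (Assign x e) s Q \<longleftrightarrow>
     \<bar>aval e s\<bar> \<le> W \<and> Q (1 + acost e) (s\<lparr>regs := (regs s)(x := aval e s)\<rparr>)"
  unfolding wp_def by (rule iffI, (auto elim!: AssignE)[1], blast intro: exec.Assign)

lemma wp_Store [simp]:
  "wp W (Store X e f) s Q \<longleftrightarrow> \<bar>aval f s\<bar> \<le> W \<and>
     Q (1 + acost e + acost f) (s\<lparr>arrs := (arrs s)(X := (arrs s X)(aval e s := aval f s))\<rparr>)"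
  unfolding wp_def by (rule iffI, (auto elim!: StoreE)[1], blast intro: exec.Store)

lemma wp_Seq [simp]:
  "wp W (Seq p q) s Q \<longleftrightarrow> wp W p s (\<lambda>t s'. wp W q s' (\<lambda>t' s''. Q (t + t') s''))"
  unfolding wp_def by (blast elim: SeqE intro: exec.Seq)

lemma wp_Cond [simp]:
  "wp W (Cond b p q) s Q \<longleftrightarrow>
     (if bval b s then wp W p s (\<lambda>t. Q (1 + bcost b + t)) else wp W q s (\<lambda>t. Q (1 + bcost b + t)))"
  (is "_ \<longleftrightarrow> ?R")
proof
  assume "wp W (Cond b p q) s Q"
  then show ?R unfolding wp_def by (auto elim!: CondE)
next
  assume R: ?R
  show "wp W (Cond b p q) s Q"
  proof (cases "bval b s")
    case True
    with R obtain t s' where "exec W p s t s'" "Q (1 + bcost b + t) s'" by (auto simp: wp_def)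
    then show ?thesis using exec.CondTrue[OF True] unfolding wp_def by blast
  next
    case False
    with R obtain t s' where "exec W q s t s'" "Q (1 + bcost b + t) s'" by (auto simp: wp_def)
    then show ?thesis using exec.CondFalse[OF False] unfolding wp_def by blast
  qed
qed

lemma wp_mono: "wp W p s Q \<Longrightarrow> (\<And>t s'. Q t s' \<Longrightarrow> Q' t s') \<Longrightarrow> wp W p s Q'"
  unfolding wp_def by blast

text \<open>A value merely copied from a bounded state is again within the word, which discharges
  many overflow conditions; \<open>exec\<close> checks every write, so boundedness is preserved by
  any run.\<close>

definition bounded :: "int \<Rightarrow> state \<Rightarrow> bool" where
  "bounded W s \<longleftrightarrow> (\<forall>x. \<bar>regs s x\<bar> \<le> W) \<and> (\<forall>X k. \<bar>arrs s X k\<bar> \<le> W)"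

lemma boundedD:
  assumes "bounded W s"
  shows "\<bar>regs s x\<bar> \<le> W" "\<bar>arrs s X k\<bar> \<le> W" "regs s x \<le> W"
  using assms abs_le_D1 by (auto simp: bounded_def)

text \<open>Written names are computed from the syntax, so that frame conditions hold once for all
  programs and specifications can concentrate on what a program computes.\<close>

fun wregs :: "com \<Rightarrow> string set" where
  "wregs Skip = {}"
| "wregs (Assign x e) = {x}"
| "wregs (Store X e f) = {}"
| "wregs (Seq p q) = wregs p \<union> wregs q"
| "wregs (Cond b p q) = wregs p \<union> wregs q"
| "wregs (While b p) = wregs p"

fun warrs :: "com \<Rightarrow> string set" where
  "warrs Skip = {}"
| "warrs (Assign x e) = {}"
| "warrs (Store X e f) = {X}"
| "warrs (Seq p q) = warrs p \<union> warrs q"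
| "warrs (Cond b p q) = warrs p \<union> warrs q"
| "warrs (While b p) = warrs p"

definition framed :: "string set \<Rightarrow> string set \<Rightarrow> state \<Rightarrow> state \<Rightarrow> bool" where
  "framed R Y s s' \<longleftrightarrow> (\<forall>x. x \<notin> R \<longrightarrow> regs s' x = regs s x) \<and> (\<forall>X. X \<notin> Y \<longrightarrow> arrs s' X = arrs s X)"

lemma framed_regs: "framed R Y s s' \<Longrightarrow> x \<notin> R \<Longrightarrow> regs s' x = regs s x"
  and framed_arrs: "framed R Y s s' \<Longrightarrow> X \<notin> Y \<Longrightarrow> arrs s' X = arrs s X"
  by (auto simp: framed_def)

lemma exec_framed: "exec W p s t s' \<Longrightarrow> framed (wregs p) (warrs p) s s'"
  by (induction rule: exec.induct) (auto simp: framed_def)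

lemma exec_bounded: "exec W p s t s' \<Longrightarrow> bounded W s \<Longrightarrow> bounded W s'"
  by (induction rule: exec.induct) (auto simp: bounded_def)

lemma wp_conseq:
  assumes "wp W p s Q"
    and "\<And>t s'. Q t s' \<Longrightarrow> framed (wregs p) (warrs p) s s' \<Longrightarrow> (bounded W s \<Longrightarrow> bounded W s') \<Longrightarrow> Q' t s'"
  shows "wp W p s Q'"
  using assms exec_framed exec_bounded unfolding wp_def by blast

text \<open>\<open>m\<close> is a budget for the number of rounds, each costing at most
  \<open>T\<close> plus the test; the extra 1 pays for the final test. A round may lower the budget
  by more than one.\<close>

lemma wp_While:
  assumes "I m s"
    and step: "\<And>m s. I m s \<Longrightarrow> bval b s \<Longrightarrow> wp W p s (\<lambda>t s'. t \<le> T \<and> (\<exists>m'<m. I m' s'))"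
    and exit: "\<And>m' t s. I m' s \<Longrightarrow> \<not> bval b s \<Longrightarrow> t \<le> (m + 1) * (1 + bcost b + T) \<Longrightarrow> Q t s"
  shows "wp W (While b p) s Q"
proof -
  have "\<exists>t s' m'. exec W (While b p) s t s' \<and> t \<le> (m + 1) * (1 + bcost b + T) \<and> I m' s' \<and> \<not> bval b s'"
    using assms(1)
  proof (induction m arbitrary: s rule: less_induct)
    case (less m)
    show ?case
    proof (cases "bval b s")
      case False
      then have "exec W (While b p) s (1 + bcost b) s" by (rule exec.WhileFalse)
      with False less.prems show ?thesis by (intro exI[of _ "1 + bcost b"]) auto
    next
      case True
      from step[OF less.prems True] obtain t s1 m1
        where 1: "exec W p s t s1" "t \<le> T" "m1 < m" "I m1 s1" unfolding wp_def by auto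
      from less.IH[OF 1(3,4)] obtain t' s' m'
        where 2: "exec W (While b p) s1 t' s'" "t' \<le> (m1 + 1) * (1 + bcost b + T)"
          "I m' s'" "\<not> bval b s'" by auto
      have "(m1 + 1) * (1 + bcost b + T) \<le> m * (1 + bcost b + T)"
        using 1(3) by (intro mult_right_mono) auto
      then have "1 + bcost b + t + t' \<le> (m + 1) * (1 + bcost b + T)"
        using 1(2) 2(2) by simp
      with exec.WhileTrue[OF True 1(1) 2(1)] 2(3,4) show ?thesis by blast
    qed
  qed
  then show ?thesis using exit unfolding wp_def by blast
qed

lemma framed_trans: "framed R Y s s' \<Longrightarrow> framed R Y s' s'' \<Longrightarrow> framed R Y s s''"
  by (auto simp: framed_def)

text \<open>Frame and boundedness relative to the state before the loop are carried along in the
  invariant, so \<open>I\<close> only describes the computed data.\<close>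

lemma wp_loop:
  assumes "I m s" "bounded W s"
    and step: "\<And>m s'. I m s' \<Longrightarrow> bval b s' \<Longrightarrow> bounded W s' \<Longrightarrow> framed (wregs p) (warrs p) s s' \<Longrightarrow>
      wp W p s' (\<lambda>t s''. t \<le> T \<and> (\<exists>m'<m. I m' s''))"
    and exit: "\<And>m' t s'. I m' s' \<Longrightarrow> \<not> bval b s' \<Longrightarrow> bounded W s' \<Longrightarrow>
      framed (wregs p) (warrs p) s s' \<Longrightarrow> t \<le> (m + 1) * (1 + bcost b + T) \<Longrightarrow> Q t s'"
  shows "wp W (While b p) s Q"
proof (rule wp_While[where m = m and T = T and
      I = "\<lambda>m s'. I m s' \<and> bounded W s' \<and> framed (wregs p) (warrs p) s s'"])
  show "I m s \<and> bounded W s \<and> framed (wregs p) (warrs p) s s"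
    using assms(1,2) by (simp add: framed_def)
next
  fix m s' assume I: "I m s' \<and> bounded W s' \<and> framed (wregs p) (warrs p) s s'" and "bval b s'"
  then have "wp W p s' (\<lambda>t s''. t \<le> T \<and> (\<exists>m'<m. I m' s''))" by (intro step) auto
  then show "wp W p s' (\<lambda>t s''. t \<le> T \<and>
      (\<exists>m'<m. I m' s'' \<and> bounded W s'' \<and> framed (wregs p) (warrs p) s s''))"
    by (rule wp_conseq) (use I framed_trans in blast)
qed (use exit in blast)

abbreviation seq_syntax (infixr ";;" 60) where "p ;; q \<equiv> Seq p q"

section \<open>Sorting with a tournament tree\<close>

text \<open>
  In a tournament tree the node \<open>p\<close> has the children \<open>2 * p\<close> and \<open>2 * p + 1\<close>; the entry \<open>e + 1\<close> stands
  for the item \<open>e\<close> with the key \<open>K e\<close>, and 0 for no item.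
\<close>

definition better :: "(int \<Rightarrow> int) \<Rightarrow> int \<Rightarrow> int \<Rightarrow> int" where
  "better K x y = (if x \<noteq> 0 \<and> \<not> (y \<noteq> 0 \<and> K (y - 1) < K (x - 1)) then x else y)"

definition node_ok :: "(int \<Rightarrow> int) \<Rightarrow> (int \<Rightarrow> int) \<Rightarrow> int \<Rightarrow> bool" where
  "node_ok K H q \<longleftrightarrow> H q = better K (H (2 * q)) (H (2 * q + 1))"

abbreviation "dbl e \<equiv> Plus e e"

text \<open>The guard is \<open>better\<close> written out as a test, with doubling by addition
  since the machine does not multiply. For an empty entry a key is read at index -1; the
  neighbouring conjunct then decides the test.\<close>

definition fix_step :: "string \<Rightarrow> com" where
  "fix_step K =
    (Assign ''p'' (Half (Reg ''p'')) ;;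
     Assign ''x'' (Load ''H'' (dbl (Reg ''p''))) ;;
     Assign ''y'' (Load ''H'' (Plus (dbl (Reg ''p'')) (Const 1))) ;;
     Cond (BAnd (BNot (Eq (Reg ''x'') (Const 0)))
            (BNot (BAnd (BNot (Eq (Reg ''y'') (Const 0)))
              (Less (Load K (Minus (Reg ''y'') (Const 1))) (Load K (Minus (Reg ''x'') (Const 1)))))))
       (Store ''H'' (Reg ''p'') (Reg ''x''))
       (Store ''H'' (Reg ''p'') (Reg ''y'')))"

definition fix_path :: "string \<Rightarrow> com" where
  "fix_path K = While (Less (Const 1) (Reg ''p'')) (fix_step K)"

lemma fix_frame [simp]:
  "wregs (fix_step K) = {''p'', ''x'', ''y''}" "warrs (fix_step K) = {''H''}"
  "wregs (fix_path K) = {''p'', ''x'', ''y''}" "warrs (fix_path K) = {''H''}"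
  by (auto simp: fix_step_def fix_path_def)

text \<open>At any time only the parent of \<open>p\<close> may disagree with its children;
  recomputing it hands the possible defect on to its own parent. Once \<open>p = 1\<close>, the
  exceptional node is 0, which lies outside the tree. The bound on \<open>p\<close> halves in every
  round.\<close>

lemma fix_path_spec:
  fixes p sz :: int and s :: state
  defines "p \<equiv> regs s ''p''"
  assumes b: "bounded W s" and K: "K \<noteq> ''H''" and p: "1 \<le> p" "p < 2 ^ h" "p < 2 * sz"
    and inv: "\<And>q. 1 \<le> q \<Longrightarrow> q < sz \<Longrightarrow> q \<noteq> p div 2 \<Longrightarrow> node_ok (arrs s K) (arrs s ''H'') q"
    and exit: "\<And>t s'. t \<le> 60 * (h + 1) \<Longrightarrow> bounded W s' \<Longrightarrow>
      framed {''p'', ''x'', ''y''} {''H''} s s' \<Longrightarrow>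
      (\<And>q. 1 \<le> q \<Longrightarrow> q < sz \<Longrightarrow> node_ok (arrs s K) (arrs s' ''H'') q) \<Longrightarrow>
      (\<And>q. sz \<le> q \<Longrightarrow> arrs s' ''H'' q = arrs s ''H'' q) \<Longrightarrow> Q t s'"
  shows "wp W (fix_path K) s Q"
proof -
  define I where "I = (\<lambda>(m::nat) (s'::state). 1 \<le> regs s' ''p'' \<and> regs s' ''p'' < 2 ^ m \<and> regs s' ''p'' < 2 * sz \<and>
     (\<forall>q. sz \<le> q \<longrightarrow> arrs s' ''H'' q = arrs s ''H'' q) \<and>
     (\<forall>q. 1 \<le> q \<and> q < sz \<and> q \<noteq> regs s' ''p'' div 2 \<longrightarrow> node_ok (arrs s K) (arrs s' ''H'') q))"
  show ?thesis
    unfolding fix_path_def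
  proof (rule wp_loop[where m = h and T = 40 and I = I])
    show "I h s" using p inv by (auto simp: I_def p_def)
  next
    fix m s'
    assume I: "I m s'" and "bval (Less (Const 1) (Reg ''p'')) s'" and b': "bounded W s'"
      and f: "framed (wregs (fix_step K)) (warrs (fix_step K)) s s'"
    then have p': "1 < regs s' ''p''" "regs s' ''p'' < 2 ^ m" by (auto simp: I_def)
    obtain m' where m: "m = Suc m'" using p' by (cases m) auto
    have K': "arrs s' K = arrs s K" using f K by (auto intro: framed_arrs)
    define pp where "pp = regs s' ''p'' div 2"
    define H where "H = arrs s' ''H''"
    define r where "r = better (arrs s K) (H (2 * pp)) (H (2 * pp + 1))"
    have half: "1 \<le> pp" "pp < 2 ^ m'" "pp < sz" "\<bar>pp\<bar> \<le> W"
      using p' I boundedD(1)[OF b', of "''p''"] by (auto simp: m pp_def I_def)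
    have inv': "node_ok (arrs s K) (H(pp := r)) q"
      if "1 \<le> q" "q < sz" "q \<noteq> pp div 2" for q
    proof -
      have "2 * q \<noteq> pp" "2 * q + 1 \<noteq> pp" using that by auto
      moreover have "2 * pp \<noteq> pp" "2 * pp + 1 \<noteq> pp" using half by auto
      moreover have "q \<noteq> pp \<Longrightarrow> node_ok (arrs s K) H q"
        using I that by (simp add: H_def pp_def I_def)
      ultimately show ?thesis by (simp add: r_def node_ok_def)
    qed
    have next': "\<exists>m''<m. I m'' s''"
      if "regs s'' ''p'' = pp" "arrs s'' ''H'' = H(pp := r)" for s''
    proof (intro exI[of _ m'] conjI)
      show "I m' s''"
        unfolding I_def using that half inv' I by (simp add: I_def H_def)
    qed (simp add: m)
    have Hb: "\<bar>H k\<bar> \<le> W" for k using boundedD(2)[OF b'] by (simp add: H_def)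
    show "wp W (fix_step K) s' (\<lambda>t s''. t \<le> 40 \<and> (\<exists>m'<m. I m' s''))"
      using K half(4)
      by (simp add: fix_step_def pp_def[symmetric] H_def[symmetric] K' Hb cong: if_cong)
        (intro conjI impI next'; simp add: r_def better_def)
  next
    fix m t s'
    assume "I m s'" "\<not> bval (Less (Const 1) (Reg ''p'')) s'" "bounded W s'"
      "framed (wregs (fix_step K)) (warrs (fix_step K)) s s'"
      "t \<le> (h + 1) * (1 + bcost (Less (Const 1) (Reg ''p'')) + 40)"
    then show "Q t s'"
      by (intro exit) (auto simp: I_def)
  qed (rule b)
qed

text \<open>The budget is the number of remaining iterations; 4 is the cost of one loop
  test.\<close>

lemma wp_for:
  assumes s: "regs s x = 0" "regs s y = m" "0 \<le> m" "J 0 s" "bounded W s" "y \<notin> wregs p"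
    and step: "\<And>k s'. 0 \<le> k \<Longrightarrow> k < m \<Longrightarrow> regs s' x = k \<Longrightarrow> J k s' \<Longrightarrow> bounded W s' \<Longrightarrow>
      framed (wregs p) (warrs p) s s' \<Longrightarrow>
      wp W p s' (\<lambda>t s''. t \<le> T \<and> regs s'' x = k + 1 \<and> J (k + 1) s'')"
    and exit: "\<And>t s'. J m s' \<Longrightarrow> bounded W s' \<Longrightarrow> framed (wregs p) (warrs p) s s' \<Longrightarrow>
      t \<le> (nat m + 1) * (4 + T) \<Longrightarrow> Q t s'"
  shows "wp W (While (Less (Reg x) (Reg y)) p) s Q"
proof (rule wp_loop[where m = "nat m" and T = T and
      I = "\<lambda>i s'. int i \<le> m \<and> regs s' x = m - int i \<and> J (m - int i) s'"])
  fix i s'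
  assume I: "int i \<le> m \<and> regs s' x = m - int i \<and> J (m - int i) s'"
    and b: "bval (Less (Reg x) (Reg y)) s'" "bounded W s'" and f: "framed (wregs p) (warrs p) s s'"
  have "regs s' y = m" using s f framed_regs by metis
  then obtain i' where i: "i = Suc i'" using I b by (cases i) auto
  have "wp W p s' (\<lambda>t s''. t \<le> T \<and> regs s'' x = (m - int i) + 1 \<and> J ((m - int i) + 1) s'')"
    by (rule step) (use I b f i in auto)
  then show "wp W p s' (\<lambda>t s''. t \<le> T \<and>
      (\<exists>i'<i. int i' \<le> m \<and> regs s'' x = m - int i' \<and> J (m - int i') s''))"
    by (rule wp_mono) (use I i in \<open>auto intro!: exI[of _ i'] simp: algebra_simps\<close>)
next
  fix i t s'
  assume I: "int i \<le> m \<and> regs s' x = m - int i \<and> J (m - int i) s'"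
    and b: "\<not> bval (Less (Reg x) (Reg y)) s'" "bounded W s'" and f: "framed (wregs p) (warrs p) s s'"
    and t: "t \<le> (nat m + 1) * (1 + bcost (Less (Reg x) (Reg y)) + T)"
  have "regs s' y = m" using s f framed_regs by metis
  then have "i = 0" using I b by auto
  moreover from t have "t \<le> (nat m + 1) * (4 + T)" by (simp add: algebra_simps)
  ultimately show "Q t s'" using I b f by (intro exit) auto
qed (use s in auto)

text \<open>Item \<open>e\<close> owns the leaf \<open>2 ^ h + e\<close> of a complete binary tree.
  Inner nodes are tied only to their children; that they hold minima over subtrees is derived in
  \<open>heap_node\<close>.\<close>

definition heap :: "(int \<Rightarrow> int) \<Rightarrow> (int \<Rightarrow> int) \<Rightarrow> nat \<Rightarrow> int set \<Rightarrow> bool" where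
  "heap K H h X \<longleftrightarrow> (\<forall>q. 1 \<le> q \<and> q < 2 ^ h \<longrightarrow> node_ok K H q) \<and>
     (\<forall>e. 0 \<le> e \<and> e < 2 ^ h \<longrightarrow> H (2 ^ h + e) = (if e \<in> X then e + 1 else 0))"

text \<open>Induction on the height \<open>g\<close>: \<open>(2 ^ h + x) div 2 ^ g\<close> is the
  ancestor of the leaf of \<open>x\<close> at that height, and \<open>better\<close> picks the
  smaller of the two winners below.\<close>

lemma heap_node:
  assumes H: "heap K H h X" and X: "X \<subseteq> {0..<2 ^ h}"
  shows "g \<le> h \<Longrightarrow> 2 ^ (h - g) \<le> q \<Longrightarrow> q < 2 * 2 ^ (h - g) \<Longrightarrow>
    (H q = 0 \<or> H q - 1 \<in> X) \<and>
    (\<forall>x\<in>X. (2 ^ h + x) div 2 ^ g = q \<longrightarrow> H q \<noteq> 0 \<and> K (H q - 1) \<le> K x)"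
proof (induction g arbitrary: q)
  case 0
  define e where "e = q - 2 ^ h"
  have "0 \<le> e" "e < 2 ^ h" "q = 2 ^ h + e" using 0 by (auto simp: e_def)
  then show ?case using H by (auto simp: heap_def)
next
  case (Suc g)
  have pow: "2 ^ (h - g) = 2 * (2 :: int) ^ (h - Suc g)"
    using Suc.prems by (metis Suc_diff_le diff_Suc_Suc power_Suc)
  have lt: "2 * (2 :: int) ^ (h - Suc g) \<le> 2 ^ h"
    unfolding pow[symmetric] by (rule power_increasing) auto
  have g: "g \<le> h" using Suc.prems by simp
  have ok: "H q = better K (H (2 * q)) (H (2 * q + 1))"
    using H Suc.prems lt order.strict_trans2[of q "2 * 2 ^ (h - Suc g)" "2 ^ h"]
      one_le_power[of "2::int" "h - Suc g"] by (auto simp: heap_def node_ok_def)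
  note l = Suc.IH[of "2 * q", OF g, unfolded pow] and r = Suc.IH[of "2 * q + 1", OF g, unfolded pow]
  have lr: "H (2 * q) = 0 \<or> H (2 * q) - 1 \<in> X" "H (2 * q + 1) = 0 \<or> H (2 * q + 1) - 1 \<in> X"
    using l r Suc.prems by auto
  have "H q \<noteq> 0 \<and> K (H q - 1) \<le> K x" if x: "x \<in> X" "(2 ^ h + x) div 2 ^ Suc g = q" for x
  proof -
    define y where "y = (2 ^ h + x) div 2 ^ g"
    have "y div 2 = q" using x unfolding y_def by (simp add: zdiv_zmult2_eq[symmetric] mult.commute)
    then have "y = 2 * q \<or> y = 2 * q + 1" by auto
    then show ?thesis
    proof
      assume "y = 2 * q"
      then have "H (2 * q) \<noteq> 0 \<and> K (H (2 * q) - 1) \<le> K x" using l x Suc.prems by (auto simp: y_def)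
      then show ?thesis unfolding ok better_def by auto
    next
      assume "y = 2 * q + 1"
      then have "H (2 * q + 1) \<noteq> 0 \<and> K (H (2 * q + 1) - 1) \<le> K x"
        using r x Suc.prems by (auto simp: y_def)
      then show ?thesis unfolding ok better_def by auto
    qed
  qed
  moreover have "H q = 0 \<or> H q - 1 \<in> X" using lr unfolding ok better_def by auto
  ultimately show ?case by blast
qed

text \<open>Every leaf of an item has node 1 as its ancestor at height \<open>h\<close>.\<close>

lemma heap_root:
  assumes "heap K H h X" "X \<subseteq> {0..<2 ^ h}" "X \<noteq> {}"
  shows "H 1 - 1 \<in> X" "x \<in> X \<Longrightarrow> K (H 1 - 1) \<le> K x"
proof -
  have r: "(2 ^ h + x) div 2 ^ h = 1" if "x \<in> X" for x
    using assms(2) that by (auto simp: div_add1_eq)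
  note * = heap_node[OF assms(1,2), of h 1]
  show "H 1 - 1 \<in> X" using * r assms(3) by auto
  show "x \<in> X \<Longrightarrow> K (H 1 - 1) \<le> K x" using * r by auto
qed

lemma heap_zero: "heap K (\<lambda>_. 0) h {}"
  by (simp add: heap_def node_ok_def better_def)

text \<open>A tree without items is zero at all its nodes, and then \<open>better\<close> does not
  depend on the keys. So the array \<open>H\<close>, left empty by one sort, serves the next sort
  with different keys.\<close>

lemma heap_empty:
  assumes "heap K H h {}"
  shows "heap K' H h {}"
proof -
  have z: "H q = 0" if q: "1 \<le> q" "q < 2 * 2 ^ h" for q
  proof -
    \<comment> \<open>\<open>g\<close> is the depth of the node \<open>q\<close>, that is, the
      integer part of its binary logarithm, so \<open>q\<close> has height
      \<open>h - g\<close>.\<close>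
    define g where "g = Max {g. g \<le> h \<and> 2 ^ g \<le> q}"
    have "g \<in> {g. g \<le> h \<and> 2 ^ g \<le> q}" unfolding g_def by (rule Max_in) (use q in auto)
    moreover have "\<not> (Suc g \<le> h \<and> 2 ^ Suc g \<le> q)"
      using Max_ge[of "{g. g \<le> h \<and> 2 ^ g \<le> q}" "Suc g"] finite_subset[of _ "{..h}"]
      unfolding g_def by fastforce
    ultimately have "g \<le> h" "2 ^ g \<le> q" "q < 2 * 2 ^ g" using q by (auto simp: le_less)
    then show ?thesis using heap_node[OF assms, of "h - g" q] by auto
  qed
  have "node_ok K' H q" if "1 \<le> q" "q < 2 ^ h" for q
    using z[of q] z[of "2 * q"] z[of "2 * q + 1"] that by (auto simp: node_ok_def better_def)
  then show ?thesis using assms by (simp add: heap_def)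
qed

definition set_leaf :: "string \<Rightarrow> aexp \<Rightarrow> com" where
  "set_leaf K v = (Store ''H'' (Reg ''p'') v ;; fix_path K)"

lemma set_leaf_frame [simp]:
  "wregs (set_leaf K v) = {''p'', ''x'', ''y''}" "warrs (set_leaf K v) = {''H''}"
  by (auto simp: set_leaf_def)

text \<open>\<open>X\<close> and \<open>Y\<close> differ at most at \<open>e\<close>, so one
  specification covers insertion (value \<open>e + 1\<close>) and removal (value 0).\<close>

lemma set_leaf_spec:
  assumes b: "bounded W s" and K: "K \<noteq> ''H''"
    and p: "regs s ''p'' = 2 ^ h + e" "0 \<le> e" "e < 2 ^ h"
    and H: "heap (arrs s K) (arrs s ''H'') h X"
    and v: "aval v s = (if e \<in> Y then e + 1 else 0)" "\<bar>aval v s\<bar> \<le> W"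
      "\<And>x. x \<noteq> e \<Longrightarrow> x \<in> Y \<longleftrightarrow> x \<in> X"
    and exit: "\<And>t s'. t \<le> 60 * (h + 2) + 2 + acost v \<Longrightarrow> bounded W s' \<Longrightarrow>
      framed {''p'', ''x'', ''y''} {''H''} s s' \<Longrightarrow> heap (arrs s K) (arrs s' ''H'') h Y \<Longrightarrow> Q t s'"
  shows "wp W (set_leaf K v) s Q"
proof -
  define s1 where "s1 = s\<lparr>arrs := (arrs s)(''H'' := (arrs s ''H'')(2 ^ h + e := aval v s))\<rparr>"
  have b1: "bounded W s1" using b v by (auto simp: bounded_def s1_def)
  have K1: "arrs s1 K = arrs s K" using K by (simp add: s1_def)
  have ok: "node_ok (arrs s1 K) (arrs s1 ''H'') q"
    if "1 \<le> q" "q < 2 ^ h" "q \<noteq> (2 ^ h + e) div 2" for q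
  proof -
    have "2 * q \<noteq> 2 ^ h + e" "2 * q + 1 \<noteq> 2 ^ h + e" "q \<noteq> 2 ^ h + e" using that p by auto
    moreover have "node_ok (arrs s K) (arrs s ''H'') q" using H that by (auto simp: heap_def)
    ultimately show ?thesis by (simp add: node_ok_def s1_def K)
  qed
  have "wp W (fix_path K) s1 (\<lambda>t. Q (1 + 1 + acost v + t))"
  \<comment> \<open>The path starts at a leaf, and leaves are numbered below
    \<open>2 ^ (h + 1)\<close>, one level more than inner nodes.\<close>
  proof (rule fix_path_spec[where h = "Suc h" and sz = "2 ^ h"])
    fix t s'
    assume t: "t \<le> 60 * (Suc h + 1)" and b': "bounded W s'" and f: "framed {''p'', ''x'', ''y''} {''H''} s1 s'"
      and n: "\<And>q. 1 \<le> q \<Longrightarrow> q < 2 ^ h \<Longrightarrow> node_ok (arrs s1 K) (arrs s' ''H'') q"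
      and l: "\<And>q. 2 ^ h \<le> q \<Longrightarrow> arrs s' ''H'' q = arrs s1 ''H'' q"
    have "heap (arrs s K) (arrs s' ''H'') h Y"
      unfolding heap_def
    proof (intro conjI allI impI)
      fix x :: int assume x: "0 \<le> x \<and> x < 2 ^ h"
      then have "arrs s' ''H'' (2 ^ h + x) = arrs s1 ''H'' (2 ^ h + x)" by (intro l) simp
      also have "\<dots> = (if x \<in> Y then x + 1 else 0)"
        using H v(1,3) x by (cases "x = e") (auto simp: s1_def heap_def)
      finally show "arrs s' ''H'' (2 ^ h + x) = (if x \<in> Y then x + 1 else 0)" .
    qed (use n K1 in auto)
    moreover have "framed {''p'', ''x'', ''y''} {''H''} s s'" using f by (auto simp: framed_def s1_def)
    ultimately show "Q (1 + 1 + acost v + t) s'" using t b' by (intro exit) auto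
  qed (use b1 K p ok in \<open>auto simp: s1_def\<close>)
  then show ?thesis using v by (simp add: set_leaf_def s1_def p)
qed

definition heap_fill :: "string \<Rightarrow> com" where
  "heap_fill K =
    (Assign ''p'' (Plus (Reg ''sz'') (Reg ''k'')) ;;
     set_leaf K (Plus (Reg ''k'') (Const 1)) ;;
     Assign ''k'' (Plus (Reg ''k'') (Const 1)))"

definition heap_extract :: "string \<Rightarrow> string \<Rightarrow> com" where
  "heap_extract K S =
    (Assign ''x'' (Minus (Load ''H'' (Const 1)) (Const 1)) ;;
     Store ''O'' (Reg ''k'') (Reg ''x'') ;;
     Store S (Reg ''k'') (Load K (Reg ''x'')) ;;
     Assign ''p'' (Plus (Reg ''sz'') (Reg ''x'')) ;;
     set_leaf K (Const 0) ;;
     Assign ''k'' (Plus (Reg ''k'') (Const 1)))"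

text \<open>Every inserted item is extracted again, so \<open>H\<close> ends empty without being
  cleared. \<open>O\<close> receives the sorting permutation and \<open>S\<close> the sorted keys;
  the keys themselves stay in place.\<close>

definition heap_sort :: "string \<Rightarrow> string \<Rightarrow> com" where
  "heap_sort K S =
    (Assign ''k'' (Const 0) ;;
     While (Less (Reg ''k'') (Reg ''m'')) (heap_fill K) ;;
     Assign ''k'' (Const 0) ;;
     While (Less (Reg ''k'') (Reg ''m'')) (heap_extract K S))"

lemma heap_sort_frames [simp]:
  "wregs (heap_fill K) = {''p'', ''x'', ''y'', ''k''}" "warrs (heap_fill K) = {''H''}"
  "wregs (heap_extract K S) = {''p'', ''x'', ''y'', ''k''}"
  "warrs (heap_extract K S) = {''H'', ''O'', S}"
  "wregs (heap_sort K S) = {''p'', ''x'', ''y'', ''k''}" "warrs (heap_sort K S) = {''H'', ''O'', S}"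
  by (auto simp: heap_fill_def heap_extract_def heap_sort_def)

definition sorts :: "(int \<Rightarrow> int) \<Rightarrow> int \<Rightarrow> (int \<Rightarrow> int) \<Rightarrow> (int \<Rightarrow> int) \<Rightarrow> bool" where
  "sorts K m P S \<longleftrightarrow> bij_betw P {0..<m} {0..<m} \<and> (\<forall>k\<in>{0..<m}. S k = K (P k)) \<and> mono_on {0..<m} S"

text \<open>The last conjunct, which compares the extracted prefix with everything still in the
  tree, allows the next minimum to be appended while \<open>S\<close> stays monotone.\<close>

definition partly_sorts :: "(int \<Rightarrow> int) \<Rightarrow> int \<Rightarrow> int \<Rightarrow> (int \<Rightarrow> int) \<Rightarrow> (int \<Rightarrow> int) \<Rightarrow> bool" where
  "partly_sorts K m k P S \<longleftrightarrow> inj_on P {0..<k} \<and> P ` {0..<k} \<subseteq> {0..<m} \<and>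
     (\<forall>i\<in>{0..<k}. S i = K (P i)) \<and> mono_on {0..<k} S \<and>
     (\<forall>i\<in>{0..<k}. \<forall>x\<in>{0..<m} - P ` {0..<k}. S i \<le> K x)"

lemma partly_sorts_step:
  assumes P: "partly_sorts K m k P S" and k: "0 \<le> k"
    and x: "x \<in> {0..<m} - P ` {0..<k}" "\<And>y. y \<in> {0..<m} - P ` {0..<k} \<Longrightarrow> K x \<le> K y"
  shows "partly_sorts K m (k + 1) (P(k := x)) (S(k := K x))"
proof -
  have k1: "{0..<k + 1} = insert k {0..<k}" using k by auto
  have im: "{0..<k} \<inter> {i. i \<noteq> k} = {0..<k}" by auto
  have inj: "inj_on (P(k := x)) {0..<k}"
    using P by (auto simp: partly_sorts_def inj_on_def)
  have "mono_on (insert k {0..<k}) (S(k := K x))"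
    using P x(1) by (auto simp: partly_sorts_def mono_on_def)
  then show ?thesis
    using P x inj unfolding partly_sorts_def k1 by (auto simp: im)
qed

text \<open>An injective map from a finite interval into itself is onto.\<close>

lemma partly_sorts_all: "partly_sorts K m m P S \<Longrightarrow> sorts K m P S"
  unfolding partly_sorts_def sorts_def bij_betw_def
  using card_subset_eq[of "{0..<m}" "P ` {0..<m}"] card_image[of P "{0..<m}"] by auto

lemma partly_sorts_nonempty:
  assumes "partly_sorts K m k P S" "0 \<le> k" "k < m"
  shows "{0..<m} - P ` {0..<k} \<noteq> {}"
proof
  assume "{0..<m} - P ` {0..<k} = {}"
  then have "card {0..<m} \<le> card (P ` {0..<k})" by (intro card_mono) auto
  also have "\<dots> \<le> card {0..<k}" by (rule card_image_le) simp
  finally show False using assms by simp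
qed

text \<open>\<open>K0\<close> is arbitrary: for an empty tree the invariant holds with one key
  function exactly if it holds with any other.\<close>

lemma heap_sort_spec:
  assumes b: "bounded W s" and m: "regs s ''m'' = m" "0 \<le> m" "m \<le> 2 ^ h"
    and sz: "regs s ''sz'' = 2 ^ h" and W: "2 * 2 ^ h \<le> W"
    and ne: "K \<noteq> ''H''" "K \<noteq> ''O''" "K \<noteq> S" "S \<noteq> ''H''" "S \<noteq> ''O''"
    and H: "heap K0 (arrs s ''H'') h {}"
    and exit: "\<And>t s'. t \<le> 500 * ((nat m + 1) * (h + 1)) \<Longrightarrow> bounded W s' \<Longrightarrow>
      framed {''p'', ''x'', ''y'', ''k''} {''H'', ''O'', S} s s' \<Longrightarrow>
      heap K0 (arrs s' ''H'') h {} \<Longrightarrow> sorts (arrs s K) m (arrs s' ''O'') (arrs s' S) \<Longrightarrow> Q t s'"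
  shows "wp W (heap_sort K S) s Q"
proof -
  define s1 where "s1 = s\<lparr>regs := (regs s)(''k'' := 0)\<rparr>"
  have W0: "1 \<le> W" "0 \<le> W" using W one_le_power[of "2::int" h] by linarith+
  have "heap (arrs s K) (arrs s ''H'') h {}" using H by (rule heap_empty)
  then have fill: "wp W (While (Less (Reg ''k'') (Reg ''m'')) (heap_fill K)) s1
    (\<lambda>t s2. t \<le> (nat m + 1) * (4 + 200 * (h + 1)) \<and> heap (arrs s K) (arrs s2 ''H'') h {0..<m})"
  proof (intro wp_for[where m = m and T = "200 * (h + 1)" and
        J = "\<lambda>k s'. heap (arrs s K) (arrs s' ''H'') h {0..<k}"])
    fix k s'
    assume k: "0 \<le> k" "k < m" "regs s' ''k'' = k" and H: "heap (arrs s K) (arrs s' ''H'') h {0..<k}"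
      and b': "bounded W s'" and f: "framed (wregs (heap_fill K)) (warrs (heap_fill K)) s1 s'"
    have K': "arrs s' K = arrs s K" using framed_arrs[OF f] ne by (simp add: s1_def)
    have sz': "regs s' ''sz'' = 2 ^ h" using framed_regs[OF f] sz by (simp add: s1_def)
    define s2 where "s2 = s'\<lparr>regs := (regs s')(''p'' := 2 ^ h + k)\<rparr>"
    have p: "\<bar>2 ^ h + k\<bar> \<le> W" using k m W by auto
    have "wp W (set_leaf K (Plus (Reg ''k'') (Const 1))) s2
      (\<lambda>t s3. t \<le> 60 * (h + 2) + 10 \<and> regs s3 ''k'' = k \<and>
         heap (arrs s K) (arrs s3 ''H'') h {0..<k + 1})"
      by (rule set_leaf_spec[where h = h and e = k and X = "{0..<k}" and Y = "{0..<k + 1}"])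
        (use b' p k m W ne K' H in \<open>auto simp: s2_def bounded_def framed_def\<close>)
    then show "wp W (heap_fill K) s' (\<lambda>t s''. t \<le> 200 * (h + 1) \<and> regs s'' ''k'' = k + 1 \<and>
        heap (arrs s K) (arrs s'' ''H'') h {0..<k + 1})"
      using p k m W by (auto simp: heap_fill_def s2_def sz' elim!: wp_mono)
  qed (use b m W0 in \<open>auto simp: s1_def bounded_def\<close>)
  have extraction: "wp W (While (Less (Reg ''k'') (Reg ''m'')) (heap_extract K S)) s3
      (\<lambda>t' s4. t' \<le> (nat m + 1) * (4 + 150 * (h + 1)) \<and> heap K0 (arrs s4 ''H'') h {} \<and>
        sorts (arrs s K) m (arrs s4 ''O'') (arrs s4 S))"
    if f3: "framed {''p'', ''x'', ''y'', ''k''} {''H''} s s3" and b3: "bounded W s3" and k3: "regs s3 ''k'' = 0"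
      and H3: "heap (arrs s K) (arrs s3 ''H'') h {0..<m}" for s3
  proof (rule wp_for[where m = m and T = "150 * (h + 1)" and
        J = "\<lambda>k s'. heap (arrs s K) (arrs s' ''H'') h ({0..<m} - arrs s' ''O'' ` {0..<k}) \<and>
          partly_sorts (arrs s K) m k (arrs s' ''O'') (arrs s' S)"])
    fix k s'
    assume k: "0 \<le> k" "k < m" "regs s' ''k'' = k"
      and J: "heap (arrs s K) (arrs s' ''H'') h ({0..<m} - arrs s' ''O'' ` {0..<k}) \<and>
          partly_sorts (arrs s K) m k (arrs s' ''O'') (arrs s' S)"
      and b': "bounded W s'" and f: "framed (wregs (heap_extract K S)) (warrs (heap_extract K S)) s3 s'"
    define X where "X = {0..<m} - arrs s' ''O'' ` {0..<k}"
    define x where "x = arrs s' ''H'' 1 - 1"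
    have X: "X \<noteq> {}" "X \<subseteq> {0..<2 ^ h}"
      using partly_sorts_nonempty J k m unfolding X_def by auto
    have H: "heap (arrs s K) (arrs s' ''H'') h X" using J by (simp add: X_def)
    note x = heap_root[OF H X(2,1), folded x_def]
    have xm: "0 \<le> x" "x < m" using x(1) by (auto simp: X_def)
    have K': "arrs s' K = arrs s K"
      using framed_arrs[OF f] framed_arrs[OF f3] ne by simp
    have sz': "regs s' ''sz'' = 2 ^ h"
      using framed_regs[OF f] framed_regs[OF f3] sz by simp
    have step: "partly_sorts (arrs s K) m (k + 1) ((arrs s' ''O'')(k := x)) ((arrs s' S)(k := arrs s K x))"
      using partly_sorts_step[of "arrs s K" m k "arrs s' ''O''" "arrs s' S" x] J k x
      unfolding X_def by blast
    have X': "{0..<m} - ((arrs s' ''O'')(k := x)) ` {0..<k + 1} = X - {x}"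
    proof -
      have "{0..<k + 1} = insert k {0..<k}" using k by auto
      then show ?thesis by (auto simp: X_def)
    qed
    define s2 where "s2 = s'\<lparr>arrs := (arrs s')(''O'' := (arrs s' ''O'')(k := x), S := (arrs s' S)(k := arrs s K x)),
      regs := (regs s')(''x'' := x, ''p'' := 2 ^ h + x)\<rparr>"
    have p: "\<bar>2 ^ h + x\<bar> \<le> W" "\<bar>x\<bar> \<le> W" "\<bar>arrs s K x\<bar> \<le> W"
      using xm m W boundedD(2)[OF b', of K x] K' by auto
    have b2: "bounded W s2" using b' p by (auto simp: bounded_def s2_def)
    have leaf: "wp W (set_leaf K (Const 0)) s2
      (\<lambda>t s3. t \<le> 60 * (h + 2) + 10 \<and> regs s3 ''k'' = k \<and>
         heap (arrs s K) (arrs s3 ''H'') h ({0..<m} - arrs s3 ''O'' ` {0..<k + 1}) \<and>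
         partly_sorts (arrs s K) m (k + 1) (arrs s3 ''O'') (arrs s3 S))"
    proof (rule set_leaf_spec[where h = h and e = x and X = X and Y = "X - {x}"])
      fix t s3
      assume "t \<le> 60 * (h + 2) + 2 + acost (Const 0)" "framed {''p'', ''x'', ''y''} {''H''} s2 s3"
        and H3: "heap (arrs s2 K) (arrs s3 ''H'') h (X - {x})"
      moreover from this have "arrs s3 ''O'' = (arrs s' ''O'')(k := x)"
          "arrs s3 S = (arrs s' S)(k := arrs s K x)" "regs s3 ''k'' = k"
        using ne k by (simp_all add: framed_def s2_def)
      moreover have "arrs s2 K = arrs s K" using ne K' by (simp add: s2_def)
      ultimately show "t \<le> 60 * (h + 2) + 10 \<and> regs s3 ''k'' = k \<and>
         heap (arrs s K) (arrs s3 ''H'') h ({0..<m} - arrs s3 ''O'' ` {0..<k + 1}) \<and>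
         partly_sorts (arrs s K) m (k + 1) (arrs s3 ''O'') (arrs s3 S)"
        using X' step by (simp del: fun_upd_image)
    qed (use b2 k xm m W0 ne K' H in \<open>auto simp: s2_def\<close>)
    have "\<bar>k + 1\<bar> \<le> W" using k m W by auto
    then show "wp W (heap_extract K S) s' (\<lambda>t s''. t \<le> 150 * (h + 1) \<and> regs s'' ''k'' = k + 1 \<and>
        heap (arrs s K) (arrs s'' ''H'') h ({0..<m} - arrs s'' ''O'' ` {0..<k + 1}) \<and>
          partly_sorts (arrs s K) m (k + 1) (arrs s'' ''O'') (arrs s'' S))"
      using p k(3) ne
      by (simp add: heap_extract_def sz' K' x_def[symmetric] s2_def[symmetric]) (rule wp_mono[OF leaf], simp)
  next
    fix t s'
    assume J: "heap (arrs s K) (arrs s' ''H'') h ({0..<m} - arrs s' ''O'' ` {0..<m}) \<and>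
          partly_sorts (arrs s K) m m (arrs s' ''O'') (arrs s' S)"
      and t: "t \<le> (nat m + 1) * (4 + 150 * (h + 1))"
    then have srt: "sorts (arrs s K) m (arrs s' ''O'') (arrs s' S)" using partly_sorts_all by blast
    then have "{0..<m} - arrs s' ''O'' ` {0..<m} = {}" by (auto simp: sorts_def bij_betw_def)
    then have "heap (arrs s K) (arrs s' ''H'') h {}" using J by metis
    then have "heap K0 (arrs s' ''H'') h {}" by (rule heap_empty)
    then show "t \<le> (nat m + 1) * (4 + 150 * (h + 1)) \<and> heap K0 (arrs s' ''H'') h {} \<and>
        sorts (arrs s K) m (arrs s' ''O'') (arrs s' S)"
      using srt t by simp
  qed (use f3 b3 k3 H3 m in \<open>auto simp: framed_def partly_sorts_def\<close>)
  have "wp W (While (Less (Reg ''k'') (Reg ''m'')) (heap_fill K)) s1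
     (\<lambda>t s2. wp W (While (Less (Reg ''k'') (Reg ''m'')) (heap_extract K S))
        (s2\<lparr>regs := (regs s2)(''k'' := 0)\<rparr>) (\<lambda>t' s4. Q (2 + (t + (2 + t'))) s4))"
  proof (rule wp_conseq[OF fill])
    fix t s2
    assume t: "t \<le> (nat m + 1) * (4 + 200 * (h + 1)) \<and> heap (arrs s K) (arrs s2 ''H'') h {0..<m}"
      and f: "framed (wregs (While (Less (Reg ''k'') (Reg ''m'')) (heap_fill K)))
        (warrs (While (Less (Reg ''k'') (Reg ''m'')) (heap_fill K))) s1 s2"
      and b2: "bounded W s1 \<Longrightarrow> bounded W s2"
    define s3 where "s3 = s2\<lparr>regs := (regs s2)(''k'' := 0)\<rparr>"
    have b3: "bounded W s3" using b b2 W0 by (auto simp: bounded_def s1_def s3_def)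
    have f3: "framed {''p'', ''x'', ''y'', ''k''} {''H''} s s3"
      using f by (auto simp: framed_def s1_def s3_def)
    show "wp W (While (Less (Reg ''k'') (Reg ''m'')) (heap_extract K S))
        (s2\<lparr>regs := (regs s2)(''k'' := 0)\<rparr>) (\<lambda>t' s4. Q (2 + (t + (2 + t'))) s4)"
      unfolding s3_def[symmetric]
    proof (rule wp_conseq[OF extraction[OF f3 b3]])
      fix t' s4
      assume t': "t' \<le> (nat m + 1) * (4 + 150 * (h + 1)) \<and> heap K0 (arrs s4 ''H'') h {} \<and>
          sorts (arrs s K) m (arrs s4 ''O'') (arrs s4 S)"
        and f4: "framed (wregs (While (Less (Reg ''k'') (Reg ''m'')) (heap_extract K S)))
          (warrs (While (Less (Reg ''k'') (Reg ''m'')) (heap_extract K S))) s3 s4"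
        and b4: "bounded W s3 \<Longrightarrow> bounded W s4"
      \<comment> \<open>The loops cost at most 200 and 150 per round and level; 500 also absorbs the
        tests and assignments.\<close>
      have "2 + (t + (2 + t')) \<le> 500 * ((nat m + 1) * (h + 1))"
        using t t' by (simp add: algebra_simps)
      then show "Q (2 + (t + (2 + t'))) s4"
        by (rule exit) (use t' f3 f4 b3 b4 in \<open>auto simp: framed_def\<close>)
    qed (use t in \<open>auto simp: s3_def\<close>)
  qed
  then show ?thesis using W0 by (simp add: heap_sort_def s1_def)
qed

section \<open>Interval updates and point queries\<close>

definition upper_step :: "string \<Rightarrow> com" where
  "upper_step S =
    (Assign ''mid'' (Half (Plus (Reg ''lo'') (Reg ''r''))) ;;
     Cond (Less (Reg ''x'') (Load S (Reg ''mid'')))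
       (Assign ''r'' (Reg ''mid'')) (Assign ''lo'' (Plus (Reg ''mid'') (Const 1))))"

definition upper :: "string \<Rightarrow> com" where
  "upper S =
    (Assign ''lo'' (Const 0) ;; Assign ''r'' (Reg ''N'') ;;
     While (Less (Reg ''lo'') (Reg ''r'')) (upper_step S))"

lemma upper_frames [simp]:
  "wregs (upper_step S) = {''mid'', ''lo'', ''r''}" "warrs (upper_step S) = {}"
  "wregs (upper S) = {''mid'', ''lo'', ''r''}" "warrs (upper S) = {}"
  by (auto simp: upper_step_def upper_def)

text \<open>The returned \<open>r\<close> is the number of entries up to the sought value. Comparing
  ranks with \<open>r\<close> replaces comparing values: the counts for \<open>lo\<close> and
  \<open>hi\<close> delimit exactly the ranks whose entries lie in \<open>(lo, hi]\<close>, repeated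
  entries included.\<close>

lemma upper_spec:
  assumes b: "bounded W s" and n: "regs s ''N'' = n" "0 \<le> n" "n < 2 ^ h" "n \<le> W"
    and S: "mono_on {0..<n} (arrs s S)"
    and exit: "\<And>t s' r. t \<le> 40 * (h + 1) \<Longrightarrow> bounded W s' \<Longrightarrow>
      framed {''mid'', ''lo'', ''r''} {} s s' \<Longrightarrow> regs s' ''r'' = r \<Longrightarrow> 0 \<le> r \<Longrightarrow> r \<le> n \<Longrightarrow>
      (\<And>k. 0 \<le> k \<Longrightarrow> k < n \<Longrightarrow> k < r \<longleftrightarrow> arrs s S k \<le> regs s ''x'') \<Longrightarrow> Q t s'"
  shows "wp W (upper S) s Q"
proof -
  define I where "I = (\<lambda>(m::nat) (s'::state). 0 \<le> regs s' ''lo'' \<and> regs s' ''lo'' \<le> regs s' ''r'' \<and>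
    regs s' ''r'' \<le> n \<and> regs s' ''r'' - regs s' ''lo'' < 2 ^ m \<and>
    (\<forall>k. 0 \<le> k \<and> k < regs s' ''lo'' \<longrightarrow> arrs s S k \<le> regs s ''x'') \<and>
    (\<forall>k. regs s' ''r'' \<le> k \<and> k < n \<longrightarrow> regs s ''x'' < arrs s S k))"
  define s1 where "s1 = s\<lparr>regs := (regs s)(''lo'' := 0, ''r'' := n)\<rparr>"
  have b1: "bounded W s1" using b n by (auto simp: bounded_def s1_def)
  have "wp W (While (Less (Reg ''lo'') (Reg ''r'')) (upper_step S)) s1 (\<lambda>t. Q (Suc (Suc (Suc (Suc t)))))"
  proof (rule wp_loop[where m = h and T = 20 and I = I])
    show "I h s1" using n by (auto simp: I_def s1_def)
  next
    fix m s'
    assume I: "I m s'" and g: "bval (Less (Reg ''lo'') (Reg ''r'')) s'" and b': "bounded W s'"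
      and f: "framed (wregs (upper_step S)) (warrs (upper_step S)) s1 s'"
    have S': "arrs s' S = arrs s S" "regs s' ''x'' = regs s ''x''"
      using framed_arrs[OF f, of S] framed_regs[OF f, of "''x''"] by (simp_all add: s1_def)
    obtain m' where m: "m = Suc m'" using I g by (cases m) (auto simp: I_def)
    define l r mid where "l = regs s' ''lo''" and "r = regs s' ''r''" and "mid = (l + r) div 2"
    have lr: "0 \<le> l" "l < r" "r \<le> n" "r - l < 2 * 2 ^ m'" using I g by (auto simp: I_def l_def r_def m)
    have mid: "l \<le> mid" "mid < r" "mid - l < 2 ^ m'" "r - (mid + 1) < 2 ^ m'"
      using lr by (auto simp: mid_def)
    have left: "\<exists>m'<m. I m' s''" if "arrs s S mid \<le> regs s ''x''"
      "regs s'' ''lo'' = mid + 1" "regs s'' ''r'' = r" for s''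
    proof (intro exI[of _ m'] conjI)
      have "arrs s S k \<le> regs s ''x''" if "0 \<le> k" "k \<le> mid" for k
        using mono_onD[OF S, of k mid] that lr mid \<open>arrs s S mid \<le> regs s ''x''\<close> by auto
      then show "I m' s''" using I that lr mid by (auto simp: I_def r_def l_def)
    qed (simp add: m)
    have right: "\<exists>m'<m. I m' s''" if "\<not> arrs s S mid \<le> regs s ''x''"
      "regs s'' ''lo'' = l" "regs s'' ''r'' = mid" for s''
    proof (intro exI[of _ m'] conjI)
      have "regs s ''x'' < arrs s S k" if "mid \<le> k" "k < n" for k
        using mono_onD[OF S, of mid k] that lr mid \<open>\<not> arrs s S mid \<le> regs s ''x''\<close> by auto
      then show "I m' s''" using I that lr mid by (auto simp: I_def r_def l_def)
    qed (simp add: m)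
    have "\<bar>mid\<bar> \<le> W" "\<bar>mid + 1\<bar> \<le> W" using lr mid n by auto
    then show "wp W (upper_step S) s' (\<lambda>t s''. t \<le> 20 \<and> (\<exists>m'<m. I m' s''))"
      by (simp add: upper_step_def S' l_def[symmetric] r_def[symmetric] mid_def[symmetric] left right)
  next
    fix m' t s'
    assume I: "I m' s'" and g: "\<not> bval (Less (Reg ''lo'') (Reg ''r'')) s'" and b': "bounded W s'"
      and f: "framed (wregs (upper_step S)) (warrs (upper_step S)) s1 s'"
      and t: "t \<le> (h + 1) * (1 + bcost (Less (Reg ''lo'') (Reg ''r'')) + 20)"
    show "Q (Suc (Suc (Suc (Suc t)))) s'"
    proof (rule exit[where r = "regs s' ''r''"])
      show "framed {''mid'', ''lo'', ''r''} {} s s'" using f by (auto simp: framed_def s1_def)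
    qed (use I g b' t in \<open>auto simp: I_def not_less[symmetric]\<close>)
  qed (rule b1)
  then show ?thesis using b n boundedD(1)[OF b, of "''N''"] by (simp add: upper_def s1_def)
qed

text \<open>The maximum of 0 and all labels on the path from node \<open>p\<close> to the root. In a
  segment tree whose updates stay at the nodes covering an interval, without being pushed down, this
  is the value at the leaf \<open>p\<close>.\<close>

function stab :: "(int \<Rightarrow> int) \<Rightarrow> int \<Rightarrow> int" where
  "stab T p = (if p \<le> 0 then 0 else max (T p) (stab T (p div 2)))"
  by auto
termination by (relation "Wellfounded.measure (\<lambda>(T, p). nat p)") auto

declare stab.simps [simp del]

lemma stab_nonneg: "0 \<le> stab T p"
  by (induction T p rule: stab.induct) (subst stab.simps, auto)

lemma stab_zero: "stab (\<lambda>_. 0) p = 0"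
  by (induction "\<lambda>_::int. 0::int" p rule: stab.induct) (subst stab.simps, auto)

text \<open>The path from \<open>k\<close> to the root visits only nodes up to
  \<open>k\<close>.\<close>

lemma stab_upd_below: "k < p \<Longrightarrow> stab (T(p := w)) k = stab T k"
proof (induction T k rule: stab.induct)
  case (1 T k)
  show ?case
  proof (cases "k \<le> 0")
    case False
    then have "stab (T(p := w)) (k div 2) = stab T (k div 2)" using 1(2) by (intro 1(1)) auto
    then show ?thesis using 1(2) by (subst (1 2) stab.simps) (simp del: fun_upd_apply, simp)
  qed (subst (1 2) stab.simps, simp)
qed

text \<open>On the level of \<open>p\<close> the path from \<open>k\<close> meets exactly one node,
  its ancestor \<open>k div 2 ^ g\<close>; raising the label of \<open>p\<close> is seen by
  \<open>k\<close> precisely if that node is \<open>p\<close>.\<close>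

lemma stab_chmax_node:
  assumes p: "2 ^ e \<le> p" "p < 2 * 2 ^ e"
  shows "2 ^ (e + g) \<le> k \<Longrightarrow> k < 2 * 2 ^ (e + g) \<Longrightarrow>
    stab (T(p := max v (T p))) k = (if k div 2 ^ g = p then max v (stab T k) else stab T k)"
proof (induction g arbitrary: k)
  case 0
  have "0 < k" using 0 by (metis add_0_right order_less_le_trans zero_less_numeral zero_less_power)
  have "k div 2 < p" using 0 p by auto
  then have "stab (T(p := max v (T p))) (k div 2) = stab T (k div 2)" by (rule stab_upd_below)
  then show ?case using \<open>0 < k\<close> by (subst (1 2 3) stab.simps) (auto simp: max.assoc)
next
  case (Suc g)
  have "(2::int) ^ e \<le> 2 ^ (e + g)" by (rule power_increasing) auto
  moreover have "2 * 2 ^ (e + g) \<le> k" using Suc.prems by simp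
  ultimately have "k \<noteq> p" using p by linarith
  have "0 < k" using Suc.prems(1) by (metis order_less_le_trans zero_less_numeral zero_less_power)
  have "stab (T(p := max v (T p))) (k div 2) =
      (if k div 2 div 2 ^ g = p then max v (stab T (k div 2)) else stab T (k div 2))"
    using Suc.prems by (intro Suc.IH) auto
  moreover have "k div 2 div 2 ^ g = k div 2 ^ Suc g" by (simp add: zdiv_zmult2_eq)
  ultimately show ?case
    using \<open>0 < k\<close> \<open>k \<noteq> p\<close> by (subst (1 2 3) stab.simps) (auto simp: max.left_commute)
qed

definition query_step :: "string \<Rightarrow> com" where
  "query_step T =
    (Cond (Less (Reg ''q'') (Load T (Reg ''p''))) (Assign ''q'' (Load T (Reg ''p''))) Skip ;;
     Assign ''p'' (Half (Reg ''p'')))"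

definition query :: "string \<Rightarrow> com" where
  "query T = (Assign ''q'' (Const 0) ;; While (Less (Const 0) (Reg ''p'')) (query_step T))"

lemma query_frames [simp]:
  "wregs (query_step T) = {''p'', ''q''}" "warrs (query_step T) = {}"
  "wregs (query T) = {''p'', ''q''}" "warrs (query T) = {}"
  by (auto simp: query_step_def query_def)

text \<open>The maximum of \<open>q\<close> and the labels on the path still ahead is
  invariant.\<close>

lemma query_spec:
  assumes b: "bounded W s" and p: "0 \<le> regs s ''p''" "regs s ''p'' < 2 ^ h"
    and exit: "\<And>t s'. t \<le> 40 * (h + 1) \<Longrightarrow> bounded W s' \<Longrightarrow> framed {''p'', ''q''} {} s s' \<Longrightarrow>
      regs s' ''q'' = stab (arrs s T) (regs s ''p'') \<Longrightarrow> Q t s'"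
  shows "wp W (query T) s Q"
proof -
  define s1 where "s1 = s\<lparr>regs := (regs s)(''q'' := 0)\<rparr>"
  define I where "I = (\<lambda>(m::nat) (s'::state). 0 \<le> regs s' ''p'' \<and> regs s' ''p'' < 2 ^ m \<and>
    0 \<le> regs s' ''q'' \<and>
    max (regs s' ''q'') (stab (arrs s T) (regs s' ''p'')) = stab (arrs s T) (regs s ''p''))"
  have W: "0 \<le> W" using boundedD(1)[OF b, of "''p''"] by linarith
  have "wp W (While (Less (Const 0) (Reg ''p'')) (query_step T)) s1 (\<lambda>t. Q (Suc (Suc t)))"
  proof (rule wp_loop[where m = h and T = 20 and I = I])
    show "I h s1" using p stab_nonneg by (auto simp: I_def s1_def max_def)
  next
    fix m s'
    assume I: "I m s'" and g: "bval (Less (Const 0) (Reg ''p'')) s'" and b': "bounded W s'"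
      and f: "framed (wregs (query_step T)) (warrs (query_step T)) s1 s'"
    have T': "arrs s' T = arrs s T" using framed_arrs[OF f, of T] by (simp add: s1_def)
    obtain m' where m: "m = Suc m'" using I g by (cases m) (auto simp: I_def)
    define p q where "p = regs s' ''p''" and "q = regs s' ''q''"
    have p: "0 < p" "p < 2 * 2 ^ m'" "0 \<le> q" using I g by (auto simp: I_def p_def q_def m)
    have "stab (arrs s T) p = max (arrs s T p) (stab (arrs s T) (p div 2))"
      using p by (subst stab.simps) simp
    then have next': "\<exists>m'<m. I m' s''"
      if "regs s'' ''p'' = p div 2" "regs s'' ''q'' = max q (arrs s T p)" for s''
      using that p I by (intro exI[of _ m']) (auto simp: I_def m p_def q_def max.assoc)
    have "\<bar>p div 2\<bar> \<le> W" using p boundedD(1)[OF b', of "''p''"] by (simp add: p_def)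
    moreover have "\<bar>arrs s T p\<bar> \<le> W" using boundedD(2)[OF b', of T p] by (simp add: T')
    ultimately show "wp W (query_step T) s' (\<lambda>t s''. t \<le> 20 \<and> (\<exists>m'<m. I m' s''))"
      by (simp add: query_step_def T' p_def[symmetric] q_def[symmetric] next')
  next
    fix m' t s'
    assume I: "I m' s'" and g: "\<not> bval (Less (Const 0) (Reg ''p'')) s'" and b': "bounded W s'"
      and f: "framed (wregs (query_step T)) (warrs (query_step T)) s1 s'"
      and t: "t \<le> (h + 1) * (1 + bcost (Less (Const 0) (Reg ''p'')) + 20)"
    have "regs s' ''p'' = 0" using I g by (auto simp: I_def)
    then have "regs s' ''q'' = stab (arrs s T) (regs s ''p'')"
      using I by (simp add: I_def stab.simps[of _ 0] max_def split: if_splits)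
    moreover have "framed {''p'', ''q''} {} s s'" using f by (auto simp: framed_def s1_def)
    ultimately show "Q (Suc (Suc t)) s'" using t b' by (intro exit) auto
  qed (use b W in \<open>auto simp: bounded_def s1_def\<close>)
  then show ?thesis using W by (simp add: query_def s1_def)
qed

section \<open>Raising all leaves of an interval\<close>

definition chmax :: "string \<Rightarrow> aexp \<Rightarrow> aexp \<Rightarrow> com" where
  "chmax T i v = Cond (Less (Load T i) v) (Store T i v) Skip"

lemma chmax_frames [simp]: "wregs (chmax T i v) = {}" "warrs (chmax T i v) = {T}"
  by (auto simp: chmax_def)

text \<open>If the test fails, the update with the maximum is the identity, so both branches reach
  the same final state.\<close>

lemma wp_chmax:
  assumes "\<bar>aval v s\<bar> \<le> W"
    and "\<And>t. t \<le> 4 + 2 * acost i + 2 * acost v \<Longrightarrow>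
      Q t (s\<lparr>arrs := (arrs s)(T := (arrs s T)(aval i s := max (aval v s) (arrs s T (aval i s))))\<rparr>)"
  shows "wp W (chmax T i v) s Q"
proof (cases "arrs s T (aval i s) < aval v s")
  case True
  then show ?thesis using assms by (simp add: chmax_def max_def)
next
  case False
  then have "max (aval v s) (arrs s T (aval i s)) = arrs s T (aval i s)" by simp
  then have "s\<lparr>arrs := (arrs s)(T := (arrs s T)(aval i s := max (aval v s) (arrs s T (aval i s))))\<rparr> = s"
    by simp
  then show ?thesis using assms(2) False by (simp add: chmax_def)
qed

text \<open>The test compares \<open>l\<close> with twice its half, which detects odd numbers
  without a modulus. An odd \<open>l\<close> is a right child whose sibling lies outside the
  interval, so it is labelled itself; for an odd exclusive end \<open>r\<close> the same holds of
  the left child \<open>r - 1\<close>.\<close>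

definition update_left :: "string \<Rightarrow> com" where
  "update_left T =
    (Cond (Less (dbl (Half (Reg ''l''))) (Reg ''l''))
       (chmax T (Reg ''l'') (Reg ''v'') ;; Assign ''l'' (Plus (Reg ''l'') (Const 1))) Skip ;;
     Assign ''l'' (Half (Reg ''l'')))"

definition update_right :: "string \<Rightarrow> com" where
  "update_right T =
    (Cond (Less (dbl (Half (Reg ''r''))) (Reg ''r''))
       (Assign ''r'' (Minus (Reg ''r'') (Const 1)) ;; chmax T (Reg ''r'') (Reg ''v'')) Skip ;;
     Assign ''r'' (Half (Reg ''r'')))"

lemma update_left_spec:
  assumes "\<bar>regs s ''v''\<bar> \<le> W" "\<bar>regs s ''l'' + 1\<bar> \<le> W" "\<bar>(regs s ''l'' + 1) div 2\<bar> \<le> W"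
    and exit: "\<And>t s' l v. t \<le> 30 \<Longrightarrow> l = regs s ''l'' \<Longrightarrow> v = regs s ''v'' \<Longrightarrow>
      regs s' = (regs s)(''l'' := (l + 1) div 2) \<Longrightarrow>
      arrs s' T = (if odd l then (arrs s T)(l := max v (arrs s T l)) else arrs s T) \<Longrightarrow> Q t s'"
  shows "wp W (update_left T) s Q"
proof -
  have c: "bval (Less (dbl (Half (Reg ''l''))) (Reg ''l'')) s \<longleftrightarrow> odd (regs s ''l'')"
    unfolding bval.simps aval.simps by presburger
  show ?thesis
  proof (cases "odd (regs s ''l'')")
    case True
    show ?thesis
      unfolding update_left_def wp_Seq wp_Cond c if_P[OF True]
    proof (rule wp_chmax, goal_cases)
      case (2 t)
      have "\<bar>(regs s ''l'' + 1) div 2\<bar> \<le> W" by (rule assms)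
      then show ?case using 2 assms(2) True by (simp add: exit)
    qed (use assms(1) in simp)
  next
    case False
    then have "regs s ''l'' div 2 = (regs s ''l'' + 1) div 2" by presburger
    then show ?thesis
      unfolding update_left_def wp_Seq wp_Cond c if_not_P[OF False]
      using assms(3) False by (simp add: exit)
  qed
qed

lemma update_right_spec:
  assumes "\<bar>regs s ''v''\<bar> \<le> W" "\<bar>regs s ''r'' - 1\<bar> \<le> W" "\<bar>regs s ''r'' div 2\<bar> \<le> W"
    and exit: "\<And>t s' r v. t \<le> 30 \<Longrightarrow> r = regs s ''r'' \<Longrightarrow> v = regs s ''v'' \<Longrightarrow>
      regs s' = (regs s)(''r'' := r div 2) \<Longrightarrow>
      arrs s' T = (if odd r then (arrs s T)(r - 1 := max v (arrs s T (r - 1))) else arrs s T) \<Longrightarrow> Q t s'"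
  shows "wp W (update_right T) s Q"
proof -
  have c: "bval (Less (dbl (Half (Reg ''r''))) (Reg ''r'')) s \<longleftrightarrow> odd (regs s ''r'')"
    unfolding bval.simps aval.simps by presburger
  show ?thesis
  proof (cases "odd (regs s ''r'')")
    case True
    then have h: "(regs s ''r'' - 1) div 2 = regs s ''r'' div 2" by presburger
    show ?thesis
      unfolding update_right_def wp_Seq wp_Cond c if_P[OF True] wp_Assign
      by (intro conjI wp_chmax) (use assms(1-3) True h in \<open>simp_all add: exit\<close>)
  next
    case False
    then show ?thesis
      unfolding update_right_def wp_Seq wp_Cond c if_not_P[OF False]
      using assms(3) by (simp add: exit)
  qed
qed

definition update_step :: "string \<Rightarrow> com" where
  "update_step T = (update_left T ;; update_right T)"

definition update :: "string \<Rightarrow> com" where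
  "update T = While (Less (Reg ''l'') (Reg ''r'')) (update_step T)"

lemma update_frames [simp]:
  "wregs (update_step T) = {''l'', ''r''}" "warrs (update_step T) = {T}"
  "wregs (update T) = {''l'', ''r''}" "warrs (update T) = {T}"
  by (auto simp: update_step_def update_left_def update_right_def update_def)

text \<open>
  One round covers the odd left end, the odd right end, and the parents of what remains of the
  interval; \<open>g\<close> is the height of the current level above the leaves.
\<close>

lemma stab_update_round:
  fixes l r v :: int and T :: "int \<Rightarrow> int"
  defines "T1 \<equiv> (if odd l then T(l := max v (T l)) else T)"
  defines "T2 \<equiv> (if odd r then T1(r - 1 := max v (T1 (r - 1))) else T1)"
  assumes lr: "2 ^ e \<le> l" "l < r" "r \<le> 2 * 2 ^ e" and k: "2 ^ (e + g) \<le> k" "k < 2 * 2 ^ (e + g)"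
  shows "(if (l + 1) div 2 \<le> k div 2 ^ Suc g \<and> k div 2 ^ Suc g < r div 2
      then max v (stab T2 k) else stab T2 k) =
    (if l \<le> k div 2 ^ g \<and> k div 2 ^ g < r then max v (stab T k) else stab T k)"
proof -
  define q where "q = k div 2 ^ g"
  have q2: "k div 2 ^ Suc g = q div 2" by (simp add: q_def zdiv_zmult2_eq[symmetric] mult.commute)
  have T1: "stab T1 k = (if odd l \<and> q = l then max v (stab T k) else stab T k)"
    using stab_chmax_node[of e l g k T v] lr k by (simp add: T1_def q_def)
  have T2: "stab T2 k = (if odd r \<and> q = r - 1 then max v (stab T1 k) else stab T1 k)"
    using stab_chmax_node[of e "r - 1" g k T1 v] lr k by (simp add: T2_def q_def)
  have "(l \<le> q \<and> q < r) \<longleftrightarrow> (odd l \<and> q = l) \<or> (odd r \<and> q = r - 1) \<or>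
      ((l + 1) div 2 \<le> q div 2 \<and> q div 2 < r div 2)"
    using lr(2) by (cases "even l"; cases "even r"; cases "even q") (auto elim!: evenE oddE)
  then show ?thesis unfolding q2 T2 T1 q_def[symmetric] by auto
qed

text \<open>Invariant: the labels stored so far, combined with the update still pending on
  \<open>[l, r)\<close> at height \<open>g\<close>, give each leaf its final value. When the
  interval is empty, nothing is pending. Each round moves one level up, so \<open>h + 1\<close>
  rounds suffice.\<close>

lemma update_spec:
  assumes b: "bounded W s" and lr: "2 ^ h \<le> regs s ''l''" "regs s ''r'' \<le> 2 * 2 ^ h"
    and W: "2 * 2 ^ h \<le> W"
    and exit: "\<And>t s'. t \<le> 80 * (h + 2) \<Longrightarrow> bounded W s' \<Longrightarrow> framed {''l'', ''r''} {T} s s' \<Longrightarrow>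
      (\<And>k. 2 ^ h \<le> k \<Longrightarrow> k < 2 * 2 ^ h \<Longrightarrow> stab (arrs s' T) k =
        (if regs s ''l'' \<le> k \<and> k < regs s ''r'' then max (regs s ''v'') (stab (arrs s T) k)
         else stab (arrs s T) k)) \<Longrightarrow> Q t s'"
  shows "wp W (update T) s Q"
proof -
  define v where "v = regs s ''v''"
  define goal where "goal k = (if regs s ''l'' \<le> k \<and> k < regs s ''r'' then max v (stab (arrs s T) k)
         else stab (arrs s T) k)" for k
  define I where "I = (\<lambda>(m::nat) (s'::state). \<exists>e g. e + g = h \<and>
    (regs s' ''l'' < regs s' ''r'' \<longrightarrow> m = Suc e \<and> 2 ^ e \<le> regs s' ''l'' \<and> regs s' ''r'' \<le> 2 * 2 ^ e) \<and>
    (\<forall>k. 2 ^ h \<le> k \<and> k < 2 * 2 ^ h \<longrightarrow>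
      (if regs s' ''l'' \<le> k div 2 ^ g \<and> k div 2 ^ g < regs s' ''r'' then max v (stab (arrs s' T) k)
       else stab (arrs s' T) k) = goal k))"
  show ?thesis unfolding update_def
  proof (rule wp_loop[where m = "Suc h" and T = 60 and I = I])
    show "I (Suc h) s" unfolding I_def
      by (rule exI[of _ h], rule exI[of _ 0]) (use lr in \<open>auto simp: goal_def\<close>)
  next
    fix m s'
    assume I: "I m s'" and gd: "bval (Less (Reg ''l'') (Reg ''r'')) s'" and b': "bounded W s'"
      and f: "framed (wregs (update_step T)) (warrs (update_step T)) s s'"
    have v': "regs s' ''v'' = v" using framed_regs[OF f] by (simp add: v_def)
    define l r A where "l = regs s' ''l''" and "r = regs s' ''r''" and "A = arrs s' T"
    obtain e g where eg: "e + g = h" "m = Suc e" "2 ^ e \<le> l" "l < r" "r \<le> 2 * 2 ^ e"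
      and goal: "\<And>k. 2 ^ h \<le> k \<Longrightarrow> k < 2 * 2 ^ h \<Longrightarrow>
        (if l \<le> k div 2 ^ g \<and> k div 2 ^ g < r then max v (stab A k) else stab A k) = goal k"
    proof -
      have "l < r" using gd by (simp add: l_def r_def)
      with I show ?thesis using that
        unfolding I_def l_def[symmetric] r_def[symmetric] A_def[symmetric] by blast
    qed
    define A1 where "A1 = (if odd l then A(l := max v (A l)) else A)"
    define A2 where "A2 = (if odd r then A1(r - 1 := max v (A1 (r - 1))) else A1)"
    have e1: "(1::int) \<le> 2 ^ e" by simp
    have round: "(if (l + 1) div 2 \<le> k div 2 ^ Suc g \<and> k div 2 ^ Suc g < r div 2
        then max v (stab A2 k) else stab A2 k) = goal k" if "2 ^ h \<le> k" "k < 2 * 2 ^ h" for k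
      using stab_update_round[where g = g and k = k and T = A and v = v, OF eg(3-5)]
        goal[OF that] that eg(1) by (simp only: A1_def[symmetric] A2_def[symmetric])
    have next': "\<exists>m'<m. I m' s''"
      if s'': "regs s'' ''l'' = (l + 1) div 2" "regs s'' ''r'' = r div 2" "arrs s'' T = A2" for s''
    proof (cases e)
      \<comment> \<open>At the root the interval is \<open>[1, 2)\<close>. The odd left end covers
        it, and the halved interval \<open>[1, 1)\<close> is empty.\<close>
      case 0
      then have lr: "(l + 1) div 2 = 1" "r div 2 = 1" using eg by auto
      have "stab A2 k = goal k" if "2 ^ h \<le> k" "k < 2 * 2 ^ h" for k
        using round[OF that] unfolding lr by (simp split: if_splits)
      then have "I 0 s''"
        unfolding I_def
        by (rule_tac exI[of _ 0], rule_tac exI[of _ h]) (use s'' lr in auto)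
      then show ?thesis using eg by auto
    next
      case (Suc e')
      have "I e s''"
        unfolding I_def
      proof (rule exI[of _ e'], rule exI[of _ "Suc g"], intro conjI allI impI)
        fix k :: int assume "2 ^ h \<le> k \<and> k < 2 * 2 ^ h"
        then show "(if regs s'' ''l'' \<le> k div 2 ^ Suc g \<and> k div 2 ^ Suc g < regs s'' ''r''
          then max v (stab (arrs s'' T) k) else stab (arrs s'' T) k) = goal k"
          using round[of k] by (simp only: s'')
      qed (use eg Suc s'' in auto)
      then show ?thesis using eg by auto
    qed
    have bd: "\<bar>v\<bar> \<le> W" "\<bar>l + 1\<bar> \<le> W" "\<bar>r - 1\<bar> \<le> W" "\<bar>(l + 1) div 2\<bar> \<le> W" "\<bar>r div 2\<bar> \<le> W"
    proof -
      have "1 \<le> l" using eg(3) e1 by linarith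
      moreover have "r \<le> W" using boundedD(3)[OF b', of "''r''"] by (simp add: r_def)
      ultimately show "\<bar>v\<bar> \<le> W" "\<bar>l + 1\<bar> \<le> W" "\<bar>r - 1\<bar> \<le> W" "\<bar>(l + 1) div 2\<bar> \<le> W" "\<bar>r div 2\<bar> \<le> W"
        using boundedD(1)[OF b', of "''v''"] v' eg(4) by auto
    qed
    show "wp W (update_step T) s' (\<lambda>t s''. t \<le> 60 \<and> (\<exists>m'<m. I m' s''))"
      unfolding update_step_def wp_Seq
    proof (rule update_left_spec, goal_cases)
      case left: (4 t s1)
      show ?case
      proof (rule update_right_spec, goal_cases)
        case right: (4 t' s2)
        have "\<exists>m'<m. I m' s2"
          by (rule next') (use left right v' in \<open>simp_all add: A1_def A2_def l_def r_def A_def\<close>)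
        then show ?case using left(1) right(1) by simp
      qed (use left bd v' in \<open>simp_all add: r_def\<close>)
    qed (use bd v' in \<open>simp_all add: l_def\<close>)
  next
    fix m' t s'
    assume I: "I m' s'" and g: "\<not> bval (Less (Reg ''l'') (Reg ''r'')) s'" and b': "bounded W s'"
      and f: "framed (wregs (update_step T)) (warrs (update_step T)) s s'"
      and t: "t \<le> (Suc h + 1) * (1 + bcost (Less (Reg ''l'') (Reg ''r'')) + 60)"
    have "stab (arrs s' T) k = goal k" if "2 ^ h \<le> k" "k < 2 * 2 ^ h" for k
    proof -
      obtain g where "(if regs s' ''l'' \<le> k div 2 ^ g \<and> k div 2 ^ g < regs s' ''r'' then max v (stab (arrs s' T) k)
       else stab (arrs s' T) k) = goal k"
        using I \<open>2 ^ h \<le> k\<close> \<open>k < 2 * 2 ^ h\<close> unfolding I_def by blast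
      moreover have "\<not> (regs s' ''l'' \<le> k div 2 ^ g \<and> k div 2 ^ g < regs s' ''r'')" using g by auto
      ultimately show ?thesis by simp
    qed
    then show "Q t s'" using t b' f by (intro exit) (auto simp: goal_def v_def)
  qed (rule b)
qed

section \<open>Sweeping over sorted events\<close>

definition sweep_query :: "string \<Rightarrow> string \<Rightarrow> string \<Rightarrow> com \<Rightarrow> com" where
  "sweep_query T S X post =
    (Assign ''x'' (Load X (Reg ''e'')) ;; upper S ;;
     Assign ''p'' (Minus (Plus (Reg ''sz'') (Reg ''r'')) (Const 1)) ;; query T ;; post)"

definition sweep_insert :: "string \<Rightarrow> string \<Rightarrow> aexp \<Rightarrow> aexp \<Rightarrow> aexp \<Rightarrow> com" where
  "sweep_insert T S lo hi v =
    (Assign ''j'' (Minus (Reg ''e'') (Reg ''N'')) ;;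
     Assign ''x'' lo ;; upper S ;; Assign ''l'' (Plus (Reg ''sz'') (Reg ''r'')) ;;
     Assign ''x'' hi ;; upper S ;; Assign ''r'' (Plus (Reg ''sz'') (Reg ''r'')) ;;
     Assign ''v'' v ;; update T)"

definition sweep_step :: "string \<Rightarrow> string \<Rightarrow> string \<Rightarrow> aexp \<Rightarrow> aexp \<Rightarrow> aexp \<Rightarrow> com \<Rightarrow> com" where
  "sweep_step T S X lo hi v post =
    (Assign ''e'' (Load ''O'' (Reg ''k'')) ;;
     Cond (Less (Reg ''e'') (Reg ''N'')) (sweep_query T S X post) (sweep_insert T S lo hi v) ;;
     Assign ''k'' (Plus (Reg ''k'') (Const 1)))"

definition sweep :: "string \<Rightarrow> string \<Rightarrow> string \<Rightarrow> aexp \<Rightarrow> aexp \<Rightarrow> aexp \<Rightarrow> com \<Rightarrow> com" where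
  "sweep T S X lo hi v post =
    (Assign ''k'' (Const 0) ;;
     While (Less (Reg ''k'') (Reg ''m'')) (sweep_step T S X lo hi v post))"

abbreviation sweep_regs :: "string set" where
  "sweep_regs \<equiv> {''e'', ''j'', ''k'', ''l'', ''lo'', ''mid'', ''p'', ''q'', ''r'', ''v'', ''x''}"

lemma sweep_frames [simp]:
  "wregs (sweep_query T S X post) = {''x'', ''mid'', ''lo'', ''r'', ''p'', ''q''} \<union> wregs post"
  "warrs (sweep_query T S X post) = warrs post"
  "wregs (sweep_insert T S lo hi v) = {''j'', ''x'', ''mid'', ''lo'', ''r'', ''l'', ''v''}"
  "warrs (sweep_insert T S lo hi v) = {T}"
  "wregs (sweep_step T S X lo hi v post) = sweep_regs \<union> wregs post"
  "warrs (sweep_step T S X lo hi v post) = insert T (warrs post)"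
  "wregs (sweep T S X lo hi v post) = sweep_regs \<union> wregs post"
  "warrs (sweep T S X lo hi v post) = insert T (warrs post)"
  by (auto simp: sweep_query_def sweep_insert_def sweep_step_def sweep_def)

text \<open>
  Of the \<open>2 * n\<close> events, \<open>i < n\<close> asks for the best interval around the value \<open>x i\<close>, and \<open>n + j\<close>
  inserts the interval \<open>(lo j, hi j]\<close> with the value \<open>val j\<close>; \<open>P\<close> is the order of events.
\<close>

definition inserted :: "int \<Rightarrow> (int \<Rightarrow> int) \<Rightarrow> int \<Rightarrow> int set" where
  "inserted n P k = {j \<in> {0..<n}. \<exists>i\<in>{0..<k}. P i = n + j}"

text \<open>The default 0 matches an all-zero tree; values that must be told apart from it have to
  be positive.\<close>

definition best :: "int set \<Rightarrow> (int \<Rightarrow> int) \<Rightarrow> (int \<Rightarrow> int) \<Rightarrow> (int \<Rightarrow> int) \<Rightarrow> int \<Rightarrow> int" where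
  "best X lo hi val y = Max (insert 0 (val ` {j \<in> X. lo j < y \<and> y \<le> hi j}))"

lemma finite_inserted [simp]: "finite (inserted n P k)"
  by (rule finite_subset[of _ "{0..<n}"]) (auto simp: inserted_def)

lemma inserted_query:
  assumes "0 \<le> k" "P k < n"
  shows "inserted n P (k + 1) = inserted n P k"
proof -
  have "{0..<k + 1} = insert k {0..<k}" using assms by auto
  then show ?thesis using assms by (auto simp: inserted_def)
qed

lemma inserted_insert:
  assumes "0 \<le> k" "P k = n + j" "j \<in> {0..<n}"
  shows "inserted n P (k + 1) = insert j (inserted n P k)"
proof -
  have "{0..<k + 1} = insert k {0..<k}" using assms by auto
  then show ?thesis using assms by (auto simp: inserted_def)
qed

lemma best_insert:
  assumes "finite X"
  shows "best (insert j X) lo hi val y =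
    (if lo j < y \<and> y \<le> hi j then max (val j) (best X lo hi val y) else best X lo hi val y)"
proof -
  have "{i \<in> insert j X. lo i < y \<and> y \<le> hi i} =
     (if lo j < y \<and> y \<le> hi j then insert j {i \<in> X. lo i < y \<and> y \<le> hi i}
      else {i \<in> X. lo i < y \<and> y \<le> hi i})" by auto
  then show ?thesis
    using assms by (simp add: best_def insert_commute[of 0] Max_insert)
qed

text \<open>Coordinates are compressed: leaf \<open>2 ^ h + k\<close> stands for the coordinate of
  rank \<open>k\<close>, and \<open>f\<close> is recorded only at coordinates that occur.\<close>

definition represents :: "(int \<Rightarrow> int) \<Rightarrow> nat \<Rightarrow> int \<Rightarrow> (int \<Rightarrow> int) \<Rightarrow> (int \<Rightarrow> int) \<Rightarrow> bool" where
  "represents T h n S f \<longleftrightarrow> (\<forall>k. 0 \<le> k \<and> k < n \<longrightarrow> stab T (2 ^ h + k) = f (S k))"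

lemma sweep_query_spec:
  fixes n x :: int
  assumes b: "bounded W s" and n: "regs s ''N'' = n" "0 \<le> n" "n < 2 ^ h" "2 * 2 ^ h \<le> W"
    and sz: "regs s ''sz'' = 2 ^ h" and S: "mono_on {0..<n} (arrs s S)"
    and x: "x = arrs s X (regs s ''e'')" "x \<in> arrs s S ` {0..<n}"
    and T: "represents (arrs s T) h n (arrs s S) f"
    and post: "\<And>s'. bounded W s' \<Longrightarrow> arrs s' = arrs s \<Longrightarrow> regs s' ''N'' = n \<Longrightarrow> regs s' ''q'' = f x \<Longrightarrow>
      regs s' ''e'' = regs s ''e'' \<Longrightarrow> regs s' ''k'' = regs s ''k'' \<Longrightarrow>
      wp W post s' (\<lambda>t s''. t \<le> 100 \<and> Q s'')"
  shows "wp W (sweep_query T S X post) s (\<lambda>t s''. t \<le> 100 * (h + 1) + 130 \<and> Q s'')"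
proof -
  have W1: "\<bar>x\<bar> \<le> W" using boundedD(2)[OF b] x by simp
  define s1 where "s1 = s\<lparr>regs := (regs s)(''x'' := x)\<rparr>"
  have b1: "bounded W s1" using b W1 by (auto simp: bounded_def s1_def)
  have "wp W (upper S) s1 (\<lambda>t s2. wp W (Assign ''p'' (Minus (Plus (Reg ''sz'') (Reg ''r'')) (Const 1)) ;;
      query T ;; post) s2 (\<lambda>t' s''. 3 + (t + t') \<le> 100 * (h + 1) + 130 \<and> Q s''))"
  proof (rule upper_spec[where h = h and n = n])
    fix t s2 r
    assume t: "t \<le> 40 * (h + 1)" and b2: "bounded W s2" and f: "framed {''mid'', ''lo'', ''r''} {} s1 s2"
      and r: "regs s2 ''r'' = r" "0 \<le> r" "r \<le> n"
      and ub: "\<And>k. 0 \<le> k \<Longrightarrow> k < n \<Longrightarrow> k < r \<longleftrightarrow> arrs s1 S k \<le> regs s1 ''x''"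
    have A2: "arrs s2 = arrs s" using f by (auto simp: framed_def s1_def)
    have sz2: "regs s2 ''sz'' = 2 ^ h" "regs s2 ''N'' = n" "regs s2 ''e'' = regs s ''e''"
        "regs s2 ''k'' = regs s ''k''"
      using f sz n by (simp_all add: framed_def s1_def)
    obtain k where k: "0 \<le> k" "k < n" "arrs s S k = x" using x(2) by auto
    then have kr: "k < r" using ub[of k] by (simp add: s1_def)
    \<comment> \<open>\<open>x\<close> itself is among the counted entries, so the last of them, at
      rank \<open>r - 1\<close>, equals \<open>x\<close>. This is why 1 is subtracted before the
      query.\<close>
    then have Sr: "arrs s S (r - 1) \<le> x" using ub[of "r - 1"] r k by (simp add: s1_def)
    have "x \<le> arrs s S (r - 1)" using mono_onD[OF S, of k "r - 1"] k kr r by simp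
    then have "stab (arrs s T) (2 ^ h + r - 1) = f x"
      using T Sr kr k r unfolding represents_def by (auto dest!: spec[of _ "r - 1"] simp: algebra_simps)
    moreover define s3 where "s3 = s2\<lparr>regs := (regs s2)(''p'' := 2 ^ h + r - 1)\<rparr>"
    ultimately have stab3: "stab (arrs s3 T) (regs s3 ''p'') = f x" by (simp add: A2)
    have p: "\<bar>2 ^ h + r - 1\<bar> \<le> W" using n r kr k by auto
    have b3: "bounded W s3" using b2 p by (auto simp: bounded_def s3_def)
    have "wp W (query T) s3 (\<lambda>t' s4. wp W post s4
      (\<lambda>t'' s''. 3 + (t + (4 + 2 + (t' + t''))) \<le> 100 * (h + 1) + 130 \<and> Q s''))"
    proof (rule query_spec[where h = "Suc h"])
      fix t' s4
      assume t': "t' \<le> 40 * (Suc h + 1)" and b4: "bounded W s4" and f4: "framed {''p'', ''q''} {} s3 s4"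
        and q: "regs s4 ''q'' = stab (arrs s3 T) (regs s3 ''p'')"
      have "wp W post s4 (\<lambda>t s''. t \<le> 100 \<and> Q s'')"
        by (rule post) (use b4 f4 q stab3 A2 sz2 in \<open>auto simp: framed_def s3_def\<close>)
      then show "wp W post s4
          (\<lambda>t'' s''. 3 + (t + (4 + 2 + (t' + t''))) \<le> 100 * (h + 1) + 130 \<and> Q s'')"
        by (rule wp_mono) (use t t' in auto)
    qed (use b3 r kr k n in \<open>auto simp: s3_def\<close>)
    then show "wp W (Assign ''p'' (Minus (Plus (Reg ''sz'') (Reg ''r'')) (Const 1)) ;;
      query T ;; post) s2 (\<lambda>t' s''. 3 + (t + t') \<le> 100 * (h + 1) + 130 \<and> Q s'')"
      using p by (simp add: sz2 r s3_def)
  qed (use b1 n S in \<open>auto simp: s1_def\<close>)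
  then show ?thesis using W1 x by (simp add: sweep_query_def s1_def)
qed

text \<open>The expressions for \<open>lo\<close>, \<open>hi\<close> and \<open>v\<close> are
  evaluated between searches that overwrite registers, so \<open>vals\<close> fixes only the arrays
  and the registers \<open>j\<close>, \<open>N\<close> and \<open>k\<close>.\<close>

lemma sweep_insert_spec:
  fixes n x :: int
  assumes b: "bounded W s" and n: "regs s ''N'' = n" "0 \<le> n" "n < 2 ^ h" "2 * 2 ^ h \<le> W"
    and sz: "regs s ''sz'' = 2 ^ h" and S: "mono_on {0..<n} (arrs s S)"
    and j: "regs s ''e'' = n + j" "\<bar>j\<bar> \<le> W"
    and T: "represents (arrs s T) h n (arrs s S) f"
    and vals: "\<And>s'. arrs s' = arrs s \<Longrightarrow> regs s' ''j'' = j \<Longrightarrow> regs s' ''N'' = n \<Longrightarrow> regs s' ''k'' = regs s ''k'' \<Longrightarrow>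
      aval elo s' = lo \<and> aval ehi s' = hi \<and> aval ev s' = v"
    and bd: "\<bar>lo\<bar> \<le> W" "\<bar>hi\<bar> \<le> W" "\<bar>v\<bar> \<le> W"
    and cost: "acost elo \<le> 20" "acost ehi \<le> 20" "acost ev \<le> 20"
    and f': "\<And>y. f' y = (if lo < y \<and> y \<le> hi then max v (f y) else f y)" and ne: "T \<noteq> S"
  shows "wp W (sweep_insert T S elo ehi ev) s (\<lambda>t s''. t \<le> 160 * (h + 1) + 200 \<and>
    represents (arrs s'' T) h n (arrs s'' S) f')"
proof -
  define Q where "Q = (\<lambda>s''::state. represents (arrs s'' T) h n (arrs s'' S) f')"
  define s1 where "s1 = s\<lparr>regs := (regs s)(''j'' := j, ''x'' := lo)\<rparr>"
  have b1: "bounded W s1" using b j bd by (auto simp: bounded_def s1_def)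
  have lo1: "aval elo (s\<lparr>regs := (regs s)(''j'' := j)\<rparr>) = lo" using vals[of "s\<lparr>regs := (regs s)(''j'' := j)\<rparr>"] n by simp
  \<comment> \<open>25 bounds \<open>5 + acost elo\<close>, the cost of the two assignments before
    the search; the same allowance recurs for \<open>ehi\<close> and \<open>ev\<close>.\<close>
  have "wp W (upper S) s1 (\<lambda>t s2. wp W (Assign ''l'' (Plus (Reg ''sz'') (Reg ''r'')) ;;
     Assign ''x'' ehi ;; upper S ;; Assign ''r'' (Plus (Reg ''sz'') (Reg ''r'')) ;;
     Assign ''v'' ev ;; update T) s2 (\<lambda>t' s''. 25 + (t + t') \<le> 160 * (h + 1) + 200 \<and> Q s''))"
  proof (rule upper_spec[where h = h and n = n])
    fix t s2 r1
    assume t: "t \<le> 40 * (h + 1)" and b2: "bounded W s2" and f2: "framed {''mid'', ''lo'', ''r''} {} s1 s2"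
      and r1: "regs s2 ''r'' = r1" "0 \<le> r1" "r1 \<le> n"
      and ub1: "\<And>k. 0 \<le> k \<Longrightarrow> k < n \<Longrightarrow> k < r1 \<longleftrightarrow> arrs s1 S k \<le> regs s1 ''x''"
    have A2: "arrs s2 = arrs s" using f2 by (auto simp: framed_def s1_def)
    have R2: "regs s2 ''sz'' = 2 ^ h" "regs s2 ''N'' = n" "regs s2 ''j'' = j" "regs s2 ''k'' = regs s ''k''"
      using f2 sz n by (simp_all add: framed_def s1_def)
    define s3 where "s3 = s2\<lparr>regs := (regs s2)(''l'' := 2 ^ h + r1, ''x'' := hi)\<rparr>"
    have l: "\<bar>2 ^ h + r1\<bar> \<le> W" using n r1 by auto
    have b3: "bounded W s3" using b2 l bd by (auto simp: bounded_def s3_def)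
    have hi1: "aval ehi (s2\<lparr>regs := (regs s2)(''l'' := 2 ^ h + r1)\<rparr>) = hi"
      using vals[of "s2\<lparr>regs := (regs s2)(''l'' := 2 ^ h + r1)\<rparr>"] R2 A2 by simp
    have "wp W (upper S) s3 (\<lambda>t' s4. wp W (Assign ''r'' (Plus (Reg ''sz'') (Reg ''r'')) ;;
       Assign ''v'' ev ;; update T) s4 (\<lambda>t'' s''. 25 + (t + (25 + (t' + t''))) \<le> 160 * (h + 1) + 200 \<and> Q s''))"
    proof (rule upper_spec[where h = h and n = n])
      fix t' s4 r2
      assume t': "t' \<le> 40 * (h + 1)" and b4: "bounded W s4" and f4: "framed {''mid'', ''lo'', ''r''} {} s3 s4"
        and r2: "regs s4 ''r'' = r2" "0 \<le> r2" "r2 \<le> n"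
        and ub2: "\<And>k. 0 \<le> k \<Longrightarrow> k < n \<Longrightarrow> k < r2 \<longleftrightarrow> arrs s3 S k \<le> regs s3 ''x''"
      have A4: "arrs s4 = arrs s" using f4 A2 by (auto simp: framed_def s3_def)
      have R4: "regs s4 ''sz'' = 2 ^ h" "regs s4 ''N'' = n" "regs s4 ''j'' = j" "regs s4 ''l'' = 2 ^ h + r1"
          "regs s4 ''k'' = regs s ''k''"
        using f4 R2 by (simp_all add: framed_def s3_def)
      define s5 where "s5 = s4\<lparr>regs := (regs s4)(''r'' := 2 ^ h + r2, ''v'' := v)\<rparr>"
      have r: "\<bar>2 ^ h + r2\<bar> \<le> W" using n r2 by auto
      have b5: "bounded W s5" using b4 r bd by (auto simp: bounded_def s5_def)
      have v1: "aval ev (s4\<lparr>regs := (regs s4)(''r'' := 2 ^ h + r2)\<rparr>) = v"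
        using vals[of "s4\<lparr>regs := (regs s4)(''r'' := 2 ^ h + r2)\<rparr>"] R4 A4 by simp
      have "wp W (update T) s5 (\<lambda>t'' s''. 25 + (t + (25 + (t' + (25 + t'')))) \<le> 160 * (h + 1) + 200 \<and> Q s'')"
      proof (rule update_spec[where h = h])
        fix t'' s6
        assume t'': "t'' \<le> 80 * (h + 2)" and f6: "framed {''l'', ''r''} {T} s5 s6"
          and st: "\<And>k. 2 ^ h \<le> k \<Longrightarrow> k < 2 * 2 ^ h \<Longrightarrow> stab (arrs s6 T) k =
            (if regs s5 ''l'' \<le> k \<and> k < regs s5 ''r'' then max (regs s5 ''v'') (stab (arrs s5 T) k)
             else stab (arrs s5 T) k)"
        have A6: "arrs s6 S = arrs s S" using f6 ne A4 by (auto simp: framed_def s5_def)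
        have "stab (arrs s6 T) (2 ^ h + k) = f' (arrs s S k)" if k: "0 \<le> k" "k < n" for k
        proof -
          have "stab (arrs s T) (2 ^ h + k) = f (arrs s S k)" using T k by (simp add: represents_def)
          moreover have "r1 \<le> k \<and> k < r2 \<longleftrightarrow> lo < arrs s S k \<and> arrs s S k \<le> hi"
            using ub1[of k] ub2[of k] k by (auto simp: s1_def s3_def A2)
          ultimately show ?thesis
            using st[of "2 ^ h + k"] k n R4 A4 by (simp add: s5_def f')
        qed
        then have "Q s6" by (simp add: Q_def represents_def A6)
        then show "25 + (t + (25 + (t' + (25 + t'')))) \<le> 160 * (h + 1) + 200 \<and> Q s6"
          using t t' t'' by simp
      qed (use b5 n r1 r2 R4 in \<open>auto simp: s5_def\<close>)
      then have "wp W (update T) s5 (\<lambda>t'' s''. 25 + (t + (25 + (t' + (5 + acost ev + t'')))) \<le> 160 * (h + 1) + 200 \<and> Q s'')"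
        by (rule wp_mono) (use cost in auto)
      then show "wp W (Assign ''r'' (Plus (Reg ''sz'') (Reg ''r'')) ;;
       Assign ''v'' ev ;; update T) s4 (\<lambda>t'' s''. 25 + (t + (25 + (t' + t''))) \<le> 160 * (h + 1) + 200 \<and> Q s'')"
        using r bd v1 by (simp add: R4 r2 s5_def)
    qed (use b3 n S R2 A2 in \<open>auto simp: s3_def\<close>)
    then have "wp W (upper S) s3 (\<lambda>t' s4. wp W (Assign ''r'' (Plus (Reg ''sz'') (Reg ''r'')) ;;
       Assign ''v'' ev ;; update T) s4 (\<lambda>t'' s''. 25 + (t + (5 + acost ehi + (t' + t''))) \<le> 160 * (h + 1) + 200 \<and> Q s''))"
      by (rule wp_mono, elim wp_mono) (use cost in auto)
    then show "wp W (Assign ''l'' (Plus (Reg ''sz'') (Reg ''r'')) ;;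
     Assign ''x'' ehi ;; upper S ;; Assign ''r'' (Plus (Reg ''sz'') (Reg ''r'')) ;;
     Assign ''v'' ev ;; update T) s2 (\<lambda>t' s''. 25 + (t + t') \<le> 160 * (h + 1) + 200 \<and> Q s'')"
      using l bd hi1 by (simp add: R2 r1 s3_def)
  qed (use b1 n S in \<open>auto simp: s1_def\<close>)
  then have "wp W (upper S) s1 (\<lambda>t s2. wp W (Assign ''l'' (Plus (Reg ''sz'') (Reg ''r'')) ;;
     Assign ''x'' ehi ;; upper S ;; Assign ''r'' (Plus (Reg ''sz'') (Reg ''r'')) ;;
     Assign ''v'' ev ;; update T) s2 (\<lambda>t' s''. 5 + acost elo + (t + t') \<le> 160 * (h + 1) + 200 \<and> Q s''))"
    by (rule wp_mono, elim wp_mono) (use cost in auto)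
  then show ?thesis using j bd lo1 n by (simp add: sweep_insert_def s1_def Q_def)
qed

text \<open>\<open>J\<close> is the client's invariant on the arrays after \<open>k\<close> events,
  kept apart from the tree, which the sweep maintains itself (\<open>JT\<close>). An insertion may
  rely on \<open>J\<close> for the meaning of its expressions, so values computed by earlier queries
  can be inserted; the main sweep depends on this.\<close>

lemma sweep_spec:
  fixes n :: int and s :: state and post :: com and lo hi val :: "int \<Rightarrow> int"
  defines "P \<equiv> arrs s ''O''"
  defines "bst \<equiv> \<lambda>k. best (inserted n P k) lo hi val"
  assumes b: "bounded W s" and n: "regs s ''N'' = n" "0 \<le> n" "n < 2 ^ h" "2 * 2 ^ h \<le> W"
    and m: "regs s ''m'' = 2 * n"
    and sz: "regs s ''sz'' = 2 ^ h" and S: "mono_on {0..<n} (arrs s S)"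
    and P: "bij_betw P {0..<2 * n} {0..<2 * n}"
    and X: "\<And>i. i \<in> {0..<n} \<Longrightarrow> arrs s X i \<in> arrs s S ` {0..<n}"
    and T: "arrs s T = (\<lambda>_. 0)" "T \<noteq> S" "T \<noteq> X" "T \<noteq> ''O''"
    and post_frame: "{T, S, X, ''O''} \<inter> warrs post = {}" "{''N'', ''sz'', ''k'', ''m''} \<inter> wregs post = {}"
    and J0: "J 0 (arrs s)"
    and JT: "\<And>k A z. J k A \<Longrightarrow> J k (A(T := z))"
    and vals: "\<And>k s' j. J k (arrs s') \<Longrightarrow> 0 \<le> k \<Longrightarrow> k < 2 * n \<Longrightarrow> P k = n + j \<Longrightarrow> j \<in> {0..<n} \<Longrightarrow>
      regs s' ''j'' = j \<Longrightarrow> regs s' ''N'' = n \<Longrightarrow> regs s' ''k'' = k \<Longrightarrow> arrs s' S = arrs s S \<Longrightarrow>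
      aval elo s' = lo j \<and> aval ehi s' = hi j \<and> aval ev s' = val j"
    and bd: "\<And>j. j \<in> {0..<n} \<Longrightarrow> \<bar>lo j\<bar> \<le> W \<and> \<bar>hi j\<bar> \<le> W \<and> \<bar>val j\<bar> \<le> W"
    and cost: "acost elo \<le> 20" "acost ehi \<le> 20" "acost ev \<le> 20"
    and insert: "\<And>k A j. J k A \<Longrightarrow> 0 \<le> k \<Longrightarrow> k < 2 * n \<Longrightarrow> P k = n + j \<Longrightarrow> j \<in> {0..<n} \<Longrightarrow> J (k + 1) A"
    and query: "\<And>k s' i. J k (arrs s') \<Longrightarrow> 0 \<le> k \<Longrightarrow> k < 2 * n \<Longrightarrow> P k = i \<Longrightarrow> i \<in> {0..<n} \<Longrightarrow>
      bounded W s' \<Longrightarrow> arrs s' ''O'' = P \<Longrightarrow> regs s' ''e'' = i \<Longrightarrow> regs s' ''N'' = n \<Longrightarrow>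
      regs s' ''q'' = bst k (arrs s X i) \<Longrightarrow> wp W post s' (\<lambda>t s''. t \<le> 100 \<and> J (k + 1) (arrs s''))"
    and exit: "\<And>t s'. t \<le> 1000 * ((nat (2 * n) + 1) * (h + 1)) \<Longrightarrow> bounded W s' \<Longrightarrow>
      framed (sweep_regs \<union> wregs post) (insert T (warrs post)) s s' \<Longrightarrow> J (2 * n) (arrs s') \<Longrightarrow> Q t s'"
  shows "wp W (sweep T S X elo ehi ev post) s Q"
proof -
  define s1 where "s1 = s\<lparr>regs := (regs s)(''k'' := 0)\<rparr>"
  have W0: "2 \<le> W" using n(4) one_le_power[of "2::int" h] by linarith
  have b1: "bounded W s1" using b W0 by (auto simp: bounded_def s1_def)
  have "wp W (While (Less (Reg ''k'') (Reg ''m'')) (sweep_step T S X elo ehi ev post)) s1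
     (\<lambda>t. Q (Suc (Suc t)))"
  proof (rule wp_for[where m = "2 * n" and T = "500 * (h + 1)" and
      J = "\<lambda>k s'. J k (arrs s') \<and> represents (arrs s' T) h n (arrs s S) (bst k)"])
    show "J 0 (arrs s1) \<and> represents (arrs s1 T) h n (arrs s S) (bst 0)"
      using J0 by (simp add: s1_def T represents_def stab_zero bst_def best_def inserted_def)
  next
    fix k s'
    assume k: "0 \<le> k" "k < 2 * n" "regs s' ''k'' = k"
      and J: "J k (arrs s') \<and> represents (arrs s' T) h n (arrs s S) (bst k)" and b': "bounded W s'"
      and f: "framed (wregs (sweep_step T S X elo ehi ev post)) (warrs (sweep_step T S X elo ehi ev post)) s1 s'"
    have fA: "arrs s' S = arrs s S" "arrs s' X = arrs s X" "arrs s' ''O'' = P"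
      using framed_arrs[OF f] T post_frame by (auto simp: s1_def P_def)
    have fR: "regs s' ''N'' = n" "regs s' ''sz'' = 2 ^ h" "regs s' ''m'' = 2 * n"
      using framed_regs[OF f] n sz m post_frame by (auto simp: s1_def)
    define e where "e = P k"
    have e: "0 \<le> e" "e < 2 * n" using P k by (auto simp: bij_betw_def e_def)
    have eW: "\<bar>e\<bar> \<le> W" "\<bar>k + 1\<bar> \<le> W" using e k n by auto
    define s2 where "s2 = s'\<lparr>regs := (regs s')(''e'' := e)\<rparr>"
    have b2: "bounded W s2" using b' eW by (auto simp: bounded_def s2_def)
    define com where "com = (if e < n then sweep_query T S X post else sweep_insert T S elo ehi ev)"
    have "wp W com s2 (\<lambda>t s3. t \<le> 460 * (h + 1) \<and> J (k + 1) (arrs s3) \<and>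
        represents (arrs s3 T) h n (arrs s S) (bst (k + 1)))"
    proof (cases "e < n")
      case True
      have bst: "bst (k + 1) = bst k" using inserted_query[of k P n] k True by (simp add: bst_def e_def)
      have "wp W (sweep_query T S X post) s2 (\<lambda>t s3. t \<le> 100 * (h + 1) + 130 \<and> J (k + 1) (arrs s3))"
      proof (rule sweep_query_spec[where n = n and f = "bst k" and x = "arrs s X e"])
        fix s3
        assume "bounded W s3" "arrs s3 = arrs s2" "regs s3 ''N'' = n" "regs s3 ''q'' = bst k (arrs s X e)"
          "regs s3 ''e'' = regs s2 ''e''" "regs s3 ''k'' = regs s2 ''k''"
        then show "wp W post s3 (\<lambda>t s''. t \<le> 100 \<and> J (k + 1) (arrs s''))"
          using J k e True fA by (intro query[where i = e]) (auto simp: s2_def e_def)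
      qed (use b2 n S J X[of e] e True fA fR in \<open>auto simp: s2_def\<close>)
      then show ?thesis
        unfolding com_def if_P[OF True]
      proof (rule wp_conseq)
        fix t s3
        assume 1: "t \<le> 100 * (h + 1) + 130 \<and> J (k + 1) (arrs s3)"
          and f3: "framed (wregs (sweep_query T S X post)) (warrs (sweep_query T S X post)) s2 s3"
        have "arrs s3 T = arrs s' T" using framed_arrs[OF f3, of T] post_frame by (auto simp: s2_def)
        then show "t \<le> 460 * (h + 1) \<and> J (k + 1) (arrs s3) \<and>
            represents (arrs s3 T) h n (arrs s S) (bst (k + 1))"
          using 1 J by (simp add: bst)
      qed
    next
      case False
      define j where "j = e - n"
      have j: "j \<in> {0..<n}" "P k = n + j" "\<bar>j\<bar> \<le> W" using False e n by (auto simp: j_def e_def)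
      have "wp W (sweep_insert T S elo ehi ev) s2 (\<lambda>t s3. t \<le> 160 * (h + 1) + 200 \<and>
          represents (arrs s3 T) h n (arrs s3 S) (bst (k + 1)))"
      proof (rule sweep_insert_spec[where n = n and j = j and lo = "lo j" and hi = "hi j" and v = "val j"
            and f = "bst k"])
        show "bst (k + 1) y = (if lo j < y \<and> y \<le> hi j then max (val j) (bst k y) else bst k y)" for y
          using inserted_insert[of k P n j] k j best_insert[of "inserted n P k" j lo hi val y]
          by (simp add: bst_def)
        show "aval elo s3 = lo j \<and> aval ehi s3 = hi j \<and> aval ev s3 = val j"
          if "arrs s3 = arrs s2" "regs s3 ''j'' = j" "regs s3 ''N'' = n" "regs s3 ''k'' = regs s2 ''k''" for s3
          by (rule vals) (use that J k j fA in \<open>auto simp: s2_def\<close>)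
      qed (use b2 n S J T fA fR j bd[OF j(1)] cost in \<open>auto simp: s2_def j_def\<close>)
      then show ?thesis
        unfolding com_def if_not_P[OF False]
      proof (rule wp_conseq)
        fix t s3
        assume 1: "t \<le> 160 * (h + 1) + 200 \<and> represents (arrs s3 T) h n (arrs s3 S) (bst (k + 1))"
          and f3: "framed (wregs (sweep_insert T S elo ehi ev)) (warrs (sweep_insert T S elo ehi ev)) s2 s3"
        have A3: "arrs s3 = (arrs s')(T := arrs s3 T)"
          using framed_arrs[OF f3] by (auto simp: fun_eq_iff s2_def)
        have "J (k + 1) (arrs s')" by (rule insert) (use J k j in auto)
        then have "J (k + 1) (arrs s3)" using JT A3 by metis
        moreover have "arrs s3 S = arrs s S" using framed_arrs[OF f3, of S] T fA by (auto simp: s2_def)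
        ultimately show "t \<le> 460 * (h + 1) \<and> J (k + 1) (arrs s3) \<and>
            represents (arrs s3 T) h n (arrs s S) (bst (k + 1))"
          using 1 by simp
      qed
    qed
    then have "wp W com s2 (\<lambda>t s3. \<bar>regs s3 ''k'' + 1\<bar> \<le> W \<and> t + 20 \<le> 500 * (h + 1) \<and> regs s3 ''k'' = k \<and>
        J (k + 1) (arrs s3) \<and> represents (arrs s3 T) h n (arrs s S) (bst (k + 1)))"
    proof (rule wp_conseq)
      fix t s3
      assume 1: "t \<le> 460 * (h + 1) \<and> J (k + 1) (arrs s3) \<and>
          represents (arrs s3 T) h n (arrs s S) (bst (k + 1))" and f3: "framed (wregs com) (warrs com) s2 s3"
      have "regs s3 ''k'' = k"
        using framed_regs[OF f3, of "''k''"] post_frame k by (auto simp: com_def s2_def split: if_splits)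
      then show "\<bar>regs s3 ''k'' + 1\<bar> \<le> W \<and> t + 20 \<le> 500 * (h + 1) \<and> regs s3 ''k'' = k \<and>
        J (k + 1) (arrs s3) \<and> represents (arrs s3 T) h n (arrs s S) (bst (k + 1))"
        using 1 eW by simp
    qed
    then have "wp W com s2 (\<lambda>t s3. \<bar>regs s3 ''k'' + 1\<bar> \<le> W \<and> 3 + (4 + t + 4) \<le> 500 * (h + 1) \<and>
       regs s3 ''k'' + 1 = k + 1 \<and>
        J (k + 1) (arrs s3) \<and> represents (arrs s3 T) h n (arrs s S) (bst (k + 1)))"
      by (rule wp_mono) auto
    then show "wp W (sweep_step T S X elo ehi ev post) s' (\<lambda>t s''. t \<le> 500 * (h + 1) \<and> regs s'' ''k'' = k + 1 \<and>
        J (k + 1) (arrs s'') \<and> represents (arrs s'' T) h n (arrs s S) (bst (k + 1)))"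
      using eW k(3) fA(3) fR(1)
      by (simp add: sweep_step_def com_def e_def[symmetric] s2_def split: if_splits)
  next
    fix t s'
    assume J: "J (2 * n) (arrs s') \<and> represents (arrs s' T) h n (arrs s S) (bst (2 * n))" and b': "bounded W s'"
      and f: "framed (wregs (sweep_step T S X elo ehi ev post)) (warrs (sweep_step T S X elo ehi ev post)) s1 s'"
      and t: "t \<le> (nat (2 * n) + 1) * (4 + 500 * (h + 1))"
    show "Q (Suc (Suc t)) s'"
    proof (rule exit)
      show "Suc (Suc t) \<le> 1000 * ((nat (2 * n) + 1) * (h + 1))" using t by (simp add: algebra_simps)
      show "framed (sweep_regs \<union> wregs post) (insert T (warrs post)) s s'"
        using f by (auto simp: framed_def s1_def)
    qed (use J b' in auto)
  qed (use b1 n m post_frame in \<open>auto simp: s1_def\<close>)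
  then show ?thesis using W0 by (simp add: sweep_def s1_def)
qed

section \<open>Nearest diagonals\<close>

definition key_step :: "string \<Rightarrow> aexp \<Rightarrow> aexp \<Rightarrow> com" where
  "key_step K eq ei =
    (Store K (Reg ''k'') eq ;; Store K (Plus (Reg ''N'') (Reg ''k'')) ei ;;
     Assign ''k'' (Plus (Reg ''k'') (Const 1)))"

definition init_keys :: "string \<Rightarrow> aexp \<Rightarrow> aexp \<Rightarrow> com" where
  "init_keys K eq ei =
    (Assign ''k'' (Const 0) ;; While (Less (Reg ''k'') (Reg ''N'')) (key_step K eq ei))"

lemma init_keys_frames [simp]:
  "wregs (key_step K eq ei) = {''k''}" "warrs (key_step K eq ei) = {K}"
  "wregs (init_keys K eq ei) = {''k''}" "warrs (init_keys K eq ei) = {K}"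
  by (auto simp: key_step_def init_keys_def)

text \<open>The key expressions may read every array but \<open>K\<close>, which is changing while
  they are evaluated. Queries get the indices below \<open>n\<close> and insertions those from
  \<open>n\<close> on.\<close>

lemma init_keys_spec:
  assumes b: "bounded W s" and n: "regs s ''N'' = n" "0 \<le> n" "n \<le> W" "0 \<le> W"
    and vals: "\<And>s' i. (\<And>X. X \<noteq> K \<Longrightarrow> arrs s' X = arrs s X) \<Longrightarrow> i \<in> {0..<n} \<Longrightarrow> regs s' ''k'' = i \<Longrightarrow>
      aval eq s' = f i \<and> aval ei s' = g i"
    and bd: "\<And>i. i \<in> {0..<n} \<Longrightarrow> \<bar>f i\<bar> \<le> W \<and> \<bar>g i\<bar> \<le> W"
    and cost: "acost eq \<le> 20" "acost ei \<le> 20"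
    and exit: "\<And>t s'. t \<le> 70 * (nat n + 1) \<Longrightarrow> bounded W s' \<Longrightarrow> framed {''k''} {K} s s' \<Longrightarrow>
      (\<And>i. i \<in> {0..<n} \<Longrightarrow> arrs s' K i = f i) \<Longrightarrow> (\<And>i. i \<in> {0..<n} \<Longrightarrow> arrs s' K (n + i) = g i) \<Longrightarrow> Q t s'"
  shows "wp W (init_keys K eq ei) s Q"
proof -
  define s1 where "s1 = s\<lparr>regs := (regs s)(''k'' := 0)\<rparr>"
  have b1: "bounded W s1" using b n by (auto simp: bounded_def s1_def)
  have "wp W (While (Less (Reg ''k'') (Reg ''N'')) (key_step K eq ei)) s1 (\<lambda>t. Q (Suc (Suc t)))"
  proof (rule wp_for[where m = n and T = 60 and
      J = "\<lambda>k s'. \<forall>i\<in>{0..<k}. arrs s' K i = f i \<and> arrs s' K (n + i) = g i"])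
    fix k s'
    assume k: "0 \<le> k" "k < n" "regs s' ''k'' = k"
      and J: "\<forall>i\<in>{0..<k}. arrs s' K i = f i \<and> arrs s' K (n + i) = g i" and b': "bounded W s'"
      and fr: "framed (wregs (key_step K eq ei)) (warrs (key_step K eq ei)) s1 s'"
    have N: "regs s' ''N'' = n" using framed_regs[OF fr] n by (simp add: s1_def)
    have A: "arrs s' X = arrs s X" if "X \<noteq> K" for X
      using framed_arrs[OF fr, of X] that by (simp add: s1_def)
    have e1: "aval eq s' = f k" using vals[OF A, of k] k by simp
    define s2 where "s2 = s'\<lparr>arrs := (arrs s')(K := (arrs s' K)(k := f k))\<rparr>"
    have e2: "aval ei s2 = g k" using vals[of s2 k] A k by (simp add: s2_def)
    have bds: "\<bar>f k\<bar> \<le> W" "\<bar>g k\<bar> \<le> W" "\<bar>k + 1\<bar> \<le> W" using bd[of k] k n by auto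
    have c: "i < k + 1 \<longleftrightarrow> i < k \<or> i = k" for i :: int by auto
    show "wp W (key_step K eq ei) s' (\<lambda>t s''. t \<le> 60 \<and> regs s'' ''k'' = k + 1 \<and>
        (\<forall>i\<in>{0..<k + 1}. arrs s'' K i = f i \<and> arrs s'' K (n + i) = g i))"
      using e1 e2 bds k J N cost by (auto simp: key_step_def s2_def c)
  next
    fix t s'
    assume J: "\<forall>i\<in>{0..<n}. arrs s' K i = f i \<and> arrs s' K (n + i) = g i" and b': "bounded W s'"
      and fr: "framed (wregs (key_step K eq ei)) (warrs (key_step K eq ei)) s1 s'"
      and t: "t \<le> (nat n + 1) * (4 + 60)"
    show "Q (Suc (Suc t)) s'"
    proof (rule exit)
      show "framed {''k''} {K} s s'" using fr by (auto simp: framed_def s1_def)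
    qed (use t b' J in auto)
  qed (use b1 n in \<open>auto simp: s1_def\<close>)
  then show ?thesis using n by (simp add: init_keys_def s1_def)
qed

text \<open>Doubling the number of events at most doubles the factor \<open>nat n + 1\<close>,
  giving \<open>70 + 2 * 500 + 2 * 1000 = 3070\<close>, below 4000.\<close>

lemma phase_time:
  fixes n :: int
  assumes "t1 \<le> 70 * (nat n + 1)" "t2 \<le> 500 * ((nat (2 * n) + 1) * (h + 1))"
    "t3 \<le> 1000 * ((nat (2 * n) + 1) * (h + 1))"
  shows "t1 + (t2 + t3) \<le> 4000 * ((nat n + 1) * (h + 1))"
proof -
  have "nat (2 * n) + 1 \<le> 2 * (nat n + 1)" by simp
  then have "(nat (2 * n) + 1) * (h + 1) \<le> 2 * (nat n + 1) * (h + 1)" by (rule mult_right_mono) simp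
  then have "(nat (2 * n) + 1) * (h + 1) \<le> 2 * ((nat n + 1) * (h + 1))" by (simp only: mult.assoc)
  moreover have "nat n + 1 \<le> (nat n + 1) * (h + 1)" by simp
  moreover have "t1 + (t2 + t3) \<le> 4000 * G"
    if "t1 \<le> 70 * A" "t2 \<le> 500 * M" "t3 \<le> 1000 * M" "M \<le> 2 * G" "A \<le> G" for A M G
    using that by linarith
  ultimately show ?thesis using assms by blast
qed

section \<open>Positions in the order of events\<close>

lemma sorts_position:
  assumes "sorts K m P S" "i \<in> {0..<m}"
  obtains k where "k \<in> {0..<m}" "P k = i"
  using assms unfolding sorts_def bij_betw_def by (metis imageE)

lemma sorts_mono:
  assumes "sorts K m P S" "k \<in> {0..<m}" "k' \<in> {0..<m}" "k \<le> k'"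
  shows "K (P k) \<le> K (P k')"
  using assms unfolding sorts_def mono_on_def by metis

lemma sorts_less:
  assumes "sorts K m P S" "k \<in> {0..<m}" "k' \<in> {0..<m}" "K (P k) < K (P k')"
  shows "k < k'"
  using sorts_mono[OF assms(1,3,2)] assms(4) by linarith

text \<open>As no insertion shares the key of event \<open>P k\<close>, being earlier in the order
  is the same as having a smaller key, however the sort breaks ties among equal keys.\<close>

lemma inserted_sorts:
  assumes K: "sorts K (2 * n) P S" and k: "k \<in> {0..<2 * n}"
    and ne: "\<And>j. j \<in> {0..<n} \<Longrightarrow> K (n + j) \<noteq> K (P k)"
  shows "inserted n P k = {j \<in> {0..<n}. K (n + j) < K (P k)}"
proof -
  have "(\<exists>i\<in>{0..<k}. P i = n + j) \<longleftrightarrow> K (n + j) < K (P k)" if j: "j \<in> {0..<n}" for j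
  proof
    assume "\<exists>i\<in>{0..<k}. P i = n + j"
    then obtain i where i: "i \<in> {0..<k}" "P i = n + j" by auto
    then have "K (P i) \<le> K (P k)" using k by (intro sorts_mono[OF K]) auto
    then show "K (n + j) < K (P k)" using ne[OF j] i by auto
  next
    assume less: "K (n + j) < K (P k)"
    obtain i where i: "i \<in> {0..<2 * n}" "P i = n + j"
      using sorts_position[OF K, of "n + j"] j by auto
    then have "i < k" using sorts_less[OF K i(1) k] less by auto
    then show "\<exists>i\<in>{0..<k}. P i = n + j" using i by auto
  qed
  then show ?thesis by (auto simp: inserted_def)
qed

text \<open>The query returns the rank of an insertion, which is its position in the order of events
  plus one. Looking up that position in \<open>O\<close> yields the event \<open>n + j\<close>, from
  which the pointer \<open>j + 1\<close> is formed.\<close>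

definition store_pointer :: "string \<Rightarrow> com" where
  "store_pointer R =
    Cond (Eq (Reg ''q'') (Const 0)) (Store R (Reg ''e'') (Const 0))
      (Store R (Reg ''e'')
        (Plus (Minus (Load ''O'' (Minus (Reg ''q'') (Const 1))) (Reg ''N'')) (Const 1)))"

text \<open>
  The interval \<open>(X j, Y j]\<close> is inserted with its rank in the order of diagonals \<open>Z j - X j\<close>, so that
  a query finds the largest diagonal. Doubled keys let insertions precede queries on equal diagonals.
\<close>

definition pointers :: "string \<Rightarrow> string \<Rightarrow> string \<Rightarrow> string \<Rightarrow> string \<Rightarrow> string \<Rightarrow> com" where
  "pointers X Y Z S T R =
    (init_keys ''K''
      (Plus (dbl (Minus (Load Z (Reg ''k'')) (Load X (Reg ''k'')))) (Const 1))
      (dbl (Minus (Load Z (Reg ''k'')) (Load X (Reg ''k'')))) ;;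
     heap_sort ''K'' ''S'' ;;
     sweep T S X (Load X (Reg ''j'')) (Load Y (Reg ''j'')) (Plus (Reg ''k'') (Const 1)) (store_pointer R))"

lemma store_pointer_frames [simp]: "wregs (store_pointer R) = {}" "warrs (store_pointer R) = {R}"
  by (auto simp: store_pointer_def)

lemma pointers_frames [simp]:
  "wregs (pointers X Y Z S T R) = sweep_regs \<union> {''y''}"
  "warrs (pointers X Y Z S T R) = {''K'', ''H'', ''O'', ''S'', T, R}"
  by (auto simp: pointers_def)

text \<open>Because ranks are positive, the answer 0 occurs only for an empty set, and any other
  answer is the rank of a member.\<close>

lemma best_rank:
  assumes X: "finite X" "P0 = {j \<in> X. lo j < y \<and> y \<le> hi j}"
    and r: "\<And>j. j \<in> P0 \<Longrightarrow> 0 < rank j"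
  shows "best X lo hi rank y = 0 \<and> P0 = {} \<or>
    (\<exists>j\<in>P0. best X lo hi rank y = rank j \<and> (\<forall>i\<in>P0. rank i \<le> rank j))"
proof (cases "P0 = {}")
  case True
  have "best X lo hi rank y = 0" unfolding best_def X(2)[symmetric] True by simp
  then show ?thesis using True by simp
next
  case False
  have fin: "finite (rank ` P0)" using X by simp
  have "Max (rank ` P0) \<in> rank ` P0" using fin False by simp
  then obtain j where j: "j \<in> P0" "Max (rank ` P0) = rank j" by auto
  have "best X lo hi rank y = max 0 (Max (rank ` P0))"
    unfolding best_def X(2)[symmetric] using fin False by simp
  moreover have "\<forall>i\<in>P0. rank i \<le> rank j" using j fin by (metis Max_ge imageI)
  ultimately show ?thesis using j r[OF j(1)] by (auto simp: max_def)
qed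

text \<open>The coordinates are parameters so that \<open>(a, b, c)\<close> yields
  \<open>above\<close> and \<open>(c, d, a)\<close> yields \<open>beside\<close>. Ranks refine the
  order of diagonals, so the member of largest rank has the largest diagonal; among equal diagonals
  any choice satisfies \<open>nearest\<close>.\<close>

lemma pointers_spec:
  fixes n :: int and s :: state and X Y Z :: string
  defines "x \<equiv> arrs s X" and "y \<equiv> arrs s Y" and "z \<equiv> arrs s Z"
  assumes b: "bounded W s" and n: "regs s ''N'' = n" "0 \<le> n" "2 * n < 2 ^ h" "2 * 2 ^ h \<le> W"
    and m: "regs s ''m'' = 2 * n" and sz: "regs s ''sz'' = 2 ^ h"
    and H: "heap K0 (arrs s ''H'') h {}"
    and S: "mono_on {0..<n} (arrs s S)" "\<And>i. i \<in> {0..<n} \<Longrightarrow> x i \<in> arrs s S ` {0..<n}"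
    and T: "arrs s T = (\<lambda>_. 0)"
    and bd: "\<And>i. i \<in> {0..<n} \<Longrightarrow> \<bar>2 * (z i - x i)\<bar> + 1 \<le> W"
    and dist: "distinct [X, Y, Z, S, T, R, ''K'', ''H'', ''O'', ''S'']"
    and exit: "\<And>t s'. t \<le> 4000 * ((nat n + 1) * (h + 1)) \<Longrightarrow> bounded W s' \<Longrightarrow>
      framed (sweep_regs \<union> {''y''}) {''K'', ''H'', ''O'', ''S'', T, R} s s' \<Longrightarrow>
      heap K0 (arrs s' ''H'') h {} \<Longrightarrow>
      (\<And>i. i \<in> {0..<n} \<Longrightarrow> nearest {j \<in> {0..<n}. x j < x i \<and> x i \<le> y j \<and> z j - x j \<le> z i - x i}
         (\<lambda>j. z j - x j) (arrs s' R i)) \<Longrightarrow> Q t s'"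
  shows "wp W (pointers X Y Z S T R) s Q"
  unfolding pointers_def wp_Seq
proof (rule init_keys_spec[where n = n and f = "\<lambda>i. 2 * (z i - x i) + 1" and g = "\<lambda>i. 2 * (z i - x i)"])
  fix t1 s1
  assume t1: "t1 \<le> 70 * (nat n + 1)" and b1: "bounded W s1" and f1: "framed {''k''} {''K''} s s1"
    and K: "\<And>i. i \<in> {0..<n} \<Longrightarrow> arrs s1 ''K'' i = 2 * (z i - x i) + 1"
      "\<And>i. i \<in> {0..<n} \<Longrightarrow> arrs s1 ''K'' (n + i) = 2 * (z i - x i)"
  define Ks where "Ks = arrs s1 ''K''"
  show "wp W (heap_sort ''K'' ''S'') s1 (\<lambda>t s'. wp W (sweep T S X (Load X (Reg ''j'')) (Load Y (Reg ''j''))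
     (Plus (Reg ''k'') (Const 1)) (store_pointer R)) s' (\<lambda>t' s''. Q (t1 + (t + t')) s''))"
  proof (rule heap_sort_spec[where h = h and m = "2 * n" and ?K0.0 = K0])
    fix t2 s2
    assume t2: "t2 \<le> 500 * ((nat (2 * n) + 1) * (h + 1))" and b2: "bounded W s2"
      and f2: "framed {''p'', ''x'', ''y'', ''k''} {''H'', ''O'', ''S''} s1 s2"
      and H2: "heap K0 (arrs s2 ''H'') h {}"
      and so: "sorts (arrs s1 ''K'') (2 * n) (arrs s2 ''O'') (arrs s2 ''S'')"
    define P where "P = arrs s2 ''O''"
    have so: "sorts Ks (2 * n) P (arrs s2 ''S'')" using so by (simp add: Ks_def P_def)
    have bij: "bij_betw P {0..<2 * n} {0..<2 * n}" using so by (simp add: sorts_def)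
    have A2: "arrs s2 V = arrs s V" if "V \<notin> {''K'', ''H'', ''O'', ''S''}" for V
      using that f1 f2 by (auto simp: framed_def)
    have A2': "arrs s2 X = x" "arrs s2 Y = y" "arrs s2 S = arrs s S" "arrs s2 T = (\<lambda>_. 0)"
      using A2 dist T by (auto simp: x_def y_def)
    have R2: "regs s2 ''N'' = n" "regs s2 ''m'' = 2 * n" "regs s2 ''sz'' = 2 ^ h"
      using f1 f2 n m sz by (auto simp: framed_def)
    \<comment> \<open>The position of the insertion event plus one, which is the value of
      \<open>k + 1\<close> when that event is processed; the shift keeps 0 free for the empty
      answer.\<close>
    define rank where "rank j = inv_into {0..<2 * n} P (n + j) + 1" for j
    have rank: "rank j = k + 1" if "k \<in> {0..<2 * n}" "P k = n + j" for k j
      using bij that by (simp add: rank_def bij_betw_def inv_into_f_f flip: that(2))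
    have rank': "rank j - 1 \<in> {0..<2 * n}" "P (rank j - 1) = n + j" if "j \<in> {0..<n}" for j
    proof -
      have "n + j \<in> P ` {0..<2 * n}" using bij that by (auto simp: bij_betw_def)
      then show "rank j - 1 \<in> {0..<2 * n}" "P (rank j - 1) = n + j"
        by (simp_all only: rank_def add_diff_cancel_right' inv_into_into f_inv_into_f)
    qed
    define U where "U i = {j \<in> {0..<n}. x j < x i \<and> x i \<le> y j \<and> z j - x j \<le> z i - x i}" for i
    define J where "J k A \<longleftrightarrow> A X = x \<and> A Y = y \<and>
      (\<forall>i\<in>{0..<n}. (\<exists>k'\<in>{0..<k}. P k' = i) \<longrightarrow> nearest (U i) (\<lambda>j. z j - x j) (A R i))"
      for k :: int and A :: "string \<Rightarrow> int \<Rightarrow> int"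
    have Jstep: "J (k + 1) A" if "J k A" "0 \<le> k" "\<And>i. i \<in> {0..<n} \<Longrightarrow> P k = i \<Longrightarrow> nearest (U i) (\<lambda>j. z j - x j) (A R i)" for k A
    proof -
      have "{0..<k + 1} = insert k {0..<k}" using that by auto
      then show ?thesis using that by (auto simp: J_def)
    qed
    show "wp W (sweep T S X (Load X (Reg ''j'')) (Load Y (Reg ''j''))
     (Plus (Reg ''k'') (Const 1)) (store_pointer R)) s2 (\<lambda>t' s''. Q (t1 + (t2 + t')) s'')"
    proof (rule sweep_spec[where s = s2 and n = n and h = h and lo = x and hi = y and val = rank and J = J,
          folded P_def])
      show "J 0 (arrs s2)" by (simp add: J_def A2')
      show "J k A \<Longrightarrow> J k (A(T := w))" for k A w using dist by (auto simp: J_def)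
      show "J (k + 1) A" if "J k A" "0 \<le> k" "P k = n + j" "j \<in> {0..<n}" for k A j
        by (rule Jstep) (use that in auto)
      show "aval (Load X (Reg ''j'')) s' = x j \<and> aval (Load Y (Reg ''j'')) s' = y j \<and>
          aval (Plus (Reg ''k'') (Const 1)) s' = rank j"
        if "J k (arrs s')" "0 \<le> k" "k < 2 * n" "P k = n + j" "j \<in> {0..<n}"
          "regs s' ''j'' = j" "regs s' ''k'' = k" for k s' j
        using that rank[of k j] by (simp add: J_def)
      show "\<bar>x j\<bar> \<le> W \<and> \<bar>y j\<bar> \<le> W \<and> \<bar>rank j\<bar> \<le> W" if "j \<in> {0..<n}" for j
        using rank'(1)[OF that] n boundedD(2)[OF b] by (auto simp: x_def y_def)
      show "arrs s2 X i \<in> arrs s2 S ` {0..<n}" if "i \<in> {0..<n}" for i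
        using S that A2' by simp
      show "wp W (store_pointer R) s' (\<lambda>t s''. t \<le> 100 \<and> J (k + 1) (arrs s''))"
        if J: "J k (arrs s')" and k: "0 \<le> k" "k < 2 * n" "P k = i" and i: "i \<in> {0..<n}" and b': "bounded W s'"
          and s': "arrs s' ''O'' = P" "regs s' ''e'' = i" "regs s' ''N'' = n"
          and q: "regs s' ''q'' = best (inserted n P k) x y rank (arrs s2 X i)" for k s' i
      proof -
        have ins: "inserted n P k = {j \<in> {0..<n}. z j - x j \<le> z i - x i}"
        proof -
          have "inserted n P k = {j \<in> {0..<n}. Ks (n + j) < Ks (P k)}"
          proof (rule inserted_sorts[OF so])
            \<comment> \<open>Query keys are odd and insertion keys even.\<close>
            show "Ks (n + j) \<noteq> Ks (P k)" if "j \<in> {0..<n}" for j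
              using K(1)[OF i] K(2)[OF that] k unfolding Ks_def by presburger
          qed (use k in auto)
          also have "\<dots> = {j \<in> {0..<n}. z j - x j \<le> z i - x i}"
            using K(1)[OF i] K(2) k by (auto simp: Ks_def)
          finally show ?thesis .
        qed
        have U: "U i = {j \<in> inserted n P k. x j < x i \<and> x i \<le> y j}" by (auto simp: U_def ins)
        have pos: "0 < rank j" if "j \<in> U i" for j using rank'(1)[of j] that by (auto simp: U_def)
        define p where "p = (if regs s' ''q'' = 0 then 0 else P (regs s' ''q'' - 1) - n + 1)"
        have "best (inserted n P k) x y rank (x i) = 0 \<and> U i = {} \<or>
          (\<exists>j\<in>U i. best (inserted n P k) x y rank (x i) = rank j \<and> (\<forall>i'\<in>U i. rank i' \<le> rank j))"
          by (rule best_rank[OF finite_inserted U]) (rule pos)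
        then have p: "nearest (U i) (\<lambda>j. z j - x j) p"
        proof (elim disjE bexE conjE)
          assume "best (inserted n P k) x y rank (x i) = 0" "U i = {}"
          then show ?thesis using q by (simp add: p_def nearest_def A2')
        next
          fix j assume j: "j \<in> U i" "best (inserted n P k) x y rank (x i) = rank j"
            "\<forall>i'\<in>U i. rank i' \<le> rank j"
          have jn: "j \<in> {0..<n}" using j by (simp add: U_def)
          have pj: "p = j + 1" using q j rank'(2)[OF jn] pos[OF j(1)] by (simp add: p_def A2')
          have "z i' - x i' \<le> z j - x j" if i': "i' \<in> U i" for i'
          proof -
            have "i' \<in> {0..<n}" using i' by (simp add: U_def)
            note r = rank'[OF this] and r' = rank'[OF jn]
            have "Ks (P (rank i' - 1)) \<le> Ks (P (rank j - 1))"
              using j(3) i' r(1) r'(1) by (intro sorts_mono[OF so]) auto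
            then show ?thesis using r(2) r'(2) K(2) \<open>i' \<in> {0..<n}\<close> jn by (simp add: Ks_def)
          qed
          then show ?thesis using j(1) by (auto simp: nearest_def pj)
        qed
        have pW: "\<bar>p\<bar> \<le> W"
        proof -
          have "p = 0 \<or> p - 1 \<in> {0..<n}" using p by (auto simp: nearest_def U_def split: if_splits)
          then show ?thesis using n by auto
        qed
        have "J (k + 1) ((arrs s')(R := (arrs s' R)(i := p)))"
        proof (rule Jstep)
          show "J k ((arrs s')(R := (arrs s' R)(i := p)))" using J dist p by (auto simp: J_def)
        qed (use k p in auto)
        then show ?thesis using pW s' by (auto simp: store_pointer_def p_def)
      qed
      show "Q (t1 + (t2 + t')) s'" if "t' \<le> 1000 * ((nat (2 * n) + 1) * (h + 1))" "bounded W s'"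
        and f: "framed (sweep_regs \<union> wregs (store_pointer R)) (insert T (warrs (store_pointer R))) s2 s'"
        and J: "J (2 * n) (arrs s')" for t' s'
      proof (rule exit)
        show "t1 + (t2 + t') \<le> 4000 * ((nat n + 1) * (h + 1))"
          by (rule phase_time[OF t1 t2 that(1)])
        show "framed (sweep_regs \<union> {''y''}) {''K'', ''H'', ''O'', ''S'', T, R} s s'"
          using f f1 f2 by (auto simp: framed_def)
        show "heap K0 (arrs s' ''H'') h {}" using H2 framed_arrs[OF f, of "''H''"] dist by auto
        show "nearest {j \<in> {0..<n}. x j < x i \<and> x i \<le> y j \<and> z j - x j \<le> z i - x i}
         (\<lambda>j. z j - x j) (arrs s' R i)" if i: "i \<in> {0..<n}" for i
        proof -
          obtain k where "k \<in> {0..<2 * n}" "P k = i" using sorts_position[OF so, of i] i by auto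
          then have "nearest (U i) (\<lambda>j. z j - x j) (arrs s' R i)" using J i unfolding J_def by blast
          then show ?thesis by (simp only: U_def)
        qed
      qed fact
    qed (use b2 n S R2 A2' bij dist in \<open>auto simp: T\<close>)
  qed (use b1 f1 n m sz H in \<open>auto simp: framed_def\<close>)
next
  show "\<bar>2 * (z i - x i) + 1\<bar> \<le> W \<and> \<bar>2 * (z i - x i)\<bar> \<le> W" if "i \<in> {0..<n}" for i
    using bd[OF that] by linarith
qed (use b n dist in \<open>auto simp: x_def z_def\<close>)

section \<open>The main sweep and the program\<close>

definition candidate :: "string \<Rightarrow> com" where
  "candidate X =
    Cond (Eq (Reg ''j'') (Const 0)) Skip
      (Assign ''y'' (Plus (Load ''D'' (Minus (Reg ''j'') (Const 1)))
         (Minus (Load X (Reg ''e'')) (Load X (Minus (Reg ''j'') (Const 1))))) ;;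
       Cond (Less (Reg ''q'') (Reg ''y'')) (Assign ''q'' (Reg ''y'')) Skip)"

definition evaluate :: com where
  "evaluate =
    (Assign ''j'' (Load ''U'' (Reg ''e'')) ;; candidate ''a'' ;;
     Assign ''j'' (Load ''L'' (Reg ''e'')) ;; candidate ''c'' ;;
     Store ''D'' (Reg ''e'') (Reg ''q'') ;;
     Store ''out'' (Reg ''e'') (Plus (Reg ''q'')
       (Plus (Minus (Load ''b'' (Reg ''e'')) (Load ''a'' (Reg ''e''))) (Const 1))))"

text \<open>Keys \<open>2 * a i\<close> for queries and \<open>2 * b j + 1\<close> for insertions
  place \<open>j\<close> before \<open>i\<close> exactly if \<open>b j < a i\<close>; with equality
  \<open>j\<close> still overlaps \<open>i\<close> and must stay out. The interval above
  \<open>d j\<close> should be unbounded, and the last entry of \<open>Sc\<close>, the largest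
  second coordinate of a start, serves as infinity. The inserted \<open>out\<close> value is
  \<open>D j + len j\<close>.\<close>

definition main_sweep :: com where
  "main_sweep =
    (init_keys ''K'' (dbl (Load ''a'' (Reg ''k''))) (Plus (dbl (Load ''b'' (Reg ''k''))) (Const 1)) ;;
     heap_sort ''K'' ''S'' ;;
     sweep ''T3'' ''Sc'' ''c'' (Load ''d'' (Reg ''j'')) (Load ''Sc'' (Minus (Reg ''N'') (Const 1)))
       (Load ''out'' (Reg ''j'')) evaluate)"

lemma evaluate_frames [simp]:
  "wregs (candidate X) = {''q'', ''y''}" "warrs (candidate X) = {}"
  "wregs evaluate = {''j'', ''q'', ''y''}" "warrs evaluate = {''D'', ''out''}"
  by (auto simp: candidate_def evaluate_def)

lemma candidate_spec:
  fixes s :: state and X :: string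
  defines "y \<equiv> arrs s ''D'' (regs s ''j'' - 1) + (arrs s X (regs s ''e'') - arrs s X (regs s ''j'' - 1))"
  assumes y: "regs s ''j'' \<noteq> 0 \<Longrightarrow> \<bar>y\<bar> \<le> W"
    and exit: "\<And>t s'. t \<le> 30 \<Longrightarrow> arrs s' = arrs s \<Longrightarrow> regs s' ''e'' = regs s ''e'' \<Longrightarrow>
      regs s' ''q'' = (if regs s ''j'' = 0 then regs s ''q'' else max (regs s ''q'') y) \<Longrightarrow> Q t s'"
  shows "wp W (candidate X) s Q"
proof (cases "regs s ''j'' = 0")
  case True
  then show ?thesis by (simp add: candidate_def exit)
next
  case False
  then have "\<bar>y\<bar> \<le> W" using y by simp
  then show ?thesis
    using False by (simp add: candidate_def y_def[symmetric] exit max_def)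
qed

context anchors
begin

text \<open>Both pointers lead to anchors with a smaller first coordinate, whose \<open>D\<close> is
  already in memory. No offer exceeds \<open>D i\<close>, so the intermediate values fit into a word
  because \<open>D i\<close> does.\<close>

lemma evaluate_spec:
  assumes A: "arrs s ''a'' = a" "arrs s ''b'' = b" "arrs s ''c'' = c"
    and i: "i \<in> {0..<n}" "regs s ''e'' = i"
    and U: "nearest (above i) (\<lambda>j. c j - a j) (arrs s ''U'' i)"
    and L: "nearest (beside i) (\<lambda>j. a j - c j) (arrs s ''L'' i)"
    and D: "\<And>j. j \<in> {0..<n} \<Longrightarrow> a j < a i \<Longrightarrow> arrs s ''D'' j = D j"
    and q: "regs s ''q'' = Max (insert 0 ((\<lambda>j. D j + len j) ` before i))"
    and W: "n \<le> W" "\<And>i. i \<in> {0..<n} \<Longrightarrow> b i \<le> W"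
  shows "wp W evaluate s (\<lambda>t s'. t \<le> 100 \<and> arrs s' = (arrs s)(''D'' := (arrs s ''D'')(i := D i),
    ''out'' := (arrs s ''out'')(i := D i + len i)))"
proof -
  let ?u = "arrs s ''U'' i" and ?l = "arrs s ''L'' i"
  note bi = anchor_bounds[OF i(1)] and Di = D_le[OF i(1)] and Wi = W(2)[OF i(1)]
  have u: "?u - 1 \<in> above i" "arrs s ''D'' (?u - 1) = D (?u - 1)" "0 \<le> D (?u - 1)"
      "D (?u - 1) + (a i - a (?u - 1)) \<le> D i" "a (?u - 1) < a i" if "?u \<noteq> 0"
  proof -
    show *: "?u - 1 \<in> above i" using that U by (auto simp: nearest_def split: if_splits)
    then have "?u - 1 \<in> {0..<n}" "a (?u - 1) < a i" by (auto simp: above_def)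
    then show "arrs s ''D'' (?u - 1) = D (?u - 1)" "0 \<le> D (?u - 1)" "a (?u - 1) < a i"
      using D D_le by auto
    show "D (?u - 1) + (a i - a (?u - 1)) \<le> D i" using D_above[OF i(1) *] .
  qed
  have l: "?l - 1 \<in> beside i" "arrs s ''D'' (?l - 1) = D (?l - 1)" "0 \<le> D (?l - 1)"
      "D (?l - 1) + (c i - c (?l - 1)) \<le> D i" "c (?l - 1) < c i" if "?l \<noteq> 0"
  proof -
    show *: "?l - 1 \<in> beside i" using that L by (auto simp: nearest_def split: if_splits)
    \<comment> \<open>Here \<open>a (?l - 1) < a i\<close> comes from the diagonal condition
      together with \<open>c (?l - 1) < c i\<close>.\<close>
    then have "?l - 1 \<in> {0..<n}" "c (?l - 1) < c i" "a (?l - 1) < a i" by (auto simp: beside_def)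
    then show "arrs s ''D'' (?l - 1) = D (?l - 1)" "0 \<le> D (?l - 1)" "c (?l - 1) < c i"
      using D D_le by auto
    show "D (?l - 1) + (c i - c (?l - 1)) \<le> D i" using D_beside[OF i(1) *] .
  qed
  have "?u = 0 \<or> ?u - 1 \<in> {0..<n}" "?l = 0 \<or> ?l - 1 \<in> {0..<n}"
    using u(1) l(1) by (auto simp: above_def beside_def)
  then have uW: "\<bar>?u\<bar> \<le> W" "\<bar>?l\<bar> \<le> W" using W(1) i(1) by auto
  define s1 where "s1 = s\<lparr>regs := (regs s)(''j'' := ?u)\<rparr>"
  have "wp W (candidate ''a'') s1 (\<lambda>t s2. wp W (Assign ''j'' (Load ''L'' (Reg ''e'')) ;; candidate ''c'' ;;
     Store ''D'' (Reg ''e'') (Reg ''q'') ;;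
     Store ''out'' (Reg ''e'') (Plus (Reg ''q'')
       (Plus (Minus (Load ''b'' (Reg ''e'')) (Load ''a'' (Reg ''e''))) (Const 1)))) s2
    (\<lambda>t' s'. 3 + (t + t') \<le> 100 \<and> arrs s' = (arrs s)(''D'' := (arrs s ''D'')(i := D i),
    ''out'' := (arrs s ''out'')(i := D i + len i))))"
  proof (rule candidate_spec)
    fix t :: nat and s2 :: state
    assume t: "t \<le> 30" and A2: "arrs s2 = arrs s1" and e2: "regs s2 ''e'' = regs s1 ''e''"
      and q2: "regs s2 ''q'' = (if regs s1 ''j'' = 0 then regs s1 ''q'' else max (regs s1 ''q'')
        (arrs s1 ''D'' (regs s1 ''j'' - 1) + (arrs s1 ''a'' (regs s1 ''e'') - arrs s1 ''a'' (regs s1 ''j'' - 1))))"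
    define s3 where "s3 = s2\<lparr>regs := (regs s2)(''j'' := ?l)\<rparr>"
    have "wp W (candidate ''c'') s3 (\<lambda>t' s4. wp W (Store ''D'' (Reg ''e'') (Reg ''q'') ;;
       Store ''out'' (Reg ''e'') (Plus (Reg ''q'')
       (Plus (Minus (Load ''b'' (Reg ''e'')) (Load ''a'' (Reg ''e''))) (Const 1)))) s4
      (\<lambda>t'' s'. 3 + (t + (3 + (t' + t''))) \<le> 100 \<and> arrs s' = (arrs s)(''D'' := (arrs s ''D'')(i := D i),
        ''out'' := (arrs s ''out'')(i := D i + len i))))"
    proof (rule candidate_spec)
      fix t' :: nat and s4 :: state
      assume t': "t' \<le> 30" and A4: "arrs s4 = arrs s3" and e4: "regs s4 ''e'' = regs s3 ''e''"
        and q4: "regs s4 ''q'' = (if regs s3 ''j'' = 0 then regs s3 ''q'' else max (regs s3 ''q'')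
          (arrs s3 ''D'' (regs s3 ''j'' - 1) + (arrs s3 ''c'' (regs s3 ''e'') - arrs s3 ''c'' (regs s3 ''j'' - 1))))"
      have A4: "arrs s4 = arrs s" using A2 A4 by (simp add: s1_def s3_def)
      have e4: "regs s4 ''e'' = i" using e2 e4 i by (simp add: s1_def s3_def)
      define M where "M = Max (insert 0 ((\<lambda>j. D j + len j) ` before i))"
      have fin: "finite (before i)" by (rule finite_subset[of _ "{0..<n}"]) (auto simp: before_def)
      have M0: "0 \<le> M" using fin by (simp add: M_def)
      have "regs s4 ''q'' = (let q1 = (if ?u = 0 then M else max M (D (?u - 1) + (a i - a (?u - 1)))) in
          if ?l = 0 then q1 else max q1 (D (?l - 1) + (c i - c (?l - 1))))"
        using q2 q4 q u(2) l(2) A A2 e2 i by (simp add: s1_def s3_def M_def Let_def)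
      also have "\<dots> = D i"
        using D_recurrence[OF i(1) U L] M0 unfolding M_def[symmetric] by (simp add: Let_def max_def)
      finally have q4: "regs s4 ''q'' = D i" .
      have "\<bar>D i\<bar> \<le> W" "\<bar>D i + (b i - a i + 1)\<bar> \<le> W" using Di bi Wi by auto
      then show "wp W (Store ''D'' (Reg ''e'') (Reg ''q'') ;;
       Store ''out'' (Reg ''e'') (Plus (Reg ''q'')
       (Plus (Minus (Load ''b'' (Reg ''e'')) (Load ''a'' (Reg ''e''))) (Const 1)))) s4
      (\<lambda>t'' s'. 3 + (t + (3 + (t' + t''))) \<le> 100 \<and> arrs s' = (arrs s)(''D'' := (arrs s ''D'')(i := D i),
        ''out'' := (arrs s ''out'')(i := D i + len i)))"
        using t t' by (simp add: A4 e4 q4 A)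
    qed (use l A A2 e2 i Di bi Wi in \<open>auto simp: s1_def s3_def\<close>)
    then show "wp W (Assign ''j'' (Load ''L'' (Reg ''e'')) ;; candidate ''c'' ;;
     Store ''D'' (Reg ''e'') (Reg ''q'') ;;
     Store ''out'' (Reg ''e'') (Plus (Reg ''q'')
       (Plus (Minus (Load ''b'' (Reg ''e'')) (Load ''a'' (Reg ''e''))) (Const 1)))) s2
      (\<lambda>t' s'. 3 + (t + t') \<le> 100 \<and> arrs s' = (arrs s)(''D'' := (arrs s ''D'')(i := D i),
        ''out'' := (arrs s ''out'')(i := D i + len i)))"
      using uW A2 e2 i by (simp add: s1_def s3_def)
  qed (use u A i Di bi Wi in \<open>auto simp: s1_def\<close>)
  then show ?thesis using uW i by (simp add: evaluate_def s1_def)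
qed

end

context anchors
begin

text \<open>The sweep respects all dependencies: the query of \<open>j\<close> precedes the
  insertion of \<open>j\<close> because \<open>2 * a j < 2 * b j + 1\<close>, and it precedes the
  query of every \<open>i\<close> with \<open>a j < a i\<close>. Anchors with equal first coordinate
  do not depend on each other, so their order is free.\<close>

lemma main_sweep_spec:
  assumes bw: "bounded W s" and N: "regs s ''N'' = n" "2 * n < 2 ^ h" "2 * 2 ^ h \<le> W"
    and m: "regs s ''m'' = 2 * n" and sz: "regs s ''sz'' = 2 ^ h"
    and H: "heap K0 (arrs s ''H'') h {}"
    and A: "arrs s ''a'' = a" "arrs s ''b'' = b" "arrs s ''c'' = c" "arrs s ''d'' = d"
    and S: "mono_on {0..<n} (arrs s ''Sc'')" "\<And>i. i \<in> {0..<n} \<Longrightarrow> c i \<in> arrs s ''Sc'' ` {0..<n}"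
    and T: "arrs s ''T3'' = (\<lambda>_. 0)"
    and U: "\<And>i. i \<in> {0..<n} \<Longrightarrow> nearest (above i) (\<lambda>j. c j - a j) (arrs s ''U'' i)"
    and L: "\<And>i. i \<in> {0..<n} \<Longrightarrow> nearest (beside i) (\<lambda>j. a j - c j) (arrs s ''L'' i)"
    and bd: "\<And>i. i \<in> {0..<n} \<Longrightarrow> 2 * b i + 1 \<le> W"
    and exit: "\<And>t s'. t \<le> 4000 * ((nat n + 1) * (h + 1)) \<Longrightarrow>
      (\<And>i. i \<in> {0..<n} \<Longrightarrow> arrs s' ''out'' i = max_coverage A (nat i)) \<Longrightarrow> Q t s'"
  shows "wp W main_sweep s Q"
  unfolding main_sweep_def wp_Seq
proof (rule init_keys_spec[where n = n and f = "\<lambda>i. 2 * a i" and g = "\<lambda>i. 2 * b i + 1"])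
  have n0: "0 \<le> n" by (simp add: n_def)
  fix t1 s1
  assume t1: "t1 \<le> 70 * (nat n + 1)" and b1: "bounded W s1" and f1: "framed {''k''} {''K''} s s1"
    and K: "\<And>i. i \<in> {0..<n} \<Longrightarrow> arrs s1 ''K'' i = 2 * a i"
      "\<And>i. i \<in> {0..<n} \<Longrightarrow> arrs s1 ''K'' (n + i) = 2 * b i + 1"
  define Ks where "Ks = arrs s1 ''K''"
  show "wp W (heap_sort ''K'' ''S'') s1 (\<lambda>t s'. wp W (sweep ''T3'' ''Sc'' ''c'' (Load ''d'' (Reg ''j''))
       (Load ''Sc'' (Minus (Reg ''N'') (Const 1))) (Load ''out'' (Reg ''j'')) evaluate) s'
     (\<lambda>t' s''. Q (t1 + (t + t')) s''))"
  proof (rule heap_sort_spec[where h = h and m = "2 * n" and ?K0.0 = K0])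
    fix t2 s2
    assume t2: "t2 \<le> 500 * ((nat (2 * n) + 1) * (h + 1))" and b2: "bounded W s2"
      and f2: "framed {''p'', ''x'', ''y'', ''k''} {''H'', ''O'', ''S''} s1 s2"
      and so: "sorts (arrs s1 ''K'') (2 * n) (arrs s2 ''O'') (arrs s2 ''S'')"
    define P where "P = arrs s2 ''O''"
    have so: "sorts Ks (2 * n) P (arrs s2 ''S'')" using so by (simp add: Ks_def P_def)
    have bij: "bij_betw P {0..<2 * n} {0..<2 * n}" using so by (simp add: sorts_def)
    have A2: "arrs s2 V = arrs s V" if "V \<notin> {''K'', ''H'', ''O'', ''S''}" for V
      using that f1 f2 by (auto simp: framed_def)
    have R2: "regs s2 ''N'' = n" "regs s2 ''m'' = 2 * n" "regs s2 ''sz'' = 2 ^ h"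
      using f1 f2 N m sz by (auto simp: framed_def)
    define Sc where "Sc = arrs s ''Sc''"
    define J where "J k X \<longleftrightarrow> X ''a'' = a \<and> X ''b'' = b \<and> X ''c'' = c \<and> X ''d'' = d \<and>
      X ''U'' = arrs s ''U'' \<and> X ''L'' = arrs s ''L'' \<and>
      (\<forall>i\<in>{0..<n}. (\<exists>k'\<in>{0..<k}. P k' = i) \<longrightarrow> X ''D'' i = D i \<and> X ''out'' i = D i + len i)"
      for k :: int and X :: "string \<Rightarrow> int \<Rightarrow> int"
    have Jstep: "J (k + 1) X" if "J k X" "0 \<le> k"
      "\<And>i. i \<in> {0..<n} \<Longrightarrow> P k = i \<Longrightarrow> X ''D'' i = D i \<and> X ''out'' i = D i + len i" for k X
    proof -
      have "{0..<k + 1} = insert k {0..<k}" using that by auto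
      then show ?thesis using that by (auto simp: J_def)
    qed
    have earlier: "\<exists>k'\<in>{0..<k}. P k' = i" if "k \<in> {0..<2 * n}" "i \<in> {0..<n}" "Ks i < Ks (P k)" for k i
    proof -
      have "i \<in> {0..<2 * n}" using that by auto
      then obtain k' where k': "k' \<in> {0..<2 * n}" "P k' = i" by (rule sorts_position[OF so])
      then have "k' < k" using sorts_less[OF so, of k' k] that by auto
      then show ?thesis using k' by auto
    qed
    show "wp W (sweep ''T3'' ''Sc'' ''c'' (Load ''d'' (Reg ''j''))
       (Load ''Sc'' (Minus (Reg ''N'') (Const 1))) (Load ''out'' (Reg ''j'')) evaluate) s2
     (\<lambda>t' s''. Q (t1 + (t2 + t')) s'')"
    proof (rule sweep_spec[where s = s2 and n = n and h = h and lo = d and hi = "\<lambda>_. Sc (n - 1)"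
          and val = "\<lambda>j. D j + len j" and J = J, folded P_def])
      show "J 0 (arrs s2)" by (simp add: J_def A2 A)
      show "J k X \<Longrightarrow> J k (X(''T3'' := w))" for k X w by (simp add: J_def)
      show "J (k + 1) X" if "J k X" "0 \<le> k" "P k = n + j" "j \<in> {0..<n}" for k X j
        by (rule Jstep) (use that in auto)
      show "aval (Load ''d'' (Reg ''j'')) s' = d j \<and>
          aval (Load ''Sc'' (Minus (Reg ''N'') (Const 1))) s' = Sc (n - 1) \<and>
          aval (Load ''out'' (Reg ''j'')) s' = D j + len j"
        if J: "J k (arrs s')" and k: "0 \<le> k" "k < 2 * n" "P k = n + j" "j \<in> {0..<n}"
          and s': "regs s' ''j'' = j" "regs s' ''N'' = n" "arrs s' ''Sc'' = arrs s2 ''Sc''" for k s' j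
      proof -
        have "Ks j < Ks (P k)" using K k anchor_bounds(2)[OF k(4)] by (simp add: Ks_def)
        then have "\<exists>k'\<in>{0..<k}. P k' = j" using k by (intro earlier) auto
        then have "arrs s' ''out'' j = D j + len j" using J k(4) unfolding J_def by blast
        then show ?thesis using J s' by (simp add: J_def A2 Sc_def)
      qed
      show "\<bar>d j\<bar> \<le> W \<and> \<bar>Sc (n - 1)\<bar> \<le> W \<and> \<bar>D j + len j\<bar> \<le> W" if "j \<in> {0..<n}" for j
        using boundedD(2)[OF bw, of "''d''" j] boundedD(2)[OF bw, of "''Sc''" "n - 1"] A
          D_le[OF that] bd[OF that] anchor_bounds[OF that] by (simp add: Sc_def)
      show "arrs s2 ''c'' i \<in> arrs s2 ''Sc'' ` {0..<n}" if "i \<in> {0..<n}" for i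
        using S(2)[OF that] A by (simp add: A2)
      show "wp W evaluate s' (\<lambda>t s''. t \<le> 100 \<and> J (k + 1) (arrs s''))"
        if J: "J k (arrs s')" and k: "0 \<le> k" "k < 2 * n" "P k = i" and i: "i \<in> {0..<n}"
          and s': "regs s' ''e'' = i" "regs s' ''N'' = n"
          and q: "regs s' ''q'' = best (inserted n P k) d (\<lambda>_. Sc (n - 1)) (\<lambda>j. D j + len j) (arrs s2 ''c'' i)"
        for k s' i
      proof -
        have "inserted n P k = {j \<in> {0..<n}. Ks (n + j) < Ks (P k)}"
        proof (rule inserted_sorts[OF so])
          show "Ks (n + j) \<noteq> Ks (P k)" if "j \<in> {0..<n}" for j
            using K(1)[OF i] K(2)[OF that] k unfolding Ks_def by presburger
        qed (use k in auto)
        also have "\<dots> = {j \<in> {0..<n}. b j < a i}"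
          using K(1)[OF i] K(2) k by (auto simp: Ks_def)
        finally have ins: "inserted n P k = {j \<in> {0..<n}. b j < a i}" .
        \<comment> \<open>Every query coordinate occurs in \<open>Sc\<close> and is thus at most its
          last entry, so the upper end of the inserted intervals excludes no query.\<close>
        have "c i \<le> Sc (n - 1)"
        proof -
          obtain k' where "k' \<in> {0..<n}" "c i = Sc k'" using S(2)[OF i] by (auto simp: Sc_def)
          then show ?thesis using mono_onD[OF S(1), of k' "n - 1"] by (simp add: Sc_def)
        qed
        then have "{j \<in> inserted n P k. d j < c i \<and> c i \<le> Sc (n - 1)} = before i"
          by (auto simp: ins before_def)
        then have q': "regs s' ''q'' = Max (insert 0 ((\<lambda>j. D j + len j) ` before i))"
          using q by (simp add: best_def A2 A)
        have DJ: "arrs s' ''D'' j = D j" if "j \<in> {0..<n}" "a j < a i" for j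
        proof -
          have "Ks j < Ks (P k)" using K(1) that i k by (simp add: Ks_def)
          then have "\<exists>k'\<in>{0..<k}. P k' = j" using k that by (intro earlier) auto
          then show ?thesis using J that unfolding J_def by blast
        qed
        have "wp W evaluate s' (\<lambda>t s''. t \<le> 100 \<and> arrs s'' = (arrs s')(''D'' := (arrs s' ''D'')(i := D i),
          ''out'' := (arrs s' ''out'')(i := D i + len i)))"
        proof (rule evaluate_spec)
          show "b i \<le> W" if "i \<in> {0..<n}" for i using bd[OF that] anchor_bounds[OF that] by simp
          show "n \<le> W" using N n0 by linarith
        qed (use J i s' U[OF i] L[OF i] DJ q' in \<open>auto simp: J_def\<close>)
        then show ?thesis
        proof (rule wp_mono)
          fix t s''
          assume 1: "t \<le> 100 \<and> arrs s'' = (arrs s')(''D'' := (arrs s' ''D'')(i := D i),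
            ''out'' := (arrs s' ''out'')(i := D i + len i))"
          have "J k (arrs s'')" using J 1 by (auto simp: J_def)
          then have "J (k + 1) (arrs s'')" by (rule Jstep) (use k 1 in auto)
          then show "t \<le> 100 \<and> J (k + 1) (arrs s'')" using 1 by simp
        qed
      qed
      show "Q (t1 + (t2 + t')) s'" if "t' \<le> 1000 * ((nat (2 * n) + 1) * (h + 1))"
        and J: "J (2 * n) (arrs s')" for t' s'
      proof (rule exit)
        show "t1 + (t2 + t') \<le> 4000 * ((nat n + 1) * (h + 1))"
          by (rule phase_time[OF t1 t2 that(1)])
        show "arrs s' ''out'' i = max_coverage A (nat i)" if i: "i \<in> {0..<n}" for i
        proof -
          obtain k where "k \<in> {0..<2 * n}" "P k = i" using sorts_position[OF so, of i] i by auto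
          then have "arrs s' ''out'' i = D i + len i" using J i unfolding J_def by blast
          then show ?thesis by (simp add: D_def)
        qed
      qed
    qed (use b2 n0 N S R2 bij T in \<open>auto simp: A2\<close>)
  qed (use b1 f1 n0 N m sz H in \<open>auto simp: framed_def\<close>)
next
  show "\<bar>2 * a i\<bar> \<le> W \<and> \<bar>2 * b i + 1\<bar> \<le> W" if "i \<in> {0..<n}" for i
    using bd[OF that] anchor_bounds[OF that] by linarith
  have "(0::int) \<le> 2 ^ h" by simp
  then show "n \<le> W" "0 \<le> W" using N by (simp_all add: n_def)
qed (use bw N in \<open>auto simp: A n_def\<close>)

end

section \<open>Tree size, the complete program and its resources\<close>

definition init_size :: com where
  "init_size =
    (Assign ''sz'' (Const 1) ;;
     While (Less (Reg ''sz'') (Plus (Plus (Reg ''N'') (Reg ''N'')) (Const 1)))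
       (Assign ''sz'' (dbl (Reg ''sz''))))"

text \<open>The size must exceed the number \<open>2 * n\<close> of events, and doubling a power of
  two that is at most \<open>2 * n\<close> keeps it within \<open>4 * n\<close>. Counting rounds by
  the decrease of \<open>2 * n + 1 - 2 ^ h\<close> gives only a linear bound, which is still below
  the total.\<close>

lemma init_size_spec:
  assumes b: "bounded W s" and n: "regs s ''N'' = n" "0 \<le> n" "4 * n + 2 \<le> W"
    and exit: "\<And>t s' h. t \<le> 30 * (nat n + 1) \<Longrightarrow> bounded W s' \<Longrightarrow> framed {''sz''} {} s s' \<Longrightarrow>
      regs s' ''sz'' = 2 ^ h \<Longrightarrow> 2 * n < 2 ^ h \<Longrightarrow> 2 ^ h \<le> 4 * n + 2 \<Longrightarrow> Q t s'"
  shows "wp W init_size s Q"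
proof -
  define s1 where "s1 = s\<lparr>regs := (regs s)(''sz'' := 1)\<rparr>"
  have b1: "bounded W s1" using b n by (auto simp: bounded_def s1_def)
  let ?b = "Less (Reg ''sz'') (Plus (Plus (Reg ''N'') (Reg ''N'')) (Const 1))"
  have "wp W (While ?b (Assign ''sz'' (dbl (Reg ''sz'')))) s1 (\<lambda>t. Q (Suc (Suc t)))"
  proof (rule wp_loop[where m = "nat (2 * n)" and T = 4 and
        I = "\<lambda>m s'. \<exists>h. regs s' ''sz'' = 2 ^ h \<and> 2 ^ h \<le> 4 * n + 2 \<and> m = nat (2 * n + 1 - 2 ^ h)"])
    show "\<exists>h. regs s1 ''sz'' = 2 ^ h \<and> 2 ^ h \<le> 4 * n + 2 \<and> nat (2 * n) = nat (2 * n + 1 - 2 ^ h)"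
      using n by (intro exI[of _ 0]) (simp add: s1_def)
  next
    fix m s'
    assume I: "\<exists>h. regs s' ''sz'' = 2 ^ h \<and> 2 ^ h \<le> 4 * n + 2 \<and> m = nat (2 * n + 1 - 2 ^ h)"
      and g: "bval ?b s'" and f: "framed (wregs (Assign ''sz'' (dbl (Reg ''sz'')))) (warrs (Assign ''sz'' (dbl (Reg ''sz'')))) s1 s'"
    have N: "regs s' ''N'' = n" using framed_regs[OF f] n by (simp add: s1_def)
    obtain h where h: "regs s' ''sz'' = 2 ^ h" "2 ^ h \<le> 4 * n + 2" "m = nat (2 * n + 1 - 2 ^ h)"
      using I by auto
    have "(2::int) ^ h < 2 * n + 1" using g h N by simp
    moreover have "(1::int) \<le> 2 ^ h" by simp
    ultimately have h': "2 ^ Suc h \<le> 4 * n + 2" "nat (2 * n + 1 - 2 ^ Suc h) < m" "\<bar>(2::int) ^ h + 2 ^ h\<bar> \<le> W"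
      using h n by simp_all
    have "\<exists>m'<m. \<exists>h'. 2 ^ h + 2 ^ h = (2::int) ^ h' \<and> 2 ^ h' \<le> 4 * n + 2 \<and>
        m' = nat (2 * n + 1 - 2 ^ h')"
    proof (rule exI[of _ "nat (2 * n + 1 - 2 ^ Suc h)"], rule conjI)
      show "\<exists>h'. 2 ^ h + 2 ^ h = (2::int) ^ h' \<and> 2 ^ h' \<le> 4 * n + 2 \<and>
          nat (2 * n + 1 - 2 ^ Suc h) = nat (2 * n + 1 - 2 ^ h')"
        by (rule exI[of _ "Suc h"]) (use h' in simp)
    qed fact
    with h' show "wp W (Assign ''sz'' (dbl (Reg ''sz''))) s' (\<lambda>t s''. t \<le> 4 \<and>
       (\<exists>m'<m. \<exists>h. regs s'' ''sz'' = 2 ^ h \<and> 2 ^ h \<le> 4 * n + 2 \<and> m' = nat (2 * n + 1 - 2 ^ h)))"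
      using h by simp
  next
    fix m' t s'
    assume I: "\<exists>h. regs s' ''sz'' = 2 ^ h \<and> 2 ^ h \<le> 4 * n + 2 \<and> m' = nat (2 * n + 1 - 2 ^ h)"
      and g: "\<not> bval ?b s'" and b': "bounded W s'"
      and f: "framed (wregs (Assign ''sz'' (dbl (Reg ''sz'')))) (warrs (Assign ''sz'' (dbl (Reg ''sz'')))) s1 s'"
      and t: "t \<le> (nat (2 * n) + 1) * (1 + bcost ?b + 4)"
    have N: "regs s' ''N'' = n" using framed_regs[OF f] n by (simp add: s1_def)
    obtain h where h: "regs s' ''sz'' = 2 ^ h" "2 ^ h \<le> 4 * n + 2" using I by auto
    show "Q (Suc (Suc t)) s'"
    proof (rule exit)
      show "Suc (Suc t) \<le> 30 * (nat n + 1)" using t n by (simp add: nat_mult_distrib)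
      show "framed {''sz''} {} s s'" using f by (auto simp: framed_def s1_def)
    qed (use b' h g N in auto)
  qed (use b1 in auto)
  then show ?thesis using n by (simp add: init_size_def s1_def)
qed

text \<open>Each sweep has its own tree array, because a sweep expects an all-zero tree and does not
  restore it. \<open>m\<close> is the number of items to sort: \<open>n\<close> coordinates at
  first, then \<open>2 * n\<close> events.\<close>

definition program :: com where
  "program =
    (init_size ;;
     Assign ''m'' (Reg ''N'') ;; heap_sort ''c'' ''Sc'' ;; heap_sort ''a'' ''Sa'' ;;
     Assign ''m'' (Plus (Reg ''N'') (Reg ''N'')) ;;
     pointers ''a'' ''b'' ''c'' ''Sa'' ''T1'' ''U'' ;;
     pointers ''c'' ''d'' ''a'' ''Sc'' ''T2'' ''L'' ;;
     main_sweep)"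

lemma sorts_image: "sorts K m P S \<Longrightarrow> i \<in> {0..<m} \<Longrightarrow> K i \<in> S ` {0..<m}"
  using sorts_position[of K m P S i] unfolding sorts_def by (metis image_eqI)

context anchors
begin

lemma program_spec:
  assumes b0: "bounded W (input_state A)" and W: "8 * n + 4 \<le> W" "\<And>i. i \<in> {0..<n} \<Longrightarrow> 2 * b i + 1 \<le> W"
    "\<And>i. i \<in> {0..<n} \<Longrightarrow> 2 * d i + 1 \<le> W"
  shows "wp W program (input_state A) (\<lambda>t s'. (\<exists>h. 2 ^ h \<le> 4 * n + 2 \<and>
    t \<le> 15000 * ((nat n + 1) * (h + 1))) \<and> (\<forall>i\<in>{0..<n}. arrs s' ''out'' i = max_coverage A (nat i)))"
  unfolding program_def wp_Seq
proof (rule init_size_spec[where n = n], goal_cases)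
  case (5 t0 s0 h)
  have n0: "0 \<le> n" by (simp add: n_def)
  have hW: "2 * 2 ^ h \<le> W" using 5(6) W(1) by linarith
  have s0: "bounded W s0" "regs s0 ''N'' = n" "regs s0 ''sz'' = 2 ^ h" "2 * n < 2 ^ h" "arrs s0 = arrs (input_state A)"
    using 5 by (auto simp: framed_def input_state_def n_def)
  have z: "arrs s0 ''H'' = (\<lambda>_. 0)" "arrs s0 ''T1'' = (\<lambda>_. 0)" "arrs s0 ''T2'' = (\<lambda>_. 0)"
    "arrs s0 ''T3'' = (\<lambda>_. 0)" "arrs s0 ''a'' = a" "arrs s0 ''b'' = b" "arrs s0 ''c'' = c" "arrs s0 ''d'' = d"
    by (simp_all add: s0 input_state_def a_def b_def c_def d_def)
  define s1 where "s1 = s0\<lparr>regs := (regs s0)(''m'' := n)\<rparr>"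
  have nW: "\<bar>n\<bar> \<le> W" "\<bar>n + n\<bar> \<le> W" using W(1) n0 by auto
  have acW: "\<bar>2 * a i - 2 * c i\<bar> + 1 \<le> W" "\<bar>2 * c i - 2 * a i\<bar> + 1 \<le> W" if "i \<in> {0..<n}" for i
    using anchor_bounds[OF that] W(2,3)[OF that] by linarith+
  let ?G = "(nat n + 1) * (h + 1)"
  show ?case
    unfolding wp_Assign aval.simps s0(2) s1_def[symmetric]
  proof (intro conjI nW(1), rule heap_sort_spec[where h = h and m = n and ?K0.0 = "\<lambda>_. 0"], goal_cases)
    case s2: (13 t2 s2)
    have R2: "regs s2 ''N'' = n" "regs s2 ''sz'' = 2 ^ h" "regs s2 ''m'' = n"
      using s2(3) s0(1-4) by (auto simp: framed_def s1_def)
    have A2: "arrs s2 X = arrs s0 X" if "X \<notin> {''H'', ''O'', ''Sc''}" for X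
      using s2(3) that by (auto simp: framed_def s1_def)
    have Sc: "sorts c n (arrs s2 ''O'') (arrs s2 ''Sc'')" using s2(5) z by (simp add: s1_def)
    then have Scm: "mono_on {0..<n} (arrs s2 ''Sc'')" by (simp add: sorts_def)
    show ?case
    proof (rule heap_sort_spec[where h = h and m = n and ?K0.0 = "\<lambda>_. 0"], goal_cases)
      case s3: (13 t3 s3)
      have R3: "regs s3 ''N'' = n" "regs s3 ''sz'' = 2 ^ h"
        using s3(3) R2 by (auto simp: framed_def)
      have A3: "arrs s3 X = arrs s0 X" if "X \<notin> {''H'', ''O'', ''Sc'', ''Sa''}" for X
        using s3(3) A2[of X] that by (auto simp: framed_def)
      have Sa: "sorts a n (arrs s3 ''O'') (arrs s3 ''Sa'')" using s3(5) z by (simp add: A2)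
      then have Sam: "mono_on {0..<n} (arrs s3 ''Sa'')" by (simp add: sorts_def)
      have Sc3: "arrs s3 ''Sc'' = arrs s2 ''Sc''" using s3(3) by (auto simp: framed_def)
      define s4 where "s4 = s3\<lparr>regs := (regs s3)(''m'' := n + n)\<rparr>"
      show ?case
        unfolding aval.simps R3(1) s4_def[symmetric]
      proof (intro conjI nW(2), rule pointers_spec[where h = h and n = n and ?K0.0 = "\<lambda>_. 0"], goal_cases)
        case s5: (14 t5 s5)
        have R5: "regs s5 ''N'' = n" "regs s5 ''sz'' = 2 ^ h" "regs s5 ''m'' = 2 * n"
          using s5(3) R3 by (auto simp: framed_def s4_def)
        have A5: "arrs s5 X = arrs s3 X" if "X \<notin> {''K'', ''H'', ''O'', ''S'', ''T1'', ''U''}" for X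
          using s5(3) that by (auto simp: framed_def s4_def)
        have U: "nearest (above i) (\<lambda>j. c j - a j) (arrs s5 ''U'' i)" if "i \<in> {0..<n}" for i
          using s5(5)[OF that] by (simp add: s4_def A3 z above_def)
        show ?case
        proof (rule pointers_spec[where h = h and n = n and ?K0.0 = "\<lambda>_. 0"], goal_cases)
          case s6: (14 t6 s6)
          have R6: "regs s6 ''N'' = n" "regs s6 ''sz'' = 2 ^ h" "regs s6 ''m'' = 2 * n"
            using s6(3) R5 by (auto simp: framed_def)
          have A6: "arrs s6 X = arrs s5 X" if "X \<notin> {''K'', ''H'', ''O'', ''S'', ''T2'', ''L''}" for X
            using s6(3) that by (auto simp: framed_def)
          have L: "nearest (beside i) (\<lambda>j. a j - c j) (arrs s6 ''L'' i)" if "i \<in> {0..<n}" for i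
            using s6(5)[OF that] by (simp add: A5 A3 z beside_def)
          show ?case
          proof (rule main_sweep_spec[where h = h and ?K0.0 = "\<lambda>_. 0"], goal_cases)
            case s7: (18 t7 s7)
            have "nat n + 1 \<le> ?G" "1 \<le> ?G" by simp_all
            \<comment> \<open>The phases add up to
              \<open>30 + 4 + 500 + 500 + 8 + 3 * 4000 = 13042\<close>.\<close>
            moreover have "t0 + (4 + (t2 + (t3 + (8 + (t5 + (t6 + t7)))))) \<le> 15000 * G"
              if "t0 \<le> 30 * N" "t2 \<le> 500 * G" "t3 \<le> 500 * G" "t5 \<le> 4000 * G" "t6 \<le> 4000 * G"
                "t7 \<le> 4000 * G" "N \<le> G" "1 \<le> G" for N G
              using that by linarith
            ultimately have "t0 + (4 + (t2 + (t3 + (8 + (t5 + (t6 + t7)))))) \<le> 15000 * ?G"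
              using 5(1) s2(1) s3(1) s5(1) s6(1) s7(1) by blast
            then show ?case using s7(2) 5(6) by (auto intro!: exI[of _ h])
          qed (use s6 R6 s0(1-4) hW U L W Scm Sc3 sorts_image[OF Sc] in \<open>auto simp: A6 A5 A3 z\<close>)
        qed (use s5 R5 s0(1-4) n0 hW acW Scm Sc3 sorts_image[OF Sc] in \<open>auto simp: A5 A3 z\<close>)
      qed (use s3 R3 s0(1-4) n0 hW acW nW Sam sorts_image[OF Sa] in \<open>auto simp: s4_def bounded_def A3 z\<close>)
    qed (use s0(1-4) s1_def s2 n0 hW R2 in \<open>auto simp: bounded_def\<close>)
  qed (use s0(1-4) n0 hW nW z heap_zero in \<open>auto simp: s1_def bounded_def\<close>)
qed (use b0 W(1) in \<open>auto simp: input_state_def n_def\<close>)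

end

lemma max_endpoint_nonneg: "0 \<le> max_endpoint A"
  unfolding max_endpoint_def by (intro Max_ge) auto

lemma max_endpoint_ge:
  assumes "I \<in> set A"
  shows "I_b I \<le> max_endpoint A" "I_d I \<le> max_endpoint A"
  unfolding max_endpoint_def using assms by (auto intro: Max_ge)

lemma input_bounded:
  assumes "\<And>I. I \<in> set A \<Longrightarrow> valid_anchor I" "int (length A) \<le> W" "max_endpoint A \<le> W"
  shows "bounded W (input_state A)"
proof -
  have W: "0 \<le> W" using assms(3) max_endpoint_nonneg[of A] by linarith
  have "\<bar>input_array f A k\<bar> \<le> W" if "f \<in> {I_a, I_b, I_c, I_d}" for f k
  proof (cases "0 \<le> k \<and> k < int (length A)")
    case True
    then have "A ! nat k \<in> set A" by auto
    from assms(1)[OF this] max_endpoint_ge[OF this] show ?thesis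
      using True that assms(3) by (auto simp: input_array_def valid_anchor_def)
  qed (use W in \<open>auto simp: input_array_def\<close>)
  then show ?thesis using W assms(2) by (auto simp: bounded_def input_state_def)
qed

text \<open>The base is at least 2, so five further factors supply the constant 32, which leaves
  room for doubled keys and tree positions.\<close>

lemma word_bound_ge: "32 * int (length A) + 32 * max_endpoint A + 64 \<le> word_bound 6 A"
proof -
  define x where "x = int (length A) + max_endpoint A + 2"
  have "2 \<le> x" using max_endpoint_nonneg[of A] by (simp add: x_def)
  then have "2 ^ 5 \<le> x ^ 5" by (intro power_mono) auto
  then have "x * 32 \<le> x * x ^ 5" using \<open>2 \<le> x\<close> by (intro mult_left_mono) auto
  then have "x * 32 \<le> x ^ 6" by (simp flip: power_Suc)
  then show ?thesis by (simp add: word_bound_def x_def algebra_simps)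
qed

theorem theorem2:
  shows "\<exists>(prog :: com) (k :: nat) (T :: nat \<Rightarrow> real).
    T \<in> O(\<lambda>N. real N * ln (real N)) \<and>
    (\<forall>A :: anchor list.
       (\<forall>I\<in>set A. valid_anchor I) \<and> equal_match_length A \<longrightarrow>
       (\<exists>t s. exec (word_bound k A) prog (input_state A) t s \<and>
              real t \<le> T (length A) \<and>
              (\<forall>i<length A. arrs s ''out'' (int i) = max_coverage A i)))"
proof -
  \<comment> \<open>\<open>2 ^ h <= 4 * N + 2\<close> turns the height into a logarithm to base 2;
    the added constants keep the bound valid for \<open>N = 0\<close>, where \<open>N * ln N\<close>
    vanishes.\<close>
  define T where "T = (\<lambda>N. 15000 * ((real N + 1) * (log 2 (4 * real N + 2) + 1)))"
  show ?thesis
  proof (rule exI[of _ program], rule exI[of _ 6], rule exI[of _ T], intro conjI allI impI)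
    show "T \<in> O(\<lambda>N. real N * ln (real N))"
      unfolding T_def by real_asymp
    fix A :: "anchor list"
    assume A: "(\<forall>I\<in>set A. valid_anchor I) \<and> equal_match_length A"
    interpret anchors A using A by unfold_locales auto
    define W where "W = word_bound 6 A"
    have M0: "0 \<le> max_endpoint A" by (rule max_endpoint_nonneg)
    have W: "32 * n + 32 * max_endpoint A + 64 \<le> W" using word_bound_ge by (simp add: W_def n_def)
    have n0: "0 \<le> n" by (simp add: n_def)
    have le: "b i \<le> max_endpoint A" "d i \<le> max_endpoint A" if "i \<in> {0..<n}" for i
      using max_endpoint_ge[OF in_set[OF that]] endpoint_simps[OF that] by simp_all
    have "bounded W (input_state A)"
      using A W M0 n0 by (intro input_bounded) (auto simp: n_def)
    then have "wp W program (input_state A) (\<lambda>t s'. (\<exists>h. 2 ^ h \<le> 4 * n + 2 \<and>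
      t \<le> 15000 * ((nat n + 1) * (h + 1))) \<and> (\<forall>i\<in>{0..<n}. arrs s' ''out'' i = max_coverage A (nat i)))"
    proof (rule program_spec)
      show "8 * n + 4 \<le> W" using W M0 n0 by linarith
      show "2 * b i + 1 \<le> W" "2 * d i + 1 \<le> W" if "i \<in> {0..<n}" for i
        using le[OF that] W M0 n0 by linarith+
    qed
    then obtain t s h where ex: "exec W program (input_state A) t s" and h: "2 ^ h \<le> 4 * n + 2"
      and t: "t \<le> 15000 * ((nat n + 1) * (h + 1))"
      and out: "\<forall>i\<in>{0..<n}. arrs s ''out'' i = max_coverage A (nat i)"
      unfolding wp_def by blast
    have "real_of_int (2 ^ h) \<le> real_of_int (4 * n + 2)" using h by (rule of_int_le_iff[THEN iffD2])
    then have "2 ^ h \<le> 4 * real (length A) + 2" by (simp add: n_def)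
    then have h': "real h \<le> log 2 (4 * real (length A) + 2)" by (intro le_log_of_power) auto
    have "real t \<le> real (15000 * ((nat n + 1) * (h + 1)))" using t by (rule of_nat_mono)
    also have "\<dots> = 15000 * ((real (length A) + 1) * (real h + 1))" by (simp add: n_def algebra_simps)
    also have "\<dots> \<le> T (length A)" unfolding T_def by (intro mult_left_mono add_right_mono h') auto
    finally have "real t \<le> T (length A)" .
    moreover have "\<forall>i<length A. arrs s ''out'' (int i) = max_coverage A i"
      using out by (auto simp: n_def)
    ultimately show "\<exists>t s. exec (word_bound 6 A) program (input_state A) t s \<and> real t \<le> T (length A) \<and>
        (\<forall>i<length A. arrs s ''out'' (int i) = max_coverage A i)"
      using ex unfolding W_def by blast
  qed
qed

end
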